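(* Let $w$ be a fixed constant. There is an algorithm that, given a cognitive radio network whose potential graph has treewidth at most $w$, decides whether it is connectable in time $2^{O(k)}n^{O(1)}$, where $n$ is the number of SUs and $k$ the number of channels (the constants hidden in the $O(\cdot)$ may depend on $w$).
   Context: A cognitive radio network consists of: a finite set $U$ of secondary users (SUs), $n=|U|$; a finite set $C$ of channels, $k=|C|$; for each $u\in U$ a spectrum map $\textsc{SpecMap}(u)\subseteq C$; a simple undirected graph $\mathcal{PG}=(U,E)$ called the potential graph; and for each $u\in U$ a positive integer antenna budget $\beta(u)$. A spectrum assignment is a function $\mathcal{SA}:U\to 2^C$ with $\mathcal{SA}(u)\subseteq \textsc{SpecMap}(u)$ and $|\mathcal{SA}(u)|\le\beta(u)$ for all $u$. A potential edge $\{u,v\}\in E$ is realized under $\mathcal{SA}$ if $\mathcal{SA}(u)\cap\mathcal{SA}(v)\neq\emptyset$; the realization graph is $(U,E')$ where $E'$ is the set of realized edges. The network is connectable if some spectrum assignment makes the realization graph connected. Treewidth is the standard graph parameter (minimum width of a tree decomposition). *)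

theory Defs
  imports "Graph_Theory.Graph_Theory"
begin

section \<open>Treewidth\<close>

text \<open>
  Simple undirected graphs are represented as in the library: finite, symmetric, loop-free
  digraphs (locale \<^locale>\<open>pair_graph\<close>).

  The library constant \<^const>\<open>tree\<close> is not the notion needed here: its acyclicity condition is the
  directed one, so a symmetric graph with an edge always fails it (an edge and its reverse form a
  cycle of length 2). In a symmetric loop-free digraph the cycles of the undirected graph are
  exactly the directed cycles of length at least 3.
\<close>

definition undirected_tree :: "'a pair_pre_digraph \<Rightarrow> bool" where
  "undirected_tree T \<longleftrightarrow> pair_graph T \<and> connected (with_proj T) \<and>
     \<not> (\<exists>p. pre_digraph.cycle (with_proj T) p \<and> 3 \<le> length p)"

text \<open>
  \<^const>\<open>connected\<close> includes non-emptiness, so the last condition says that the nodes whose bag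
  contains \<open>v\<close> induce a non-empty subtree.
\<close>

definition tree_decomposition ::
    "'a pair_pre_digraph \<Rightarrow> 'b pair_pre_digraph \<Rightarrow> ('b \<Rightarrow> 'a set) \<Rightarrow> bool" where
  "tree_decomposition G T B \<longleftrightarrow>
     undirected_tree T \<and>
     (\<Union>i\<in>pverts T. B i) = pverts G \<and>
     (\<forall>(u, v)\<in>parcs G. \<exists>i\<in>pverts T. u \<in> B i \<and> v \<in> B i) \<and>
     (\<forall>v\<in>pverts G. connected (with_proj T \<restriction> {i \<in> pverts T. v \<in> B i}))"

text \<open>
  Subtraction truncates only if all bags are empty, that is, for the graph without vertices, which
  thus gets treewidth 0 instead of -1.
\<close>

definition td_width :: "'b pair_pre_digraph \<Rightarrow> ('b \<Rightarrow> 'a set) \<Rightarrow> nat" where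
  "td_width T B = Max ((\<lambda>i. card (B i)) ` pverts T) - 1"

text \<open>
  Decomposition trees are finite, so taking their nodes from \<^typ>\<open>nat\<close> is no restriction.
  For a finite graph the minimum is over a non-empty set (one bag containing everything).
\<close>

definition treewidth :: "'a pair_pre_digraph \<Rightarrow> nat" where
  "treewidth G =
     (LEAST w. \<exists>(T :: nat pair_pre_digraph) B. tree_decomposition G T B \<and> td_width T B = w)"

section \<open>Cognitive radio networks\<close>

record ('u, 'c) crn =
  users :: "'u set"
  channels :: "'c set"
  spec_map :: "'u \<Rightarrow> 'c set"
  potential_graph :: "'u pair_pre_digraph"
  budget :: "'u \<Rightarrow> nat"

locale cognitive_radio_network =
  fixes N :: "('u, 'c) crn"
  assumes finite_users: "finite (users N)"
    and finite_channels: "finite (channels N)"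
    and spec_map_subset: "u \<in> users N \<Longrightarrow> spec_map N u \<subseteq> channels N"
    and potential_graph: "pair_graph (potential_graph N)"
    and potential_verts: "pverts (potential_graph N) = users N"
    and budget_pos: "u \<in> users N \<Longrightarrow> 0 < budget N u"

definition spectrum_assignment :: "('u, 'c) crn \<Rightarrow> ('u \<Rightarrow> 'c set) \<Rightarrow> bool" where
  "spectrum_assignment N SA \<longleftrightarrow>
     (\<forall>u\<in>users N. SA u \<subseteq> spec_map N u \<and> card (SA u) \<le> budget N u)"

definition realization_graph :: "('u, 'c) crn \<Rightarrow> ('u \<Rightarrow> 'c set) \<Rightarrow> 'u pair_pre_digraph" where
  "realization_graph N SA =
     \<lparr> pverts = users N,
       parcs = {(u, v) \<in> parcs (potential_graph N). SA u \<inter> SA v \<noteq> {}} \<rparr>"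

text \<open>By the library's convention, the graph without vertices is not connected.\<close>

definition connectable :: "('u, 'c) crn \<Rightarrow> bool" where
  "connectable N \<longleftrightarrow>
     (\<exists>SA. spectrum_assignment N SA \<and> connected (with_proj (realization_graph N SA)))"

section \<open>Model of computation\<close>

text \<open>
  Algorithms are programs of a first-order functional language on binary trees (pure first-order
  Lisp without symbols; the language F of N. D. Jones, \<^emph>\<open>Computability and Complexity\<close>, with
  several functions and several parameters). A program is a list of function bodies, and function 0
  is the main function. Variables are de Bruijn indices into the environment, which holds the
  actual parameters of the current call and the values bound by enclosing \<open>Let\<close>s.

  The running time is the number of expression evaluations. There is no equality test
  on trees and no arithmetic, and the length of the environment is bounded by a constant
  depending only on the program. Hence, with trees represented by pointers, each evaluation step
  takes a constant number of operations of a pointer machine or RAM, so running times agree with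
  those of the usual machine models up to a polynomial.
\<close>

datatype data = Nl | Cns data data

datatype exp =
    Var nat
  | Nul
  | Cons exp exp
  | Hd exp
  | Tl exp
  | If exp exp exp
  | Let exp exp
  | Call nat "exp list"

type_synonym program = "exp list"

fun hd_data :: "data \<Rightarrow> data" where
  "hd_data Nl = Nl"
| "hd_data (Cns x y) = x"

fun tl_data :: "data \<Rightarrow> data" where
  "tl_data Nl = Nl"
| "tl_data (Cns x y) = y"

text \<open>
  \<open>eval P env e v t\<close>: in environment \<open>env\<close>, evaluation of \<open>e\<close> terminates with value \<open>v\<close>
  after \<open>t\<close> steps. Out-of-range variables and calls of undefined functions have no value.
\<close>

inductive eval :: "program \<Rightarrow> data list \<Rightarrow> exp \<Rightarrow> data \<Rightarrow> nat \<Rightarrow> bool"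
  and evals :: "program \<Rightarrow> data list \<Rightarrow> exp list \<Rightarrow> data list \<Rightarrow> nat \<Rightarrow> bool"
  for P :: program where
  eval_Var: "i < length env \<Longrightarrow> eval P env (Var i) (env ! i) 1"
| eval_Nul: "eval P env Nul Nl 1"
| eval_Cons: "eval P env e1 v1 t1 \<Longrightarrow> eval P env e2 v2 t2 \<Longrightarrow>
    eval P env (Cons e1 e2) (Cns v1 v2) (t1 + t2 + 1)"
| eval_Hd: "eval P env e v t \<Longrightarrow> eval P env (Hd e) (hd_data v) (t + 1)"
| eval_Tl: "eval P env e v t \<Longrightarrow> eval P env (Tl e) (tl_data v) (t + 1)"
| eval_If_then: "eval P env e1 v1 t1 \<Longrightarrow> v1 \<noteq> Nl \<Longrightarrow> eval P env e2 v t2 \<Longrightarrow>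
    eval P env (If e1 e2 e3) v (t1 + t2 + 1)"
| eval_If_else: "eval P env e1 Nl t1 \<Longrightarrow> eval P env e3 v t3 \<Longrightarrow>
    eval P env (If e1 e2 e3) v (t1 + t3 + 1)"
| eval_Let: "eval P env e1 v1 t1 \<Longrightarrow> eval P (v1 # env) e2 v t2 \<Longrightarrow>
    eval P env (Let e1 e2) v (t1 + t2 + 1)"
| eval_Call: "evals P env es vs t1 \<Longrightarrow> f < length P \<Longrightarrow> eval P vs (P ! f) v t2 \<Longrightarrow>
    eval P env (Call f es) v (t1 + t2 + 1)"
| evals_Nil: "evals P env [] [] 0"
| evals_Cons: "eval P env e v t1 \<Longrightarrow> evals P env es vs t2 \<Longrightarrow>
    evals P env (e # es) (v # vs) (t1 + t2)"

inductive_cases eval_elims: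
  "eval P env (Var i) v t"
  "eval P env Nul v t"
  "eval P env (Cons e1 e2) v t"
  "eval P env (Hd e) v t"
  "eval P env (Tl e) v t"
  "eval P env (If e1 e2 e3) v t"
  "eval P env (Let e1 e2) v t"
  "eval P env (Call f es) v t"

inductive_cases evals_elims:
  "evals P env [] vs t"
  "evals P env (e # es) vs t"

lemma eval_deterministic:
  "eval P env e v t \<Longrightarrow> eval P env e v' t' \<Longrightarrow> v' = v \<and> t' = t"
  "evals P env es vs t \<Longrightarrow> evals P env es vs' t' \<Longrightarrow> vs' = vs \<and> t' = t"
proof (induction arbitrary: v' t' and vs' t' rule: eval_evals.inducts)
  case (eval_If_then env e1 v1 t1 e2 v t2 e3)
  from eval_If_then.prems show ?case
    by (elim eval_elims(6)) (metis Suc_eq_plus1 eval_If_then.IH eval_If_then.hyps)+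
next
  case (eval_If_else env e1 t1 e3 v t3 e2)
  from eval_If_else.prems show ?case
    by (elim eval_elims(6)) (metis Suc_eq_plus1 eval_If_else.IH)+
next
  case (eval_Var i env)
  from eval_Var.prems show ?case by (elim eval_elims(1)) simp
next
  case (eval_Nul env)
  from eval_Nul.prems show ?case by (elim eval_elims(2)) simp
next
  case (eval_Cons env e1 v1 t1 e2 v2 t2)
  from eval_Cons.prems show ?case by (elim eval_elims(3)) (metis Suc_eq_plus1 eval_Cons.IH)
next
  case (eval_Hd env e v t)
  from eval_Hd.prems show ?case by (elim eval_elims(4)) (metis Suc_eq_plus1 eval_Hd.IH)
next
  case (eval_Tl env e v t)
  from eval_Tl.prems show ?case by (elim eval_elims(5)) (metis Suc_eq_plus1 eval_Tl.IH)
next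
  case (eval_Let env e1 v1 t1 e2 v t2)
  from eval_Let.prems show ?case by (elim eval_elims(7)) (metis Suc_eq_plus1 eval_Let.IH)
next
  case (eval_Call env es vs t1 f v t2)
  from eval_Call.prems show ?case by (elim eval_elims(8)) (metis Suc_eq_plus1 eval_Call.IH)
next
  case (evals_Nil env)
  from evals_Nil.prems show ?case by (elim evals_elims(1)) simp
next
  case (evals_Cons env e v t1 es vs t2)
  from evals_Cons.prems show ?case by (elim evals_elims(2)) (metis evals_Cons.IH)
qed

definition runs :: "program \<Rightarrow> data \<Rightarrow> data \<Rightarrow> nat \<Rightarrow> bool" where
  "runs P x y t \<longleftrightarrow> 0 < length P \<and> eval P [x] (P ! 0) y t"

section \<open>Encoding of networks\<close>

fun enc_list :: "data list \<Rightarrow> data" where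
  "enc_list [] = Nl"
| "enc_list (x # xs) = Cns x (enc_list xs)"

definition enc_bool :: "bool \<Rightarrow> data" where
  "enc_bool b = (if b then Cns Nl Nl else Nl)"

text \<open>Binary numerals, least significant bit first, without leading zeros.\<close>

fun bits :: "nat \<Rightarrow> bool list" where
  "bits m = (if m = 0 then [] else odd m # bits (m div 2))"

declare bits.simps [simp del]

definition enc_nat :: "nat \<Rightarrow> data" where
  "enc_nat m = enc_list (map enc_bool (bits m))"

definition enc_matrix :: "('a \<Rightarrow> 'b \<Rightarrow> bool) \<Rightarrow> 'a list \<Rightarrow> 'b list \<Rightarrow> data" where
  "enc_matrix R xs ys = enc_list (map (\<lambda>x. enc_list (map (\<lambda>y. enc_bool (R x y)) ys)) xs)"

text \<open>
  The input given to an algorithm, relative to listings \<open>us\<close> of the users and \<open>cs\<close> of the channels: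
  the incidence matrix of the spectrum map, the adjacency matrix of the potential graph, and
  the list of antenna budgets.
\<close>

definition enc_network :: "('u, 'c) crn \<Rightarrow> 'u list \<Rightarrow> 'c list \<Rightarrow> data" where
  "enc_network N us cs = enc_list
     [enc_matrix (\<lambda>u c. c \<in> spec_map N u) us cs,
      enc_matrix (\<lambda>u v. (u, v) \<in> parcs (potential_graph N)) us us,
      enc_list (map (\<lambda>u. enc_nat (budget N u)) us)]"

definition listing :: "'a list \<Rightarrow> 'a set \<Rightarrow> bool" where
  "listing xs A \<longleftrightarrow> distinct xs \<and> set xs = A"

text \<open>
  \<open>P\<close> decides connectability of the networks in \<open>X\<close>, however they are listed, within
  time \<open>T n k\<close>, where \<open>n\<close> is the number of users and \<open>k\<close> the number of channels.
  Users and channels are named by natural numbers, which covers every finite network up to renaming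
  (names do not occur in the encoding); with type variables instead, the existence of a program
  could only be asserted separately for each instance of the types.
\<close>

definition decides_connectability ::
    "program \<Rightarrow> (nat, nat) crn set \<Rightarrow> (nat \<Rightarrow> nat \<Rightarrow> nat) \<Rightarrow> bool" where
  "decides_connectability P X T \<longleftrightarrow>
     (\<forall>N us cs. N \<in> X \<longrightarrow> listing us (users N) \<longrightarrow> listing cs (channels N) \<longrightarrow>
        (\<exists>t. runs P (enc_network N us cs) (enc_bool (connectable N)) t \<and>
             t \<le> T (card (users N)) (card (channels N))))"

end

theory Submission
  imports Defs "HOL-Computational_Algebra.Polynomial"
begin

text \<open>
  Dynamic programming over a tree decomposition that is never computed. A partial solution lives on
  a union \<open>Z\<close> of components of \<open>G - X\<close> for a bag \<open>X\<close> of at most \<open>w + 1\<close> vertices, and its interface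
  consists of the channel sets chosen on \<open>X\<close> and the connections inside \<open>X\<close> that it realizes. Three
  rules derive interfaces: nothing is realized on the empty part, disjoint parts behind the same bag
  can be merged, and one may pass to another bag as long as no vertex left behind gets separated.
  Every derivable interface is realizable, whatever the treewidth. If the treewidth is at most \<open>w\<close>,
  every solution is found by induction along a rooted tree decomposition; merging the components
  behind a bag one by one, in a fixed vertex order, needs only polynomially many parts \<open>Z\<close>. Hence
  the least fixed point of the rules, over a universe whose size is polynomial in \<open>n\<close> and \<open>2 ^ k\<close>,
  decides connectability.

  On the side of the programs, it suffices to list all channel sets and to cut the budgets down to
  about \<open>k\<close> bits (their length is not bounded in terms of \<open>n\<close> and \<open>k\<close>). The fixed point is then
  computed in time polynomial in the size of the data, by closure properties of polynomial time.
\<close>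

section \<open>Polynomial time\<close>

text \<open>Since \<open>w\<close> is fixed, trying all \<open>(w + 1)\<close>-tuples of vertices as
  bags, with all channel sets on them, costs only a factor polynomial in \<open>n\<close> and
  \<open>2 ^ k\<close>; this is why no decomposition has to be found. In return, the parts behind a
  bag must be nameable without one. A component of \<open>G - X\<close> is named by \<open>X\<close>
  and one of its vertices. Arbitrary unions of components would need exponentially many names, but
  the components met by a suffix of the vertex list need only \<open>n + 1\<close> per bag and
  region, and these suffice for merging them one at a time. An edge with both ends in the bag
  belongs to no part; it is counted when one of its ends is left behind, or in the final test. Hence
  solutions on disjoint parts can be glued without regard to each other. Connectivity on a bag is an
  equivalence relation, generated by a star in each class, so \<open>w + 1\<close> pairs record it.
  The language has neither equality nor numbers, and its time bound must not depend on the length of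
  the budgets. The main program is therefore obtained from closure properties, and only what they
  cannot cover is programmed by hand.\<close>

fun sz :: "data \<Rightarrow> nat" where
  "sz Nl = 1"
| "sz (Cns x y) = Suc (sz x + sz y)"

text \<open>The summand 1 keeps the measure positive for the empty environment too, so constants are
  bounded by multiples of it and polynomials in it by monomials.\<close>

definition szs :: "data list \<Rightarrow> nat" where
  "szs env = Suc (sum_list (map sz env))"

text \<open>Every tree is a list along its right spine, so this is a total inverse of
  \<open>enc_list\<close>, and list operations on data require no well-formedness condition.\<close>

fun dl :: "data \<Rightarrow> data list" where
  "dl Nl = []"
| "dl (Cns x y) = x # dl y"

lemma dl_enc_list [simp]: "dl (enc_list xs) = xs"
  by (induction xs) auto

lemma enc_list_dl [simp]: "enc_list (dl d) = d"
  by (induction d) auto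

lemma enc_list_inj [simp]: "enc_list xs = enc_list ys \<longleftrightarrow> xs = ys"
  by (metis dl_enc_list)

lemma enc_list_eq_Nl [simp]: "enc_list xs = Nl \<longleftrightarrow> xs = []"
  by (cases xs) auto

lemma szs_Cons [simp]: "szs (x # env) = sz x + szs env"
  by (simp add: szs_def)

lemma szs_Nil [simp]: "szs [] = 1"
  by (simp add: szs_def)

lemma sz_pos [simp]: "0 < sz d"
  by (cases d) auto

lemma szs_pos [simp]: "0 < szs env"
  by (simp add: szs_def)

lemma sz_le_szs: "x \<in> set env \<Longrightarrow> sz x \<le> szs env"
  by (induction env) auto

lemma length_dl_less_sz: "length (dl d) < sz d"
  by (induction d) auto

lemma length_dl_le_sz: "length (dl d) \<le> sz d"
  using length_dl_less_sz[of d] by simp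

lemma poly_mono_nat: "x \<le> y \<Longrightarrow> poly p x \<le> poly (p :: nat poly) y"
  by (induction p) (auto intro!: add_mono mult_mono)

lemma poly_nat_bound: "\<exists>c d. \<forall>x\<ge>1. poly (p :: nat poly) x \<le> c * x ^ d"
proof (induction p)
  case 0
  show ?case by (intro exI[of _ 0]) auto
next
  case (pCons a p)
  then obtain c d where cd: "\<And>x. x \<ge> 1 \<Longrightarrow> poly p x \<le> c * x ^ d" by blast
  have "poly (pCons a p) x \<le> (a + c) * x ^ Suc d" if "x \<ge> 1" for x
  proof -
    have "1 \<le> x ^ Suc d" using that by (metis one_le_power)
    then have "a * 1 \<le> a * x ^ Suc d" by (rule mult_left_mono) simp
    moreover have "x * poly p x \<le> x * (c * x ^ d)" using cd[OF that] by (rule mult_left_mono) simp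
    moreover have "(a + c) * x ^ Suc d = a * x ^ Suc d + x * (c * x ^ d)" by (simp add: algebra_simps)
    ultimately show ?thesis by (simp only: poly_pCons)
  qed
  then show ?case by blast
qed

section \<open>Evaluation within a time bound\<close>

definition evalb :: "program \<Rightarrow> data list \<Rightarrow> exp \<Rightarrow> data \<Rightarrow> nat \<Rightarrow> bool" where
  "evalb P env e v T \<longleftrightarrow> (\<exists>t\<le>T. eval P env e v t)"

definition evalsb :: "program \<Rightarrow> data list \<Rightarrow> exp list \<Rightarrow> data list \<Rightarrow> nat \<Rightarrow> bool" where
  "evalsb P env es vs T \<longleftrightarrow> (\<exists>t\<le>T. evals P env es vs t)"

lemma evalb_mono: "evalb P env e v T \<Longrightarrow> T \<le> T' \<Longrightarrow> evalb P env e v T'"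
  unfolding evalb_def by (meson order_trans)

lemma evalb_Var: "i < length env \<Longrightarrow> evalb P env (Var i) (env ! i) 1"
  unfolding evalb_def using eval_Var by blast

lemma evalb_Nul: "evalb P env Nul Nl 1"
  unfolding evalb_def using eval_Nul by blast

lemma evalb_Cons:
  "evalb P env e1 v1 T1 \<Longrightarrow> evalb P env e2 v2 T2 \<Longrightarrow> evalb P env (Cons e1 e2) (Cns v1 v2) (T1 + T2 + 1)"
  unfolding evalb_def using eval_Cons by (meson add_mono le_refl)

lemma evalb_Hd: "evalb P env e v T \<Longrightarrow> evalb P env (Hd e) (hd_data v) (T + 1)"
  unfolding evalb_def using eval_Hd by (meson add_mono le_refl)

lemma evalb_Tl: "evalb P env e v T \<Longrightarrow> evalb P env (Tl e) (tl_data v) (T + 1)"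
  unfolding evalb_def using eval_Tl by (meson add_mono le_refl)

text \<open>The exact times of the two branches differ; with upper bounds both can be charged alike,
  which is why the calculus carries bounds instead of exact times.\<close>

lemma evalb_If:
  assumes "evalb P env e1 v1 T1" and "v1 \<noteq> Nl \<Longrightarrow> evalb P env e2 v T2" and "v1 = Nl \<Longrightarrow> evalb P env e3 v T2"
  shows "evalb P env (If e1 e2 e3) v (T1 + T2 + 1)"
proof -
  from assms(1) obtain t1 where t1: "t1 \<le> T1" "eval P env e1 v1 t1" by (auto simp: evalb_def)
  show ?thesis
  proof (cases "v1 = Nl")
    case True
    with assms(3) obtain t2 where "t2 \<le> T2" "eval P env e3 v t2" by (auto simp: evalb_def)
    with t1 True eval_If_else show ?thesis unfolding evalb_def by (meson add_mono le_refl)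
  next
    case False
    with assms(2) obtain t2 where "t2 \<le> T2" "eval P env e2 v t2" by (auto simp: evalb_def)
    with t1 False eval_If_then show ?thesis unfolding evalb_def by (meson add_mono le_refl)
  qed
qed

lemma evalb_Call:
  "evalsb P env es vs T1 \<Longrightarrow> f < length P \<Longrightarrow> evalb P vs (P ! f) v T2 \<Longrightarrow> evalb P env (Call f es) v (T1 + T2 + 1)"
  unfolding evalb_def evalsb_def using eval_Call by (meson add_mono le_refl)

lemma evalsb_Nil: "evalsb P env [] [] 0"
  unfolding evalsb_def using evals_Nil by blast

lemma evalsb_Cons:
  "evalb P env e v T1 \<Longrightarrow> evalsb P env es vs T2 \<Longrightarrow> evalsb P env (e # es) (v # vs) (T1 + T2)"
  unfolding evalb_def evalsb_def using evals_Cons by (meson add_mono)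

definition true_exp :: exp where
  "true_exp = Cons Nul Nul"

lemma evalb_true: "evalb P env true_exp (Cns Nl Nl) 3"
  using evalb_Cons[OF evalb_Nul evalb_Nul, of P env] by (simp add: true_exp_def numeral_eq_Suc)

lemma evalb_Var0: "evalb P (x # env) (Var 0) x 1"
  using evalb_Var[of 0 "x # env"] by simp

lemma evalb_Var1: "evalb P (x # y # env) (Var 1) y 1"
  using evalb_Var[of 1 "x # y # env"] by simp

lemma evalb_Var2: "evalb P (x # y # z # env) (Var 2) z 1"
  using evalb_Var[of 2 "x # y # z # env"] by simp

lemma evalb_Var3: "evalb P (x # y # z # u # env) (Var 3) u 1"
  using evalb_Var[of 3 "x # y # z # u # env"] by simp

section \<open>Relocatable code and its closure under composition\<close>

definition computes :: "nat \<Rightarrow> nat \<Rightarrow> exp \<Rightarrow> program \<Rightarrow> (data list \<Rightarrow> data) \<Rightarrow> nat poly \<Rightarrow> bool" where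
  "computes l n e fs f p \<longleftrightarrow> (\<forall>Pre Post env. length Pre = l \<longrightarrow> length env = n \<longrightarrow>
     evalb (Pre @ fs @ Post) env e (f env) (poly p (szs env)))"

lemma computesD:
  "computes l n e fs f p \<Longrightarrow> length Pre = l \<Longrightarrow> length env = n \<Longrightarrow>
    evalb (Pre @ fs @ Post) env e (f env) (poly p (szs env))"
  by (simp add: computes_def)

text \<open>The code can be placed anywhere in a program: it may depend on the number \<open>l\<close> of preceding
  functions, but not on these functions, and the polynomial does not depend on \<open>l\<close>.\<close>

definition ptime :: "nat \<Rightarrow> (data list \<Rightarrow> data) \<Rightarrow> bool" where
  "ptime n f \<longleftrightarrow> (\<exists>p. (\<forall>env. length env = n \<longrightarrow> sz (f env) \<le> poly p (szs env)) \<and>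
     (\<forall>l. \<exists>e fs. computes l n e fs f p))"

lemma ptimeI:
  assumes "\<And>env. length env = n \<Longrightarrow> sz (f env) \<le> poly p (szs env)"
    and "\<And>l. \<exists>e fs. computes l n e fs f q"
  shows "ptime n f"
  unfolding ptime_def
proof (intro exI[of _ "p + q"] conjI allI impI)
  fix env :: "data list"
  assume "length env = n"
  then show "sz (f env) \<le> poly (p + q) (szs env)" using assms(1)[of env] by simp
next
  fix l
  have "computes l n e fs f (p + q)" if "computes l n e fs f q" for e fs
    unfolding computes_def by (intro allI impI evalb_mono[OF computesD[OF that]]) simp_all
  with assms(2) show "\<exists>e fs. computes l n e fs f (p + q)" by blast
qed

lemma ptimeE:
  assumes "ptime n f"
  obtains p where "\<And>env. length env = n \<Longrightarrow> sz (f env) \<le> poly p (szs env)"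
    and "\<And>l. \<exists>e fs. computes l n e fs f p"
  using assms unfolding ptime_def by blast

lemma ptime_cong:
  assumes "ptime n f" and eq: "\<And>env. length env = n \<Longrightarrow> f env = g env"
  shows "ptime n g"
proof -
  have "computes l n e fs f p \<longleftrightarrow> computes l n e fs g p" for l e fs p
    using eq by (auto simp: computes_def)
  with assms(1) eq show ?thesis by (simp add: ptime_def)
qed

lemma ptime_simple:
  assumes "\<And>P env. length env = n \<Longrightarrow> evalb P env e (f env) c"
    and "\<And>env. length env = n \<Longrightarrow> sz (f env) \<le> c * szs env"
  shows "ptime n f"
proof (rule ptimeI[of n f "[:0, c:]" "[:c:]"])
  show "sz (f env) \<le> poly [:0, c:] (szs env)" if "length env = n" for env
    using assms(2)[OF that] by (simp add: mult.commute)
  show "\<exists>e fs. computes l n e fs f [:c:]" for l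
    using assms(1) by (intro exI[of _ e] exI[of _ "[]"]) (simp add: computes_def)
qed

lemma ptime_Var: "i < n \<Longrightarrow> ptime n (\<lambda>env. env ! i)"
  by (rule ptime_simple[of n "Var i" _ 1]) (simp_all add: evalb_Var[simplified] sz_le_szs)

lemma ptime_Nl: "ptime n (\<lambda>env. Nl)"
  by (rule ptime_simple[of n "Nul" _ 1]) (simp_all add: evalb_Nul[simplified] Suc_leI)

lemma length_1_conv: "length xs = Suc 0 \<longleftrightarrow> (\<exists>a. xs = [a])"
  by (cases xs) auto

lemma length_2_conv: "length xs = 2 \<longleftrightarrow> (\<exists>a b. xs = [a, b])"
  by (auto simp: numeral_2_eq_2 length_Suc_conv)

lemma length_3_conv: "length xs = 3 \<longleftrightarrow> (\<exists>a b c. xs = [a, b, c])"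
  by (auto simp: numeral_3_eq_3 length_Suc_conv)

lemma ptime_Cns0: "ptime 2 (\<lambda>env. Cns (env ! 0) (env ! 1))"
  by (rule ptime_simple[of 2 "Cons (Var 0) (Var 1)" _ 3])
    (auto simp: length_2_conv intro!: evalb_mono[OF evalb_Cons[OF evalb_Var0 evalb_Var1[simplified]]])

lemma sz_hd_data: "sz (hd_data d) \<le> sz d"
  by (cases d) auto

lemma sz_tl_data: "sz (tl_data d) \<le> sz d"
  by (cases d) auto

lemma ptime_hd0: "ptime 1 (\<lambda>env. hd_data (env ! 0))"
  by (rule ptime_simple[of 1 "Hd (Var 0)" _ 2])
    (auto simp: length_1_conv intro!: evalb_mono[OF evalb_Hd[OF evalb_Var0]] intro: order_trans[OF sz_hd_data])

lemma ptime_tl0: "ptime 1 (\<lambda>env. tl_data (env ! 0))"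
  by (rule ptime_simple[of 1 "Tl (Var 0)" _ 2])
    (auto simp: length_1_conv intro!: evalb_mono[OF evalb_Tl[OF evalb_Var0]] intro: order_trans[OF sz_tl_data])

lemma ptime_if0: "ptime 3 (\<lambda>env. if env ! 0 \<noteq> Nl then env ! 1 else env ! 2)"
proof (rule ptime_simple[of 3 "If (Var 0) (Var 1) (Var 2)" _ 3])
  fix P and env :: "data list"
  assume "length env = 3"
  then show "evalb P env (If (Var 0) (Var 1) (Var 2)) (if env ! 0 \<noteq> Nl then env ! 1 else env ! 2) 3"
    using evalb_Var[of 1 env P] evalb_Var[of 2 env P]
    by (intro evalb_mono[OF evalb_If[OF evalb_Var[of 0 env P]]]) auto
qed (auto simp: length_3_conv)

lemma evalsb_Vars:
  "\<forall>i\<in>set is. i < length env \<Longrightarrow> evalsb P env (map Var is) (map ((!) env) is) (length is)"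
proof (induction "is")
  case Nil
  show ?case by (simp add: evalsb_Nil)
next
  case (Cons i "is")
  then show ?case using evalsb_Cons[OF evalb_Var[of i env P], of "map Var is"] by simp
qed

text \<open>Arguments are compiled one after the other: the helpers for \<open>gs\<close> are placed
  behind those of \<open>g\<close>, which is possible because code exists for every
  position.\<close>

lemma ptime_args:
  assumes "\<forall>g\<in>set gs. ptime n g"
  shows "\<exists>p :: nat poly. (\<forall>env. length env = n \<longrightarrow> szs (map (\<lambda>g. g env) gs) \<le> poly p (szs env)) \<and>
     (\<forall>l. \<exists>es fs. \<forall>Pre Post env. length Pre = l \<longrightarrow> length env = n \<longrightarrow>
        evalsb (Pre @ fs @ Post) env es (map (\<lambda>g. g env) gs) (poly p (szs env)))"
  using assms
proof (induction gs)
  case Nil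
  have "evalsb P env [] [] 1" for P env
    using evalsb_Nil[of P env] by (auto simp: evalsb_def)
  then show ?case by (intro exI[of _ "1 :: nat poly"] conjI allI impI exI[of _ "[]"]) auto
next
  case (Cons g gs)
  from Cons.prems have "\<forall>g\<in>set gs. ptime n g" by simp
  from Cons.IH[OF this] obtain p
    where p: "\<And>env. length env = n \<Longrightarrow> szs (map (\<lambda>g. g env) gs) \<le> poly p (szs env)"
    and c: "\<And>l. \<exists>es fs. \<forall>Pre Post env. length Pre = l \<longrightarrow> length env = n \<longrightarrow>
        evalsb (Pre @ fs @ Post) env es (map (\<lambda>g. g env) gs) (poly p (szs env))"
    by blast
  from Cons.prems have "ptime n g" by simp
  then obtain q where q: "\<And>env. length env = n \<Longrightarrow> sz (g env) \<le> poly q (szs env)"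
    and d: "\<And>l. \<exists>e fs. computes l n e fs g q"
    by (rule ptimeE) blast
  show ?case
  proof (intro exI[of _ "q + p"] conjI allI impI)
    fix env :: "data list"
    assume "length env = n"
    then show "szs (map (\<lambda>g. g env) (g # gs)) \<le> poly (q + p) (szs env)"
      using p[of env] q[of env] by simp
  next
    fix l
    from d[of l] obtain e fs where e: "computes l n e fs g q" by blast
    from c[of "l + length fs"] obtain es gs' where es: "\<And>Pre Post env. length Pre = l + length fs \<Longrightarrow>
        length env = n \<Longrightarrow> evalsb (Pre @ gs' @ Post) env es (map (\<lambda>g. g env) gs) (poly p (szs env))" by blast
    show "\<exists>es fs. \<forall>Pre Post env. length Pre = l \<longrightarrow> length env = n \<longrightarrow>
        evalsb (Pre @ fs @ Post) env es (map (\<lambda>g. g env) (g # gs)) (poly (q + p) (szs env))"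
    proof (rule exI[of _ "e # es"], rule exI[of _ "fs @ gs'"], intro allI impI)
      fix Pre Post :: program and env :: "data list"
      assume l: "length Pre = l" and n: "length env = n"
      from evalsb_Cons[OF computesD[OF e l n, of "gs' @ Post"]] es[of "Pre @ fs", OF _ n, of Post] l
      show "evalsb (Pre @ (fs @ gs') @ Post) env (e # es) (map (\<lambda>g. g env) (g # gs)) (poly (q + p) (szs env))"
        by simp
    qed
  qed
qed

text \<open>The code of \<open>f\<close> refers to its arguments by their position in the
  environment, so it is stored as a function of its own and called on the evaluated arguments rather
  than inlined.\<close>

lemma ptime_comp:
  assumes "ptime m f" and "\<forall>g\<in>set gs. ptime n g" and m: "length gs = m"
  shows "ptime n (\<lambda>env. f (map (\<lambda>g. g env) gs))"
proof -
  from ptime_args[OF assms(2)] obtain p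
    where p: "\<And>env. length env = n \<Longrightarrow> szs (map (\<lambda>g. g env) gs) \<le> poly p (szs env)"
    and c: "\<And>l. \<exists>es fs. \<forall>Pre Post env. length Pre = l \<longrightarrow> length env = n \<longrightarrow>
        evalsb (Pre @ fs @ Post) env es (map (\<lambda>g. g env) gs) (poly p (szs env))"
    by blast
  from assms(1) obtain q where q: "\<And>env. length env = m \<Longrightarrow> sz (f env) \<le> poly q (szs env)"
    and d: "\<And>l. \<exists>e fs. computes l m e fs f q"
    by (rule ptimeE) blast
  \<comment> \<open>\<open>pcompose q p\<close> bounds the work of \<open>f\<close> on arguments of
    total size at most \<open>p\<close>; the 1 pays for the call.\<close>
  let ?r = "p + pcompose q p + 1"
  have q': "poly q (szs (map (\<lambda>g. g env) gs)) \<le> poly (pcompose q p) (szs env)"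
    if "length env = n" for env :: "data list"
    using poly_mono_nat[OF p[OF that], of q] by (simp add: poly_pcompose)
  show ?thesis
  proof (rule ptimeI[of n _ ?r ?r])
    fix env :: "data list"
    assume n: "length env = n"
    show "sz (f (map (\<lambda>g. g env) gs)) \<le> poly ?r (szs env)"
      using order_trans[OF q[of "map (\<lambda>g. g env) gs"] q'[OF n]] m by simp
  next
    fix l
    from c[of l] obtain es fs where es: "\<And>Pre Post env. length Pre = l \<Longrightarrow> length env = n \<Longrightarrow>
        evalsb (Pre @ fs @ Post) env es (map (\<lambda>g. g env) gs) (poly p (szs env))" by blast
    from d[of "l + length fs"] obtain e fs' where e: "computes (l + length fs) m e fs' f q" by blast
    \<comment> \<open>The entry \<open>e\<close> comes after \<open>Pre\<close>, the helpers
      \<open>fs\<close> of the arguments and the helpers \<open>fs'\<close> of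
      \<open>f\<close>.\<close>
    let ?i = "l + length fs + length fs'"
    show "\<exists>e fs. computes l n e fs (\<lambda>env. f (map (\<lambda>g. g env) gs)) ?r"
      unfolding computes_def
    proof (intro exI[of _ "Call ?i es"] exI[of _ "fs @ fs' @ [e]"] allI impI)
      fix Pre Post :: program and env :: "data list"
      assume l: "length Pre = l" and n: "length env = n"
      let ?P = "Pre @ (fs @ fs' @ [e]) @ Post"
      let ?vs = "map (\<lambda>g. g env) gs"
      have nth: "?P ! ?i = e" "?i < length ?P"
        using l by (auto simp: nth_append)
      have "evalsb ?P env es ?vs (poly p (szs env))"
        using es[OF l n, of "fs' @ [e] @ Post"] by simp
      moreover have "evalb ?P ?vs (?P ! ?i) (f ?vs) (poly q (szs ?vs))"
        using computesD[OF e, of "Pre @ fs" ?vs "[e] @ Post"] l m nth(1) by simp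
      ultimately show "evalb ?P env (Call ?i es) (f ?vs) (poly ?r (szs env))"
        using q'[OF n] by (intro evalb_mono[OF evalb_Call[OF _ nth(2)]]) auto
    qed
  qed
qed

lemma ptime_comp1: "ptime 1 (\<lambda>e. F (e ! 0)) \<Longrightarrow> ptime n f \<Longrightarrow> ptime n (\<lambda>e. F (f e))"
  using ptime_comp[of 1 "\<lambda>e. F (e ! 0)" "[f]" n] by simp

lemma ptime_comp2: "ptime 2 (\<lambda>e. F (e ! 0) (e ! 1)) \<Longrightarrow> ptime n f \<Longrightarrow> ptime n g \<Longrightarrow> ptime n (\<lambda>e. F (f e) (g e))"
  using ptime_comp[of 2 "\<lambda>e. F (e ! 0) (e ! 1)" "[f, g]" n] by simp

lemma ptime_comp3: "ptime 3 (\<lambda>e. F (e ! 0) (e ! 1) (e ! 2)) \<Longrightarrow> ptime n f \<Longrightarrow> ptime n g \<Longrightarrow> ptime n h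
    \<Longrightarrow> ptime n (\<lambda>e. F (f e) (g e) (h e))"
  using ptime_comp[of 3 "\<lambda>e. F (e ! 0) (e ! 1) (e ! 2)" "[f, g, h]" n] by simp

lemma map_nth_upt: "length env = n \<Longrightarrow> map (\<lambda>i. env ! i) [0..<n] = env"
  by (metis map_nth)

lemma map_nth_upt_Suc: "length env = n \<Longrightarrow> map (\<lambda>i. (x # env) ! i) [1..<Suc n] = env"
  by (rule nth_equalityI) (auto simp del: upt_Suc)

lemma ptime_Let:
  assumes "ptime (Suc n) f" and "ptime n g"
  shows "ptime n (\<lambda>env. f (g env # env))"
proof -
  have *: "\<forall>h\<in>set (g # map (\<lambda>i env. env ! i) [0..<n]). ptime n h"
    using assms(2) ptime_Var by auto
  show ?thesis
    by (rule ptime_cong[OF ptime_comp[OF assms(1) *]]) (auto simp: comp_def map_nth_upt)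
qed

lemma ptime_tl:
  assumes "ptime n f"
  shows "ptime (Suc n) (\<lambda>env. f (tl env))"
proof -
  have *: "\<forall>h\<in>set (map (\<lambda>i env. env ! i) [1..<Suc n]). ptime (Suc n) h"
    using ptime_Var by auto
  show ?thesis
  proof (rule ptime_cong[OF ptime_comp[OF assms *]])
    show "f (map (\<lambda>g. g env) (map (\<lambda>i env. env ! i) [1..<Suc n])) = f (tl env)"
      if "length env = Suc n" for env
      using that map_nth_upt_Suc[of "tl env" n "hd env"]
      by (cases env) (simp_all add: comp_def del: upt_Suc)
  qed auto
qed

text \<open>Iterating a polynomial-time step can square the size at each element and thus leave
  polynomial time. The hypothesis \<open>size\<close> excludes this: a polynomial bound on all
  intermediate results has to be supplied with each use.\<close>

lemma ptime_fold0:
  assumes b: "ptime n b" and s: "ptime (Suc (Suc n)) s"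
    and size: "\<And>d env. length env = n \<Longrightarrow>
      sz (foldr (\<lambda>x r. s (x # r # env)) (dl d) (b env)) \<le> poly q (szs (d # env))"
  shows "ptime (Suc n) (\<lambda>env. foldr (\<lambda>x r. s (x # r # tl env)) (dl (hd env)) (b (tl env)))"
proof -
  let ?F = "\<lambda>d env. foldr (\<lambda>x r. s (x # r # env)) (dl d) (b env)"
  obtain p1 where p1: "\<And>l. \<exists>e fs. computes l n e fs b p1" using b by (rule ptimeE) blast
  obtain p2 where p2: "\<And>l. \<exists>e fs. computes l (Suc (Suc n)) e fs s p2" using s by (rule ptimeE) blast
  \<comment> \<open>Cost of one level: the base, the step on an environment enlarged by an
    intermediate result of size at most \<open>q\<close>, and the overhead, in which two calls copy
    the \<open>n\<close> parameters.\<close>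
  define u where "u = p1 + pcompose p2 ([:0, 1:] + q) + [:2 * n + 10:]"
  show ?thesis
  proof (rule ptimeI[of _ _ q "u * [:1, 1:]"])
    show "sz (?F (hd env) (tl env)) \<le> poly q (szs env)" if "length env = Suc n" for env
      using size[of "tl env" "hd env"] that by (cases env) auto
  next
    fix l
    from p1[of l] obtain eb fb where eb: "computes l n eb fb b p1" by blast
    from p2[of "l + length fb"] obtain es fs where es: "computes (l + length fb) (Suc (Suc n)) es fs s p2"
      by blast
    \<comment> \<open>Function \<open>ib\<close> is the base, \<open>ib + 1\<close> the step, and
      \<open>ib + 2\<close> the recursion \<open>g\<close> itself.\<close>
    define ib where "ib = l + length fb + length fs"
    define vs where "vs = map Var [1..<Suc n]"
    define g where "g = If (Var 0)
      (Call (ib + 1) (Hd (Var 0) # Call (ib + 2) (Tl (Var 0) # vs) # vs)) (Call ib vs)"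
    show "\<exists>e fs. computes l (Suc n) e fs (\<lambda>env. ?F (hd env) (tl env)) (u * [:1, 1:])"
      unfolding computes_def
    proof (rule exI[of _ g], rule exI[of _ "fb @ fs @ [eb, es, g]"], intro allI impI)
      fix Pre Post :: program and env :: "data list"
      assume l: "length Pre = l" and n: "length env = Suc n"
      define P where "P = Pre @ (fb @ fs @ [eb, es, g]) @ Post"
      obtain d0 ps where env: "env = d0 # ps" and ps: "length ps = n"
        using n by (cases env) auto
      have nth: "P ! ib = eb" "P ! (ib + 1) = es" "P ! (ib + 2) = g"
        and len: "ib < length P" "ib + 1 < length P" "ib + 2 < length P"
        using l by (auto simp: ib_def nth_append P_def)
      have vs: "evalsb P (d # ps) vs ps n" for d
        using evalsb_Vars[of "[1..<Suc n]" "d # ps" P] ps map_nth_upt_Suc[of ps n d]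
        by (simp add: vs_def del: upt_Suc)
      define N where "N = szs (d0 # ps)"
      have uN: "poly p1 N + poly p2 (N + poly q N) + 2 * n + 10 = poly u N"
        by (simp add: u_def poly_pcompose)
      \<comment> \<open>All remaining lists \<open>d\<close> are measured by the size of the initial
        one, so every level costs at most the same \<open>poly u N\<close>.\<close>
      have main: "evalb P (d # ps) g (?F d ps) (poly u N * (length (dl d) + 1))" if "sz d \<le> sz d0" for d
        using that
      proof (induction d)
        case Nl
        have "evalb P ps (P ! ib) (b ps) (poly p1 (szs ps))"
          using computesD[OF eb l ps, of "fs @ [eb, es, g] @ Post"] nth(1) by (simp add: P_def)
        note c = evalb_Call[OF vs len(1) this]
        have "poly p1 (szs ps) \<le> poly p1 N" by (rule poly_mono_nat) (simp add: N_def)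
        then have *: "1 + (n + poly p1 (szs ps) + 1) + 1 \<le> poly u N * (length (dl Nl) + 1)"
          using uN by simp
        have "evalb P (Nl # ps) g (b ps) (1 + (n + poly p1 (szs ps) + 1) + 1)"
          unfolding g_def by (rule evalb_If[OF evalb_Var0 _ c]) auto
        from evalb_mono[OF this *] show ?case by simp
      next
        case (Cns x d)
        let ?e = "Cns x d # ps" and ?e2 = "x # ?F d ps # ps"
        let ?t = "poly u N * (length (dl d) + 1)"
        have h: "evalb P ?e (Hd (Var 0)) x 2" and tl: "evalb P ?e (Tl (Var 0)) d 2"
          using evalb_Hd[OF evalb_Var0, of P "Cns x d" ps] evalb_Tl[OF evalb_Var0, of P "Cns x d" ps]
          by (simp_all add: numeral_eq_Suc)
        have "evalb P (d # ps) (P ! (ib + 2)) (?F d ps) ?t" using Cns nth(3) by simp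
        note c = evalb_Call[OF evalsb_Cons[OF tl vs] len(3) this]
        have "evalb P ?e2 (P ! (ib + 1)) (s ?e2) (poly p2 (szs ?e2))"
          using computesD[OF es, of "Pre @ fb" ?e2 "[eb, es, g] @ Post"] l ps nth(2) by (simp add: P_def)
        note c2 = evalb_Call[OF evalsb_Cons[OF h evalsb_Cons[OF c vs]] len(2) this]
        have "szs ?e2 \<le> N + poly q N"
        proof -
          have "poly q (szs (d # ps)) \<le> poly q N"
            using Cns.prems by (intro poly_mono_nat) (simp add: N_def)
          then have "sz (?F d ps) \<le> poly q N" using size[OF ps, of d] by simp
          then show ?thesis using Cns.prems by (simp add: N_def)
        qed
        then have "poly p2 (szs ?e2) \<le> poly p2 (N + poly q N)" by (rule poly_mono_nat)
        then have "1 + (2 + (2 + n + ?t + 1 + n) + poly p2 (szs ?e2) + 1) + 1 \<le> poly u N + ?t"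
          using uN by linarith
        also have "\<dots> = poly u N * (length (dl (Cns x d)) + 1)" by simp
        finally have *: "1 + (2 + (2 + n + ?t + 1 + n) + poly p2 (szs ?e2) + 1) + 1
          \<le> poly u N * (length (dl (Cns x d)) + 1)" .
        have "evalb P ?e g (s ?e2) (1 + (2 + (2 + n + ?t + 1 + n) + poly p2 (szs ?e2) + 1) + 1)"
          unfolding g_def by (rule evalb_If[OF evalb_Var0 c2]) auto
        from evalb_mono[OF this *] show ?case by simp
      qed
      have "poly u N * (length (dl d0) + 1) \<le> poly (u * [:1, 1:]) N"
        using length_dl_le_sz[of d0] by (simp add: N_def)
      from evalb_mono[OF main[OF order_refl] this]
      show "evalb (Pre @ (fb @ fs @ [eb, es, g]) @ Post) env g (?F (hd env) (tl env)) (poly (u * [:1, 1:]) (szs env))"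
        by (simp only: env N_def P_def list.sel)
    qed
  qed
qed

lemma ptime_fold:
  assumes l: "ptime n l" and b: "ptime n b" and s: "ptime (Suc (Suc n)) (\<lambda>e. s (hd e) (hd (tl e)) (tl (tl e)))"
    and size: "\<And>d env. length env = n \<Longrightarrow>
      sz (foldr (\<lambda>x r. s x r env) (dl d) (b env)) \<le> poly q (szs (d # env))"
  shows "ptime n (\<lambda>env. foldr (\<lambda>x r. s x r env) (dl (l env)) (b env))"
proof -
  have "ptime (Suc n) (\<lambda>env. foldr (\<lambda>x r. s x r (tl env)) (dl (hd env)) (b (tl env)))"
    using ptime_fold0[OF b s, of q] size by simp
  from ptime_Let[OF this l] show ?thesis by simp
qed

section \<open>Equality of trees\<close>

fun eqd :: "data \<Rightarrow> data \<Rightarrow> bool" where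
  "eqd Nl Nl = True"
| "eqd (Cns a b) (Cns c d) = (eqd a c \<and> eqd b d)"
| "eqd _ _ = False"

lemma eqd_iff: "eqd a b \<longleftrightarrow> a = b"
  by (induction a b rule: eqd.induct) auto

lemma enc_bool_simps [simp]: "enc_bool True = Cns Nl Nl" "enc_bool False = Nl"
  by (simp_all add: enc_bool_def)

lemma enc_bool_eq_Nl [simp]: "enc_bool b = Nl \<longleftrightarrow> \<not> b"
  by (simp add: enc_bool_def)

lemma sz_enc_bool: "sz (enc_bool b) \<le> 3"
  by (cases b) auto

definition eq_body :: "nat \<Rightarrow> exp" where
  "eq_body i = If (Var 0)
     (If (Var 1) (If (Call i [Hd (Var 0), Hd (Var 1)]) (Call i [Tl (Var 0), Tl (Var 1)]) Nul) Nul)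
     (If (Var 1) Nul true_exp)"

text \<open>Both trees are descended simultaneously until one of them ends, so the size of the first
  bounds the number of nodes visited; each of them costs at most 20 steps.\<close>

lemma evalb_eq_body:
  assumes i: "i < length P" "P ! i = eq_body i"
  shows "evalb P [a, b] (eq_body i) (enc_bool (eqd a b)) (20 * sz a)"
proof (induction a b rule: eqd.induct)
  case 1
  show ?case unfolding eq_body_def eqd.simps enc_bool_simps
    by (rule evalb_mono, rule evalb_If[OF evalb_Var0 _ evalb_If[OF evalb_Var1 _ evalb_true]]) auto
next
  case (2 a b c d)
  let ?e = "[Cns a b, Cns c d]"
  have h: "evalsb P ?e [Hd (Var 0), Hd (Var 1)] [a, c] ((1 + 1) + ((1 + 1) + 0))"
    using evalsb_Cons[OF evalb_Hd[OF evalb_Var0] evalsb_Cons[OF evalb_Hd[OF evalb_Var1] evalsb_Nil],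
      of P "Cns a b" "Cns c d" "[]"] by simp
  have t: "evalsb P ?e [Tl (Var 0), Tl (Var 1)] [b, d] ((1 + 1) + ((1 + 1) + 0))"
    using evalsb_Cons[OF evalb_Tl[OF evalb_Var0] evalsb_Cons[OF evalb_Tl[OF evalb_Var1] evalsb_Nil],
      of P "Cns a b" "Cns c d" "[]"] by simp
  have c1: "evalb P ?e (Call i [Hd (Var 0), Hd (Var 1)]) (enc_bool (eqd a c))
      ((1 + 1) + ((1 + 1) + 0) + 20 * sz a + 1)"
    by (rule evalb_Call[OF h i(1)]) (use 2 i(2) in simp)
  have c2: "evalb P ?e (Call i [Tl (Var 0), Tl (Var 1)]) (enc_bool (eqd b d))
      ((1 + 1) + ((1 + 1) + 0) + 20 * sz b + 1)"
    by (rule evalb_Call[OF t i(1)]) (use 2 i(2) in simp)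
  have "evalb P ?e (If (Call i [Hd (Var 0), Hd (Var 1)]) (Call i [Tl (Var 0), Tl (Var 1)]) Nul)
      (enc_bool (eqd a c \<and> eqd b d))
      ((1 + 1) + ((1 + 1) + 0) + 20 * sz a + 1 + ((1 + 1) + ((1 + 1) + 0) + 20 * sz b + 1) + 1)"
    by (rule evalb_If[OF c1]) (use c2 evalb_mono[OF evalb_Nul] in auto)
  note r = evalb_If[OF evalb_Var1 this]
  show ?case unfolding eq_body_def eqd.simps
    by (rule evalb_mono, rule evalb_If[OF evalb_Var0 r]) auto
next
  case ("3_1" v va)
  show ?case unfolding eq_body_def eqd.simps enc_bool_simps
    by (rule evalb_mono, rule evalb_If[OF evalb_Var0 evalb_If[OF evalb_Var1 _ evalb_Nul]]) auto
next
  case ("3_2" v va)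
  show ?case unfolding eq_body_def eqd.simps enc_bool_simps
    by (rule evalb_mono, rule evalb_If[OF evalb_Var0 _ evalb_If[OF evalb_Var1 evalb_Nul]]) auto
qed

lemma ptime_eq0: "ptime 2 (\<lambda>e. enc_bool (e ! 0 = e ! 1))"
proof (rule ptimeI[of _ _ "[:3:]" "[:0, 20:]"])
  show "sz (enc_bool (e ! 0 = e ! 1)) \<le> poly [:3:] (szs e)" if "length e = 2" for e :: "data list"
    using sz_enc_bool by simp
  have "evalb (Pre @ [eq_body l] @ Post) env (eq_body l) (enc_bool (env ! 0 = env ! 1)) (poly [:0, 20:] (szs env))"
    if l: "length Pre = l" and env: "length env = 2" for Pre Post env l
  proof -
    from env obtain a b where env: "env = [a, b]" by (auto simp: length_2_conv)
    from l have "l < length (Pre @ [eq_body l] @ Post)" "(Pre @ [eq_body l] @ Post) ! l = eq_body l"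
      by auto
    from evalb_mono[OF evalb_eq_body[OF this, of a b]] show ?thesis
      by (simp add: env eqd_iff)
  qed
  then show "\<exists>e fs. computes l 2 e fs (\<lambda>env. enc_bool (env ! 0 = env ! 1)) [:0, 20:]" for l
    unfolding computes_def by blast
qed

lemma ptime_hd: "ptime (Suc n) hd"
  by (rule ptime_cong[OF ptime_Var[of 0]]) (auto simp: length_Suc_conv)

text \<open>Positions are written with \<open>hd\<close> and \<open>tl\<close> instead of
  \<open>!\<close>: each bound variable enters the environment at the front, and the outer variables
  then still have a form that matches these rules.\<close>

lemmas ptime_vars =
  ptime_hd
  ptime_hd[THEN ptime_tl]
  ptime_hd[THEN ptime_tl, THEN ptime_tl]
  ptime_hd[THEN ptime_tl, THEN ptime_tl, THEN ptime_tl]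
  ptime_hd[THEN ptime_tl, THEN ptime_tl, THEN ptime_tl, THEN ptime_tl]
  ptime_hd[THEN ptime_tl, THEN ptime_tl, THEN ptime_tl, THEN ptime_tl, THEN ptime_tl]
  ptime_hd[THEN ptime_tl, THEN ptime_tl, THEN ptime_tl, THEN ptime_tl, THEN ptime_tl, THEN ptime_tl]
  ptime_hd[THEN ptime_tl, THEN ptime_tl, THEN ptime_tl, THEN ptime_tl, THEN ptime_tl, THEN ptime_tl,
    THEN ptime_tl]
  ptime_hd[THEN ptime_tl, THEN ptime_tl, THEN ptime_tl, THEN ptime_tl, THEN ptime_tl, THEN ptime_tl,
    THEN ptime_tl, THEN ptime_tl]
  ptime_hd[THEN ptime_tl, THEN ptime_tl, THEN ptime_tl, THEN ptime_tl, THEN ptime_tl, THEN ptime_tl,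
    THEN ptime_tl, THEN ptime_tl, THEN ptime_tl]

text \<open>The step of a fold finds the accumulator in second position; this adapts a function that
  is unaware of it.\<close>

lemma ptime_skip:
  assumes "ptime (Suc n) f"
  shows "ptime (Suc (Suc n)) (\<lambda>env. f (hd env # tl (tl env)))"
proof -
  have *: "\<forall>h\<in>set (hd # map (\<lambda>i env. env ! i) [2..<Suc (Suc n)]). ptime (Suc (Suc n)) h"
    using ptime_Var ptime_hd by auto
  show ?thesis
  proof (rule ptime_cong[OF ptime_comp[OF assms *]])
    show "f (map (\<lambda>g. g env) (hd # map (\<lambda>i env. env ! i) [2..<Suc (Suc n)])) = f (hd env # tl (tl env))"
      if env: "length env = Suc (Suc n)" for env :: "data list"
    proof -
      have "map ((!) env) [2..<Suc (Suc n)] = tl (tl env)"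
        using env by (intro nth_equalityI) (auto simp: nth_tl simp del: upt_Suc)
      then show ?thesis by (simp add: comp_def del: upt_Suc)
    qed
  qed (simp del: upt_Suc)
qed

lemma ptime_Cns: "ptime n f \<Longrightarrow> ptime n g \<Longrightarrow> ptime n (\<lambda>e. Cns (f e) (g e))"
  by (rule ptime_comp2[OF ptime_Cns0])

lemma ptime_hd_data: "ptime n f \<Longrightarrow> ptime n (\<lambda>e. hd_data (f e))"
  by (rule ptime_comp1[OF ptime_hd0])

lemma ptime_tl_data: "ptime n f \<Longrightarrow> ptime n (\<lambda>e. tl_data (f e))"
  by (rule ptime_comp1[OF ptime_tl0])

lemma ptime_if: "ptime n (\<lambda>e. enc_bool (\<phi> e)) \<Longrightarrow> ptime n f \<Longrightarrow> ptime n g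
    \<Longrightarrow> ptime n (\<lambda>e. if \<phi> e then f e else g e)"
  using ptime_comp3[OF ptime_if0, of n "\<lambda>e. enc_bool (\<phi> e)" f g] by simp

lemma ptime_eq: "ptime n f \<Longrightarrow> ptime n g \<Longrightarrow> ptime n (\<lambda>e. enc_bool (f e = g e))"
  by (rule ptime_comp2[OF ptime_eq0])

lemma ptime_True: "ptime n (\<lambda>e. enc_bool True)"
  by (simp add: ptime_Cns ptime_Nl)

lemma ptime_False: "ptime n (\<lambda>e. enc_bool False)"
  by (simp add: ptime_Nl)

lemma ptime_not: "ptime n (\<lambda>e. enc_bool (p e)) \<Longrightarrow> ptime n (\<lambda>e. enc_bool (\<not> p e))"
  by (rule ptime_cong[OF ptime_if[OF _ ptime_False ptime_True]]) auto

lemma ptime_conj: "ptime n (\<lambda>e. enc_bool (p e)) \<Longrightarrow> ptime n (\<lambda>e. enc_bool (q e))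
    \<Longrightarrow> ptime n (\<lambda>e. enc_bool (p e \<and> q e))"
  by (rule ptime_cong[OF ptime_if[of n p "\<lambda>e. enc_bool (q e)", OF _ _ ptime_False]]) auto

lemma ptime_disj: "ptime n (\<lambda>e. enc_bool (p e)) \<Longrightarrow> ptime n (\<lambda>e. enc_bool (q e))
    \<Longrightarrow> ptime n (\<lambda>e. enc_bool (p e \<or> q e))"
  by (rule ptime_cong[OF ptime_if[of n p _ "\<lambda>e. enc_bool (q e)", OF _ ptime_True]]) auto

lemma ptime_imp: "ptime n (\<lambda>e. enc_bool (p e)) \<Longrightarrow> ptime n (\<lambda>e. enc_bool (q e))
    \<Longrightarrow> ptime n (\<lambda>e. enc_bool (p e \<longrightarrow> q e))"
  by (rule ptime_cong[OF ptime_if[of n p "\<lambda>e. enc_bool (q e)", OF _ _ ptime_True]]) auto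

section \<open>Polynomial-time list operations\<close>

lemma sz_le_of_mem: "x \<in> set (dl d) \<Longrightarrow> sz x \<le> sz d"
  by (induction d) auto

definition dmap :: "(data \<Rightarrow> data) \<Rightarrow> data \<Rightarrow> data" where
  "dmap g d = enc_list (map g (dl d))"

definition dfilter :: "(data \<Rightarrow> bool) \<Rightarrow> data \<Rightarrow> data" where
  "dfilter p d = enc_list (filter p (dl d))"

definition dappend :: "data \<Rightarrow> data \<Rightarrow> data" where
  "dappend c d = enc_list (dl c @ dl d)"

definition dconcat :: "data \<Rightarrow> data" where
  "dconcat d = enc_list (concat (map dl (dl d)))"

lemma dl_simps [simp]:
  "dl (dmap g d) = map g (dl d)"
  "dl (dfilter p d) = filter p (dl d)"
  "dl (dappend c d) = dl c @ dl d"
  "dl (dconcat d) = concat (map dl (dl d))"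
  by (simp_all add: dmap_def dfilter_def dappend_def dconcat_def)

lemma ptime_dmap:
  assumes l: "ptime n l" and g: "ptime (Suc n) (\<lambda>e. g (hd e) (tl e))"
  shows "ptime n (\<lambda>e. dmap (\<lambda>x. g x e) (l e))"
proof -
  from g obtain p :: "nat poly"
    where p: "\<And>env. length env = Suc n \<Longrightarrow> sz (g (hd env) (tl env)) \<le> poly p (szs env)"
    unfolding ptime_def by blast
  have "ptime n (\<lambda>e. foldr (\<lambda>x r. Cns (g x e) r) (dl (l e)) Nl)"
  \<comment> \<open>For an environment of size \<open>N\<close>, at most \<open>N\<close> elements
    of size at most \<open>poly p N\<close>, each with one constructor, and the final
    \<open>Nl\<close>.\<close>
  proof (rule ptime_fold[OF l ptime_Nl, of _ "[:0, 1:] * (p + [:1:]) + [:1:]"])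
    show "ptime (Suc (Suc n)) (\<lambda>e. Cns (g (hd e) (tl (tl e))) (hd (tl e)))"
      using ptime_skip[OF g] by (intro ptime_Cns ptime_vars) simp
    fix d and env :: "data list"
    assume n: "length env = n"
    have *: "sz (g x env) \<le> poly p (szs (d # env))" if "x \<in> set (dl d)" for x
    proof -
      have "poly p (szs (x # env)) \<le> poly p (szs (d # env))"
        using sz_le_of_mem[OF that] by (intro poly_mono_nat) simp
      then show ?thesis using p[of "x # env"] n by simp
    qed
    have "sz (foldr (\<lambda>x r. Cns (g x env) r) xs Nl) \<le> length xs * (b + 1) + 1"
      if "\<forall>x\<in>set xs. sz (g x env) \<le> b" for xs b
      using that by (induction xs) auto
    then have "sz (foldr (\<lambda>x r. Cns (g x env) r) (dl d) Nl)
        \<le> length (dl d) * (poly p (szs (d # env)) + 1) + 1" using * by blast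
    also have "\<dots> \<le> szs (d # env) * (poly p (szs (d # env)) + 1) + 1"
      using length_dl_le_sz[of d] by (intro add_mono mult_right_mono) auto
    finally show "sz (foldr (\<lambda>x r. Cns (g x env) r) (dl d) Nl)
        \<le> poly ([:0, 1:] * (p + [:1:]) + [:1:]) (szs (d # env))" by (simp del: szs_Cons)
  qed
  moreover have "foldr (\<lambda>x r. Cns (g x e) r) xs Nl = enc_list (map (\<lambda>x. g x e) xs)" for xs e
    by (induction xs) auto
  ultimately show ?thesis by (simp add: dmap_def)
qed

lemma ptime_dfilter:
  assumes l: "ptime n l" and g: "ptime (Suc n) (\<lambda>e. enc_bool (g (hd e) (tl e)))"
  shows "ptime n (\<lambda>e. dfilter (\<lambda>x. g x e) (l e))"
proof -
  have "ptime n (\<lambda>e. foldr (\<lambda>x r. if g x e then Cns x r else r) (dl (l e)) Nl)"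
  proof (rule ptime_fold[OF l ptime_Nl, of _ "[:0, 1:]"])
    show "ptime (Suc (Suc n)) (\<lambda>e. if g (hd e) (tl (tl e)) then Cns (hd e) (hd (tl e)) else hd (tl e))"
      using ptime_skip[OF g] by (intro ptime_if ptime_Cns ptime_vars) simp
    fix d and env :: "data list"
    have "sz (foldr (\<lambda>x r. if g x env then Cns x r else r) (dl d) Nl) \<le> sz d"
      by (induction d) auto
    then show "sz (foldr (\<lambda>x r. if g x env then Cns x r else r) (dl d) Nl)
        \<le> poly [:0, 1:] (szs (d # env))" by simp
  qed
  moreover have "foldr (\<lambda>x r. if g x e then Cns x r else r) xs Nl = enc_list (filter (\<lambda>x. g x e) xs)" for xs e
    by (induction xs) auto
  ultimately show ?thesis by (simp add: dfilter_def)
qed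

lemma dappend_foldr: "dappend c d = foldr Cns (dl c) d"
proof -
  have "enc_list (xs @ dl d) = foldr Cns xs d" for xs by (induction xs) auto
  then show ?thesis by (simp add: dappend_def)
qed

lemma sz_dappend: "sz (dappend c d) \<le> sz c + sz d"
  unfolding dappend_foldr by (induction c) auto

lemma ptime_dappend:
  assumes "ptime n f" and "ptime n g"
  shows "ptime n (\<lambda>e. dappend (f e) (g e))"
proof -
  have "ptime 2 (\<lambda>e. foldr (\<lambda>x r. Cns x r) (dl (e ! 0)) (e ! 1))"
  proof (rule ptime_fold[OF ptime_Var ptime_Var, of 0 2 1 "\<lambda>x r e. Cns x r" "[:0, 1:]"])
    fix d and env :: "data list"
    assume "length env = 2"
    then show "sz (foldr (\<lambda>x r. Cns x r) (dl d) (env ! 1)) \<le> poly [:0, 1:] (szs (d # env))"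
      using sz_dappend[of d "env ! 1"] by (auto simp: dappend_foldr length_2_conv)
  next
    show "ptime (Suc (Suc 2)) (\<lambda>e. Cns (hd e) (hd (tl e)))"
      by (intro ptime_Cns ptime_vars)
  qed simp_all
  then have "ptime 2 (\<lambda>e. dappend (e ! 0) (e ! 1))" by (simp add: dappend_foldr)
  from this assms show ?thesis by (rule ptime_comp2)
qed

lemma dconcat_foldr: "dconcat d = foldr dappend (dl d) Nl"
proof -
  have "enc_list (concat (map dl xs)) = foldr dappend xs Nl" for xs
    by (induction xs) (auto simp: dappend_def, metis dl_enc_list)
  then show ?thesis by (simp add: dconcat_def)
qed

lemma ptime_dconcat: "ptime n f \<Longrightarrow> ptime n (\<lambda>e. dconcat (f e))"
  unfolding dconcat_foldr
proof (rule ptime_fold[OF _ ptime_Nl, of n f "\<lambda>x r e. dappend x r" "[:0, 1:]"])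
  show "ptime (Suc (Suc n)) (\<lambda>e. dappend (hd e) (hd (tl e)))"
    by (intro ptime_dappend ptime_vars)
  fix d and env :: "data list"
  have "sz (foldr dappend (dl d) Nl) \<le> sz d"
  proof (induction d)
    case (Cns x d)
    then show ?case using sz_dappend[of x "foldr dappend (dl d) Nl"] by simp
  qed simp
  then show "sz (foldr dappend (dl d) Nl) \<le> poly [:0, 1:] (szs (d # env))" by simp
qed

lemma ptime_ex:
  assumes l: "ptime n l" and g: "ptime (Suc n) (\<lambda>e. enc_bool (g (hd e) (tl e)))"
  shows "ptime n (\<lambda>e. enc_bool (\<exists>x\<in>set (dl (l e)). g x e))"
  by (rule ptime_cong[OF ptime_not[OF ptime_eq[OF ptime_dfilter[OF l g] ptime_Nl]]])
    (auto simp: dfilter_def filter_empty_conv)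

lemma ptime_all:
  assumes l: "ptime n l" and g: "ptime (Suc n) (\<lambda>e. enc_bool (g (hd e) (tl e)))"
  shows "ptime n (\<lambda>e. enc_bool (\<forall>x\<in>set (dl (l e)). g x e))"
  using ptime_not[OF ptime_ex[OF l ptime_not[OF g]]] by simp

lemma ptime_mem:
  assumes "ptime n f" and "ptime n l"
  shows "ptime n (\<lambda>e. enc_bool (f e \<in> set (dl (l e))))"
proof -
  have "ptime n (\<lambda>e. enc_bool (\<exists>x\<in>set (dl (l e)). x = f e))"
    by (intro ptime_ex assms ptime_eq ptime_vars ptime_tl)
  then show ?thesis by simp
qed

text \<open>A suffix is a position in a list together with what follows, and so replaces an index in
  a language without numbers.\<close>

fun dsuffixes :: "data \<Rightarrow> data" where
  "dsuffixes Nl = Cns Nl Nl"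
| "dsuffixes (Cns x y) = Cns (Cns x y) (dsuffixes y)"

lemma hd_dsuffixes [simp]: "hd_data (dsuffixes d) = d"
  by (cases d) auto

lemma sz_dsuffixes: "sz (dsuffixes d) \<le> (sz d + 2) * (sz d + 2)"
proof (induction d)
  case (Cns x y)
  have "0 < sz x" by simp
  with Cns show ?case by (simp add: algebra_simps)
qed simp

lemma ptime_dsuffixes:
  assumes "ptime n f"
  shows "ptime n (\<lambda>e. dsuffixes (f e))"
proof -
  have eq: "dsuffixes d = foldr (\<lambda>x r. Cns (Cns x (hd_data r)) r) (dl d) (Cns Nl Nl)" for d
  proof (induction d)
    case (Cns x d)
    from Cns(2)[symmetric] show ?case by simp
  qed simp
  show ?thesis
    unfolding eq
  proof (rule ptime_fold[OF assms, of _ "\<lambda>x r e. Cns (Cns x (hd_data r)) r" "[:2, 1:] * [:2, 1:]"])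
    show "ptime (Suc (Suc n)) (\<lambda>e. Cns (Cns (hd e) (hd_data (hd (tl e)))) (hd (tl e)))"
      by (intro ptime_Cns ptime_hd_data ptime_vars)
    fix d and env :: "data list"
    have "(sz d + 2) * (sz d + 2) \<le> (szs (d # env) + 2) * (szs (d # env) + 2)"
      by (intro mult_mono) auto
    with sz_dsuffixes[of d] have "sz (dsuffixes d) \<le> (szs (d # env) + 2) * (szs (d # env) + 2)" by simp
    then show "sz (foldr (\<lambda>x r. Cns (Cns x (hd_data r)) r) (dl d) (Cns Nl Nl))
        \<le> poly ([:2, 1:] * [:2, 1:]) (szs (d # env))"
      by (simp add: eq[symmetric] add.commute del: szs_Cons)
  qed (intro ptime_Cns ptime_Nl)
qed

text \<open>Kleene iteration inside a finite universe. Each stage filters the universe anew instead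
  of enlarging its predecessor, so all stages are sublists of \<open>u\<close> and the size
  condition of \<open>ptime_fold\<close> holds.\<close>

definition dlfp :: "(data \<Rightarrow> data \<Rightarrow> bool) \<Rightarrow> data \<Rightarrow> data" where
  "dlfp p u = ((\<lambda>k. dfilter (p k) u) ^^ length (dl u)) Nl"

lemma foldr_const: "foldr (\<lambda>_. f) xs a = (f ^^ length xs) a"
  by (induction xs) auto

lemma ptime_dlfp:
  assumes u: "ptime n u" and p: "ptime (Suc (Suc n)) (\<lambda>e. enc_bool (p (hd (tl e)) (hd e) (tl (tl e))))"
  shows "ptime n (\<lambda>e. dlfp (\<lambda>k x. p k x e) (u e))"
proof -
  \<comment> \<open>The fold runs over the universe as a clock and ignores its elements.\<close>
  have "ptime n (\<lambda>e. foldr (\<lambda>_ k. dfilter (\<lambda>x. p k x e) (u e)) (dl (u e)) Nl)"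
  proof -
    from u obtain q :: "nat poly" where q: "\<And>env. length env = n \<Longrightarrow> sz (u env) \<le> poly q (szs env)"
      unfolding ptime_def by blast
    show ?thesis
    proof (rule ptime_fold[OF u ptime_Nl, of _ "q + [:1:]"])
      show "ptime (Suc (Suc n)) (\<lambda>e. dfilter (\<lambda>x. p (hd (tl e)) x (tl (tl e))) (u (tl (tl e))))"
        using ptime_skip[OF p] by (intro ptime_dfilter ptime_tl[OF ptime_tl[OF u]]) simp
      fix d and env :: "data list"
      assume n: "length env = n"
      have "sz (dfilter r e) \<le> sz e" for r e
        unfolding dfilter_def by (induction e) auto
      then have "sz (foldr (\<lambda>_ k. dfilter (\<lambda>x. p k x env) (u env)) (dl d) Nl) \<le> sz (u env) + 1"
        by (cases d) (auto intro: le_SucI)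
      moreover have "poly q (szs env) \<le> poly q (szs (d # env))" by (rule poly_mono_nat) simp
      ultimately show "sz (foldr (\<lambda>_ k. dfilter (\<lambda>x. p k x env) (u env)) (dl d) Nl)
          \<le> poly (q + [:1:]) (szs (d # env))"
        using q[OF n] by simp
    qed
  qed
  then show ?thesis by (simp add: dlfp_def foldr_const)
qed

lemma dlfp_induct:
  assumes "x \<in> set (dl (dlfp p u))"
    and "\<And>k x. \<lbrakk>\<And>y. y \<in> set (dl k) \<Longrightarrow> Q y; x \<in> set (dl u); p k x\<rbrakk> \<Longrightarrow> Q x"
  shows "Q x"
proof -
  have "\<forall>x\<in>set (dl (((\<lambda>k. dfilter (p k) u) ^^ i) Nl)). Q x" for i
    by (induction i) (auto intro: assms(2))
  then show ?thesis using assms(1) by (auto simp: dlfp_def)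
qed

text \<open>The stages increase, and one that equals its predecessor is final. Until then every
  round adds an element, so as many rounds as \<open>u\<close> has entries reach the fixed
  point.\<close>

lemma dlfp_closed:
  assumes mono: "\<And>k k' x. set (dl k) \<subseteq> set (dl k') \<Longrightarrow> p k x \<Longrightarrow> p k' x"
    and x: "x \<in> set (dl u)" "p (dlfp p u) x"
  shows "x \<in> set (dl (dlfp p u))"
proof -
  define it where "it i = ((\<lambda>k. dfilter (p k) u) ^^ i) Nl" for i
  define K where "K i = set (dl (it i))" for i
  have K_Suc: "K (Suc i) = {x \<in> set (dl u). p (it i) x}" for i
    by (auto simp: K_def it_def)
  have K_mono: "K (Suc i) \<subseteq> K (Suc j)" if "K i \<subseteq> K j" for i j
    using mono[of "it i" "it j"] that unfolding K_Suc by (auto simp: K_def)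
  have incr: "K i \<subseteq> K (Suc i)" for i
  proof (induction i)
    case (Suc i)
    then show ?case by (rule K_mono)
  qed (simp add: K_def it_def)
  have stable: "K (Suc (Suc i)) = K (Suc i)" if "K (Suc i) = K i" for i
    using K_mono[of i "Suc i"] K_mono[of "Suc i" i] that by auto
  have sub: "K i \<subseteq> set (dl u)" for i
    by (cases i) (auto simp: K_def it_def)
  have "K (Suc i) = K i \<or> i \<le> card (K i)" for i
  proof (induction i)
    case (Suc i)
    show ?case
    proof (cases "K (Suc i) = K i")
      case False
      with Suc have "i \<le> card (K i)" by simp
      moreover have "card (K i) < card (K (Suc i))"
        using False incr[of i] sub[of "Suc i"] by (intro psubset_card_mono) (auto intro: finite_subset)
      ultimately show ?thesis by simp
    qed (simp add: stable)
  qed simp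
  from this[of "length (dl u)"] have "K (Suc (length (dl u))) = K (length (dl u))"
  proof
    \<comment> \<open>The stage now has at least as many elements as the universe, hence exhausts
      it.\<close>
    assume "length (dl u) \<le> card (K (length (dl u)))"
    moreover have "card (set (dl u)) \<le> length (dl u)" by (rule card_length)
    ultimately have "K (length (dl u)) = set (dl u)"
      by (intro card_seteq sub) auto
    then show ?thesis using sub incr by (metis subset_antisym)
  qed
  moreover have "x \<in> K (Suc (length (dl u)))"
    using x unfolding K_Suc by (simp add: dlfp_def it_def)
  ultimately show ?thesis by (simp add: K_def it_def dlfp_def)
qed

section \<open>Unary counters and comparison with binary numbers\<close>

abbreviation unary :: "nat \<Rightarrow> data" where
  "unary m \<equiv> enc_list (replicate m Nl)"

lemma sz_unary [simp]: "sz (unary m) = 2 * m + 1"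
  by (induction m) auto

lemma length_dl_double_sz: "2 * length (dl d) + 1 \<le> sz d"
proof (induction d)
  case (Cns x d)
  have "0 < sz x" by simp
  with Cns show ?case by simp
qed simp

definition dlength :: "data \<Rightarrow> data" where
  "dlength d = unary (length (dl d))"

lemma dlength_eq_iff [simp]: "dlength c = dlength d \<longleftrightarrow> length (dl c) = length (dl d)"
  by (metis dl_enc_list dlength_def length_replicate)

lemma ptime_dlength: "ptime n f \<Longrightarrow> ptime n (\<lambda>e. dlength (f e))"
proof -
  assume f: "ptime n f"
  have "ptime n (\<lambda>e. dmap (\<lambda>x. Nl) (f e))" by (intro ptime_dmap f ptime_Nl)
  then show ?thesis by (simp add: dmap_def dlength_def map_replicate_const)
qed

text \<open>Floor and ceiling of half the length are kept together because they exchange roles: with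
  one more element, the new floor is the old ceiling and the new ceiling is the old floor plus one.
  One fold therefore computes both.\<close>

definition dhalf :: "data \<Rightarrow> data" where
  "dhalf d = Cns (unary (length (dl d) div 2)) (unary ((length (dl d) + 1) div 2))"

lemma ptime_dhalf:
  assumes "ptime n f"
  shows "ptime n (\<lambda>e. dhalf (f e))"
proof -
  have eq: "dhalf d = foldr (\<lambda>x r. Cns (tl_data r) (Cns Nl (hd_data r))) (dl d) (Cns Nl Nl)" for d
  proof (induction d)
    case (Cns x d)
    have "(length (dl d) + 2) div 2 = length (dl d) div 2 + 1" by simp
    then show ?case by (simp add: Cns(2)[symmetric] dhalf_def)
  qed (simp add: dhalf_def)
  show ?thesis
    unfolding eq
  proof (rule ptime_fold[OF assms, of _ "\<lambda>x r e. Cns (tl_data r) (Cns Nl (hd_data r))" "[:3, 2:]"])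
    show "ptime (Suc (Suc n)) (\<lambda>e. Cns (tl_data (hd (tl e))) (Cns Nl (hd_data (hd (tl e)))))"
      by (intro ptime_Cns ptime_hd_data ptime_tl_data ptime_Nl ptime_vars)
    fix d and env :: "data list"
    show "sz (foldr (\<lambda>x r. Cns (tl_data r) (Cns Nl (hd_data r))) (dl d) (Cns Nl Nl))
        \<le> poly [:3, 2:] (szs (d # env))"
      using length_dl_double_sz[of d] by (simp add: eq[symmetric] dhalf_def)
  qed (intro ptime_Cns ptime_Nl)
qed

fun bval :: "bool list \<Rightarrow> nat" where
  "bval [] = 0"
| "bval (b # bs) = (if b then 1 else 0) + 2 * bval bs"

text \<open>The bits are expected most significant first.\<close>

definition dle_bits :: "data \<Rightarrow> data \<Rightarrow> bool" where
  "dle_bits d b \<longleftrightarrow>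
     foldr (\<lambda>x r. if x \<noteq> Nl then hd_data (dhalf r) else tl_data (dhalf r)) (dl b) (dlength d) = Nl"

text \<open>Expanding the binary number in unary would take exponential time. Instead the unary side
  is halved once per bit, starting at the end of the list with the least significant one:
  \<open>m \<le> 1 + 2 * v\<close> iff the floor of \<open>m / 2\<close> is at most
  \<open>v\<close>, and \<open>m \<le> 2 * v\<close> iff the ceiling is.\<close>

lemma dle_bits_iff: "dle_bits d b \<longleftrightarrow> length (dl d) \<le> bval (map (\<lambda>x. x \<noteq> Nl) (rev (dl b)))"
proof -
  have "foldr (\<lambda>x r. if x \<noteq> Nl then hd_data (dhalf r) else tl_data (dhalf r)) (rev bs) (unary m) = Nl
      \<longleftrightarrow> m \<le> bval (map (\<lambda>x. x \<noteq> Nl) bs)" for bs m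
  proof (induction bs arbitrary: m)
    case (Cons b bs)
    have step: "hd_data (dhalf (unary m)) = unary (m div 2)"
      "tl_data (dhalf (unary m)) = unary ((m + 1) div 2)"
      by (simp_all add: dhalf_def)
    have "m div 2 \<le> v \<longleftrightarrow> m \<le> 1 + 2 * v" "(m + 1) div 2 \<le> v \<longleftrightarrow> m \<le> 2 * v" for v :: nat
      by linarith+
    with Cons.IH[of "m div 2"] Cons.IH[of "(m + 1) div 2"] show ?case
      by (simp add: step)
  qed simp
  from this[of "rev (dl b)"] show ?thesis by (simp add: dle_bits_def dlength_def)
qed

lemma ptime_dle_bits:
  assumes "ptime n f" and "ptime n g"
  shows "ptime n (\<lambda>e. enc_bool (dle_bits (f e) (g e)))"
proof -
  let ?F = "\<lambda>b d. foldr (\<lambda>x r. if x \<noteq> Nl then hd_data (dhalf r) else tl_data (dhalf r)) (dl b) d"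
  have "ptime n (\<lambda>e. ?F (g e) (dlength (f e)))"
  proof -
    from ptime_dlength[OF assms(1)] obtain q :: "nat poly"
      where q: "\<And>env. length env = n \<Longrightarrow> sz (dlength (f env)) \<le> poly q (szs env)"
      unfolding ptime_def by blast
    show ?thesis
    proof (rule ptime_fold[OF assms(2) ptime_dlength[OF assms(1)],
          of "\<lambda>x r e. if x \<noteq> Nl then hd_data (dhalf r) else tl_data (dhalf r)" q])
      show "ptime (Suc (Suc n)) (\<lambda>e. if hd e \<noteq> Nl then hd_data (dhalf (hd (tl e))) else tl_data (dhalf (hd (tl e))))"
        by (intro ptime_if ptime_not ptime_eq ptime_hd_data ptime_tl_data ptime_dhalf ptime_Nl ptime_vars)
      fix d and env :: "data list"
      assume n: "length env = n"
      have half: "sz (hd_data (dhalf r)) \<le> sz r" "sz (tl_data (dhalf r)) \<le> sz r" for r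
      proof -
        have "Suc (length (dl r)) div 2 \<le> length (dl r)" by linarith
        then have "Suc (2 * (Suc (length (dl r)) div 2)) \<le> Suc (2 * length (dl r))" by simp
        then show "sz (hd_data (dhalf r)) \<le> sz r" "sz (tl_data (dhalf r)) \<le> sz r"
          using length_dl_double_sz[of r] by (simp_all add: dhalf_def)
      qed
      have "sz (foldr (\<lambda>x r. if x \<noteq> Nl then hd_data (dhalf r) else tl_data (dhalf r)) xs r) \<le> sz r" for xs r
        by (induction xs) (auto intro: order_trans[OF half(1)] order_trans[OF half(2)])
      from this[of "dl d" "dlength (f env)"] q[OF n] poly_mono_nat[of "szs env" "szs (d # env)" q]
      show "sz (?F d (dlength (f env))) \<le> poly q (szs (d # env))" by simp
    qed
  qed
  from ptime_eq[OF this ptime_Nl] show ?thesis by (simp add: dle_bits_def)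
qed

lemmas ptime_intros = ptime_Nl ptime_Cns ptime_hd_data ptime_tl_data ptime_if ptime_True ptime_False
  ptime_not ptime_conj ptime_disj ptime_imp ptime_mem ptime_ex ptime_all ptime_eq ptime_dmap ptime_dfilter
  ptime_dappend ptime_dconcat ptime_dsuffixes ptime_dlength ptime_dle_bits ptime_vars

section \<open>A derivation system for assignments\<close>

text \<open>The equivalence relation generated by \<open>E\<close>; interfaces store a connection in
  one orientation only, hence the converse.\<close>

definition sclosure :: "('a \<times> 'a) set \<Rightarrow> ('a \<times> 'a) set" where
  "sclosure E = (E \<union> E\<inverse>)\<^sup>*"

lemma sclosure_sym: "(x, y) \<in> sclosure E \<Longrightarrow> (y, x) \<in> sclosure E"
  unfolding sclosure_def by (metis converse_Un converse_converse rtrancl_converseI sup_commute)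

lemma sclosure_refl [simp]: "(x, x) \<in> sclosure E"
  by (simp add: sclosure_def)

lemma sclosure_trans: "(x, y) \<in> sclosure E \<Longrightarrow> (y, z) \<in> sclosure E \<Longrightarrow> (x, z) \<in> sclosure E"
  unfolding sclosure_def by (rule rtrancl_trans)

lemma sclosure_base: "(x, y) \<in> E \<Longrightarrow> (x, y) \<in> sclosure E"
  by (auto simp: sclosure_def)

lemma sclosure_sub:
  assumes "E \<subseteq> H\<^sup>*" and "sym H"
  shows "sclosure E \<subseteq> H\<^sup>*"
proof -
  have "sym (H\<^sup>*)" using assms(2) by (rule sym_rtrancl)
  with assms(1) have "E \<union> E\<inverse> \<subseteq> H\<^sup>*" by (auto dest: symD)
  then have "(E \<union> E\<inverse>)\<^sup>* \<subseteq> (H\<^sup>*)\<^sup>*" by (rule rtrancl_mono)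
  then show ?thesis by (simp add: sclosure_def)
qed

text \<open>While the path is inside \<open>Z\<close>, the induction remembers the last vertex of \<open>X\<close> on it.\<close>

lemma rtrancl_contract:
  assumes "(x, y) \<in> (H \<union> E)\<^sup>*" and "x \<in> X"
    and H: "\<And>u v. (u, v) \<in> H \<Longrightarrow> (u \<in> Z \<or> v \<in> Z) \<and> u \<in> Z \<union> X \<and> v \<in> Z \<union> X"
    and E: "\<And>u v. (u, v) \<in> E \<Longrightarrow> u \<notin> Z \<and> v \<notin> Z"
    and Q: "\<And>u v. \<lbrakk>u \<in> X; v \<in> X; (u, v) \<in> H\<^sup>*\<rbrakk> \<Longrightarrow> (u, v) \<in> Q\<^sup>*"
    and XZ: "X \<inter> Z = {}"
    and "y \<notin> Z"
  shows "(x, y) \<in> (Q \<union> E)\<^sup>*"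
proof -
  have Q': "(u, v) \<in> (Q \<union> E)\<^sup>*" if "u \<in> X" "v \<in> X" "(u, v) \<in> H\<^sup>*" for u v
    using Q[OF that] by (metis in_rtrancl_UnI)
  from assms(1) have "if y \<in> Z then \<exists>x'\<in>X. (x, x') \<in> (Q \<union> E)\<^sup>* \<and> (x', y) \<in> H\<^sup>* else (x, y) \<in> (Q \<union> E)\<^sup>*"
  proof (induction rule: rtrancl_induct)
    case base
    show ?case using \<open>x \<in> X\<close> XZ by auto
  next
    case (step y z)
    show ?case
    proof (cases "(y, z) \<in> E")
      case True
      with step.IH E[OF True] show ?thesis by (auto intro: rtrancl_into_rtrancl)
    next
      case False
      with step have yz: "(y, z) \<in> H" by auto
      show ?thesis
      proof (cases "y \<in> Z")
        case True
        with step.IH obtain x' where x': "x' \<in> X" "(x, x') \<in> (Q \<union> E)\<^sup>*" "(x', y) \<in> H\<^sup>*" by auto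
        then have "(x', z) \<in> H\<^sup>*" using yz by (auto intro: rtrancl_into_rtrancl)
        with x' Q' H[OF yz] show ?thesis by (auto intro: rtrancl_trans)
      next
        case False
        with H[OF yz] step.IH yz show ?thesis by auto
      qed
    qed
  qed
  with \<open>y \<notin> Z\<close> show ?thesis by simp
qed

text \<open>Channels do not occur here: a state of type \<open>'s\<close> stands for a channel set,
  of which only admissibility and non-disjointness matter. The system can thus be applied directly
  to encoded sets.\<close>

locale assignment_problem =
  fixes V :: "'v set"
    and adj :: "'v \<Rightarrow> 'v \<Rightarrow> bool"
    and allowed :: "'v \<Rightarrow> 's set"
    and meets :: "'s \<Rightarrow> 's \<Rightarrow> bool"
  assumes finite_V: "finite V"
    and adj_V: "adj u v \<Longrightarrow> u \<in> V \<and> v \<in> V"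
    and adj_sym: "adj u v \<Longrightarrow> adj v u"
    and meets_sym: "meets s t \<Longrightarrow> meets t s"
begin

definition realized :: "('v \<Rightarrow> 's) \<Rightarrow> ('v \<times> 'v) set" where
  "realized A = {(u, v). adj u v \<and> meets (A u) (A v)}"

definition solvable :: bool where
  "solvable \<longleftrightarrow> V \<noteq> {} \<and> (\<exists>A. (\<forall>v\<in>V. A v \<in> allowed v) \<and> V \<times> V \<subseteq> (realized A)\<^sup>*)"

text \<open>Edges with both ends in \<open>X\<close> are excluded, so disjoint parts behind the same
  bag own disjoint sets of edges.\<close>

definition around :: "('v \<Rightarrow> 's) \<Rightarrow> 'v set \<Rightarrow> 'v set \<Rightarrow> ('v \<times> 'v) set" where
  "around A Z X = {(u, v) \<in> realized A. (u \<in> Z \<or> v \<in> Z) \<and> u \<in> Z \<union> X \<and> v \<in> Z \<union> X}"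

definition bag :: "('v \<times> 's) set \<Rightarrow> bool" where
  "bag \<beta> \<longleftrightarrow> single_valued \<beta> \<and> (\<forall>(v, s)\<in>\<beta>. v \<in> V \<and> s \<in> allowed v)"

text \<open>A triple stands for partial solutions on \<open>Z\<close> behind the assigned bag \<open>\<beta>\<close>: no part
  of \<open>Z\<close> is separated from the bag, and \<open>R\<close> records connections inside \<open>Z\<close>.\<close>

definition sound :: "('v \<times> 's) set \<Rightarrow> 'v set \<Rightarrow> ('v \<times> 'v) set \<Rightarrow> bool" where
  "sound \<beta> Z R \<longleftrightarrow> Z \<inter> Domain \<beta> = {} \<and>
     (\<exists>A. (\<forall>(v, s)\<in>\<beta>. A v = s) \<and> (\<forall>v\<in>Z. A v \<in> allowed v) \<and> R \<subseteq> (around A Z (Domain \<beta>))\<^sup>* \<and>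
        (\<forall>v\<in>Z. \<exists>x\<in>Domain \<beta>. (v, x) \<in> (around A Z (Domain \<beta>))\<^sup>*))"

text \<open>Edges inside a bag that have to be accounted for once the vertices of \<open>Z\<close>
  are no longer in the bag. In \<open>final_ok\<close> this set is the whole bag, so all edges
  inside it count.\<close>

definition bag_edges :: "('v \<times> 's) set \<Rightarrow> 'v set \<Rightarrow> ('v \<times> 'v) set" where
  "bag_edges \<beta> Z = {(u, v). \<exists>s t. (u, s) \<in> \<beta> \<and> (v, t) \<in> \<beta> \<and> adj u v \<and> meets s t \<and> (u \<in> Z \<or> v \<in> Z)}"

text \<open>The primed triple is the premise, the other one the conclusion. By the condition on
  neighbours the new bag separates \<open>Z\<close> from the rest, so a vertex left behind without a
  connection to the new bag could never be connected again; the last condition excludes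
  this.\<close>

definition step_ok :: "('v \<times> 's) set \<Rightarrow> 'v set \<Rightarrow> ('v \<times> 'v) set \<Rightarrow>
    ('v \<times> 's) set \<Rightarrow> 'v set \<Rightarrow> ('v \<times> 'v) set \<Rightarrow> bool" where
  "step_ok \<beta> Z R \<beta>' Z' R' \<longleftrightarrow>
     Z \<inter> Domain \<beta> = {} \<and> (\<forall>u\<in>Z. \<forall>v\<in>V. adj u v \<longrightarrow> v \<in> Z \<union> Domain \<beta>) \<and>
     Z' \<subseteq> Z \<and> Z \<subseteq> Z' \<union> Domain \<beta>' \<and>
     (\<forall>v s t. (v, s) \<in> \<beta> \<longrightarrow> (v, t) \<in> \<beta>' \<longrightarrow> s = t) \<and>
     R \<subseteq> sclosure (R' \<union> bag_edges \<beta>' Z) \<and>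
     (\<forall>v\<in>Z \<inter> Domain \<beta>'. \<exists>x\<in>Domain \<beta>. (v, x) \<in> sclosure (R' \<union> bag_edges \<beta>' Z))"

definition final_ok :: "('v \<times> 's) set \<Rightarrow> 'v set \<Rightarrow> ('v \<times> 'v) set \<Rightarrow> bool" where
  "final_ok \<beta> Z R \<longleftrightarrow> Domain \<beta> \<noteq> {} \<and> V \<subseteq> Z \<union> Domain \<beta> \<and>
     Domain \<beta> \<times> Domain \<beta> \<subseteq> sclosure (R \<union> bag_edges \<beta> (Domain \<beta>))"

lemma sym_realized: "sym (realized A)"
  by (auto simp: sym_def realized_def adj_sym meets_sym)

lemma sym_around: "sym (around A Z X)"
  using sym_realized by (auto simp: sym_def around_def)

lemma around_cong:
  assumes "\<And>v. v \<in> Z \<union> X \<Longrightarrow> A v = A' v"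
  shows "around A Z X = around A' Z X"
  using assms by (auto simp: around_def realized_def)

lemma bag_functional: "single_valued \<beta> \<Longrightarrow> \<exists>A. \<forall>(v, s)\<in>\<beta>. A v = s"
  by (intro exI[of _ "\<lambda>v. THE s. (v, s) \<in> \<beta>"]) (auto simp: single_valued_def)

lemma sound_empty:
  assumes "single_valued \<beta>" and "R \<subseteq> Id"
  shows "sound \<beta> {} R"
  using bag_functional[OF assms(1)] assms(2) by (auto simp: sound_def)

text \<open>Both partial solutions follow \<open>\<beta>\<close> on the bag, and their parts are
  disjoint, so they can be glued and the walks of either survive.\<close>

lemma sound_union:
  assumes "sound \<beta> Z1 R1" and "sound \<beta> Z2 R2" and disj: "Z1 \<inter> Z2 = {}"
    and R: "R \<subseteq> sclosure (R1 \<union> R2)"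
  shows "sound \<beta> (Z1 \<union> Z2) R"
proof -
  let ?X = "Domain \<beta>"
  from assms(1) obtain A1 where Z1: "Z1 \<inter> ?X = {}" and A1: "\<forall>(v, s)\<in>\<beta>. A1 v = s" "\<forall>v\<in>Z1. A1 v \<in> allowed v"
    "R1 \<subseteq> (around A1 Z1 ?X)\<^sup>*" "\<forall>v\<in>Z1. \<exists>x\<in>?X. (v, x) \<in> (around A1 Z1 ?X)\<^sup>*"
    by (auto simp: sound_def)
  from assms(2) obtain A2 where Z2: "Z2 \<inter> ?X = {}" and A2: "\<forall>(v, s)\<in>\<beta>. A2 v = s" "\<forall>v\<in>Z2. A2 v \<in> allowed v"
    "R2 \<subseteq> (around A2 Z2 ?X)\<^sup>*" "\<forall>v\<in>Z2. \<exists>x\<in>?X. (v, x) \<in> (around A2 Z2 ?X)\<^sup>*"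
    by (auto simp: sound_def)
  define A where "A v = (if v \<in> Z1 then A1 v else A2 v)" for v
  let ?H = "around A (Z1 \<union> Z2) ?X"
  have "around A1 Z1 ?X = around A Z1 ?X"
    using A1(1) A2(1) by (intro around_cong) (auto simp: A_def)
  then have H1: "around A1 Z1 ?X \<subseteq> ?H" by (auto simp: around_def)
  have "around A2 Z2 ?X = around A Z2 ?X"
    using A1(1) A2(1) disj Z1 by (intro around_cong) (auto simp: A_def)
  then have H2: "around A2 Z2 ?X \<subseteq> ?H" by (auto simp: around_def)
  have m: "(around A1 Z1 ?X)\<^sup>* \<subseteq> ?H\<^sup>*" "(around A2 Z2 ?X)\<^sup>* \<subseteq> ?H\<^sup>*"
    using H1 H2 by (intro rtrancl_mono; simp)+
  then have "sclosure (R1 \<union> R2) \<subseteq> ?H\<^sup>*"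
    using A1(3) A2(3) by (intro sclosure_sub sym_around) auto
  moreover have "\<forall>(v, s)\<in>\<beta>. A v = s" using A1(1) A2(1) by (auto simp: A_def)
  moreover have "\<forall>v\<in>Z1 \<union> Z2. A v \<in> allowed v" using A1(2) A2(2) by (auto simp: A_def)
  moreover have "\<forall>v\<in>Z1 \<union> Z2. \<exists>x\<in>?X. (v, x) \<in> ?H\<^sup>*" using A1(4) A2(4) m by blast
  ultimately show ?thesis using R Z1 Z2 unfolding sound_def by (intro conjI exI[of _ A]) auto
qed

text \<open>The solution of the premise is kept on \<open>Z'\<close> and on the old bag. On the new
  bag \<open>\<beta>\<close> takes precedence, which changes nothing on the old one because the two
  bags agree where they overlap.\<close>

lemma sound_step:
  assumes "sound \<beta>' Z' R'" and sv: "single_valued \<beta>" and bag: "bag \<beta>'" and ok: "step_ok \<beta> Z R \<beta>' Z' R'"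
  shows "sound \<beta> Z R"
proof -
  let ?X = "Domain \<beta>" and ?X' = "Domain \<beta>'"
  from assms(1) obtain A1 where Z': "Z' \<inter> ?X' = {}" and A1: "\<forall>(v, s)\<in>\<beta>'. A1 v = s" "\<forall>v\<in>Z'. A1 v \<in> allowed v"
    "R' \<subseteq> (around A1 Z' ?X')\<^sup>*" "\<forall>v\<in>Z'. \<exists>x\<in>?X'. (v, x) \<in> (around A1 Z' ?X')\<^sup>*"
    by (auto simp: sound_def)
  from ok have ZX: "Z \<inter> ?X = {}" and closed: "\<And>u v. u \<in> Z \<Longrightarrow> adj u v \<Longrightarrow> v \<in> Z \<union> ?X"
    and sub: "Z' \<subseteq> Z" "Z \<subseteq> Z' \<union> ?X'"
    and agree: "\<And>v s t. (v, s) \<in> \<beta> \<Longrightarrow> (v, t) \<in> \<beta>' \<Longrightarrow> s = t"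
    and R: "R \<subseteq> sclosure (R' \<union> bag_edges \<beta>' Z)"
    and conn: "\<And>v. v \<in> Z \<Longrightarrow> v \<in> ?X' \<Longrightarrow> \<exists>x\<in>?X. (v, x) \<in> sclosure (R' \<union> bag_edges \<beta>' Z)"
    using adj_V by (auto simp: step_ok_def)
  obtain A2 where A2: "\<forall>(v, s)\<in>\<beta>. A2 v = s" using bag_functional[OF sv] by blast
  define A where "A v = (if v \<in> ?X then A2 v else A1 v)" for v
  let ?H = "around A Z ?X"
  have A_A1: "A v = A1 v" if v: "v \<in> Z' \<union> ?X'" for v
  proof (cases "v \<in> ?X")
    case True
    \<comment> \<open>\<open>Z\<close> avoids the new bag, so \<open>v\<close> is not in
      \<open>Z'\<close> and therefore lies in both bags.\<close>
    with v ZX sub obtain s t where "(v, s) \<in> \<beta>" "(v, t) \<in> \<beta>'" by blast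
    with agree A1(1) A2 show ?thesis by (fastforce simp: A_def)
  qed (simp add: A_def)
  have "around A1 Z' ?X' = around A Z' ?X'"
    by (intro around_cong) (simp add: A_A1)
  also have "\<dots> \<subseteq> ?H"
  proof
    fix e assume e: "e \<in> around A Z' ?X'"
    obtain u v where uv: "e = (u, v)" by (cases e)
    with e have "adj u v" "u \<in> Z' \<or> v \<in> Z'" by (auto simp: around_def realized_def)
    then have "u \<in> Z \<union> ?X \<and> v \<in> Z \<union> ?X \<and> (u \<in> Z \<or> v \<in> Z)"
      using closed[of u v] closed[of v u] adj_sym sub(1) by auto
    then show "e \<in> ?H" using e uv by (auto simp: around_def)
  qed
  finally have H1: "around A1 Z' ?X' \<subseteq> ?H" .
  have E: "bag_edges \<beta>' Z \<subseteq> ?H"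
  proof
    fix e assume e: "e \<in> bag_edges \<beta>' Z"
    then obtain u v s t where uv: "e = (u, v)" "(u, s) \<in> \<beta>'" "(v, t) \<in> \<beta>'" "adj u v" "meets s t" "u \<in> Z \<or> v \<in> Z"
      by (auto simp: bag_edges_def)
    moreover have "A x = r" if "(x, r) \<in> \<beta>'" for x r
      using A_A1[of x] bspec[OF A1(1) that] that by auto
    ultimately have "A u = s" "A v = t" by auto
    moreover from uv have "u \<in> Z \<union> ?X \<and> v \<in> Z \<union> ?X"
      using closed[of u v] closed[of v u] adj_sym uv by auto
    ultimately show "e \<in> ?H" using uv by (auto simp: around_def realized_def)
  qed
  have m: "(around A1 Z' ?X')\<^sup>* \<subseteq> ?H\<^sup>*" using H1 by (rule rtrancl_mono)
  have cl: "sclosure (R' \<union> bag_edges \<beta>' Z) \<subseteq> ?H\<^sup>*"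
    using m A1(3) E by (intro sclosure_sub sym_around) auto
  have "\<forall>v\<in>Z. \<exists>x\<in>?X. (v, x) \<in> ?H\<^sup>*"
  proof
    fix v assume v: "v \<in> Z"
    show "\<exists>x\<in>?X. (v, x) \<in> ?H\<^sup>*"
    proof (cases "v \<in> Z'")
      case True
      \<comment> \<open>The walk supplied by the premise ends in the old bag. If its end is in
        \<open>Z\<close>, it is a vertex left behind by this step, and the last condition of the
        rule leads on to the new bag.\<close>
      with A1(4) m obtain x where x: "x \<in> ?X'" "(v, x) \<in> ?H\<^sup>*" by blast
      from x(2) v have "x \<in> Z \<union> ?X" by (cases rule: rtranclE) (auto simp: around_def)
      then show ?thesis
      proof
        assume "x \<in> Z"
        with conn[OF this x(1)] cl x(2) show ?thesis by (blast intro: rtrancl_trans)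
      qed (use x in blast)
    next
      case False
      with v sub conn cl show ?thesis by blast
    qed
  qed
  moreover have "\<forall>(v, s)\<in>\<beta>. A v = s" using A2 by (auto simp: A_def)
  moreover have "\<forall>v\<in>Z. A v \<in> allowed v"
  proof
    fix v assume v: "v \<in> Z"
    with sub consider "v \<in> Z'" | s where "(v, s) \<in> \<beta>'" by blast
    then show "A v \<in> allowed v"
    proof cases
      case 1
      then show ?thesis using A_A1[of v] A1(2) by simp
    next
      case 2
      have "s \<in> allowed v" using bag 2 by (auto simp: bag_def)
      then show ?thesis using A_A1[of v] bspec[OF A1(1) 2] DomainI[OF 2] by simp
    qed
  qed
  ultimately show ?thesis using ZX R cl unfolding sound_def by (intro conjI exI[of _ A]) auto
qed

lemma sound_final:
  assumes "sound \<beta> Z R" and bag: "bag \<beta>" and ok: "final_ok \<beta> Z R"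
  shows solvable
proof -
  let ?X = "Domain \<beta>"
  from assms(1) obtain A where A: "\<forall>(v, s)\<in>\<beta>. A v = s" "\<forall>v\<in>Z. A v \<in> allowed v"
    "R \<subseteq> (around A Z ?X)\<^sup>*" "\<forall>v\<in>Z. \<exists>x\<in>?X. (v, x) \<in> (around A Z ?X)\<^sup>*"
    by (auto simp: sound_def)
  from ok have ok: "?X \<noteq> {}" "V \<subseteq> Z \<union> ?X" "?X \<times> ?X \<subseteq> sclosure (R \<union> bag_edges \<beta> ?X)"
    by (auto simp: final_ok_def)
  have m: "(around A Z ?X)\<^sup>* \<subseteq> (realized A)\<^sup>*" by (rule rtrancl_mono) (auto simp: around_def)
  have "A v = s" if "(v, s) \<in> \<beta>" for v s using bspec[OF A(1) that] by simp
  then have "bag_edges \<beta> ?X \<subseteq> realized A" by (auto simp: bag_edges_def realized_def)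
  then have "sclosure (R \<union> bag_edges \<beta> ?X) \<subseteq> (realized A)\<^sup>*"
    using m A(3) by (intro sclosure_sub sym_realized) auto
  with ok(3) have X: "(x, y) \<in> (realized A)\<^sup>*" if "x \<in> ?X" "y \<in> ?X" for x y using that by blast
  have to_X: "\<exists>x\<in>?X. (v, x) \<in> (realized A)\<^sup>*" if "v \<in> V" for v
    using that ok(2) A(4) m by blast
  have "sym ((realized A)\<^sup>*)" by (intro sym_rtrancl sym_realized)
  then have "(u, v) \<in> (realized A)\<^sup>*" if "u \<in> V" "v \<in> V" for u v
    using to_X[OF that(1)] to_X[OF that(2)] X by (meson rtrancl_trans symD)
  moreover have "\<forall>v\<in>V. A v \<in> allowed v"
  proof
    fix v assume "v \<in> V"
    with ok(2) consider "v \<in> Z" | s where "(v, s) \<in> \<beta>" by blast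
    then show "A v \<in> allowed v" using A(1,2) bag by cases (auto simp: bag_def)
  qed
  moreover have "V \<noteq> {}" using ok(1) bag by (auto simp: bag_def)
  ultimately show ?thesis by (auto simp: solvable_def)
qed

end

section \<open>Completeness along a rooted tree decomposition\<close>

text \<open>Node 0 is the root and parents precede their children. That the nodes whose bags contain
  \<open>v\<close> form a subtree is expressed by \<open>top_parent\<close>: on the way up,
  \<open>v\<close> stays in the bags until its topmost node \<open>top v\<close>.\<close>

locale rooted_decomposition =
  fixes V :: "'v set" and adj :: "'v \<Rightarrow> 'v \<Rightarrow> bool"
    and m :: nat and parent :: "nat \<Rightarrow> nat" and B :: "nat \<Rightarrow> 'v set" and top :: "'v \<Rightarrow> nat"
  assumes parent_less: "0 < i \<Longrightarrow> i < m \<Longrightarrow> parent i < i"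
    and B_V: "i < m \<Longrightarrow> B i \<subseteq> V"
    and adj_B: "adj u v \<Longrightarrow> \<exists>i<m. u \<in> B i \<and> v \<in> B i"
    and top: "v \<in> V \<Longrightarrow> top v < m \<and> v \<in> B (top v)"
    and top_parent: "i < m \<Longrightarrow> v \<in> B i \<Longrightarrow> i \<noteq> top v \<Longrightarrow> 0 < i \<and> v \<in> B (parent i)"
begin

definition par :: "(nat \<times> nat) set" where
  "par = {(i, parent i) | i. 0 < i \<and> i < m}"

definition below :: "nat \<Rightarrow> 'v set" where
  "below i = {v \<in> V. (top v, i) \<in> par\<^sup>*}"

lemma par_le: "(i, j) \<in> par\<^sup>* \<Longrightarrow> j \<le> i"
  by (induction rule: rtrancl_induct) (auto simp: par_def dest: parent_less)

lemma single_valued_par: "single_valued par"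
  by (auto simp: par_def single_valued_def)

lemma top_ancestor: "i < m \<Longrightarrow> v \<in> B i \<Longrightarrow> (i, top v) \<in> par\<^sup>*"
proof (induction i rule: less_induct)
  case (less i)
  show ?case
  proof (cases "i = top v")
    case False
    with less.prems top_parent have "0 < i" "v \<in> B (parent i)" by auto
    with less have "(parent i, top v) \<in> par\<^sup>*" using parent_less[of i] by auto
    moreover have "(i, parent i) \<in> par" using \<open>0 < i\<close> less.prems by (auto simp: par_def)
    ultimately show ?thesis by (rule converse_rtrancl_into_rtrancl[rotated])
  qed simp
qed

lemma root_ancestor: "i < m \<Longrightarrow> (i, 0) \<in> par\<^sup>*"
proof (induction i rule: less_induct)
  case (less i)
  show ?case
  proof (cases "i = 0")
    case False
    then have "(parent i, 0) \<in> par\<^sup>*" using less parent_less[of i] by auto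
    moreover have "(i, parent i) \<in> par" using False less.prems by (auto simp: par_def)
    ultimately show ?thesis by (rule converse_rtrancl_into_rtrancl[rotated])
  qed simp
qed

lemma bag_convex:
  assumes "(i, j) \<in> par\<^sup>*" and "(j, top v) \<in> par\<^sup>*" and "v \<in> B i" and "i < m"
  shows "v \<in> B j"
proof -
  from assms(1) have "j < m \<and> ((j, top v) \<in> par\<^sup>* \<longrightarrow> v \<in> B j)"
  proof (induction rule: rtrancl_induct)
    case (step y z)
    then have z: "0 < y" "y < m" "z = parent y" by (auto simp: par_def)
    then have "z < y" using parent_less by auto
    have "v \<in> B z" if "(z, top v) \<in> par\<^sup>*"
    proof -
      have "(y, top v) \<in> par\<^sup>*" using step.hyps(2) that by (rule converse_rtrancl_into_rtrancl)
      moreover have "y \<noteq> top v" using par_le[OF that] \<open>z < y\<close> by auto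
      ultimately show ?thesis using step.IH z top_parent by auto
    qed
    with z \<open>z < y\<close> show ?case by auto
  qed (use assms in auto)
  with assms(2) show ?thesis by blast
qed

text \<open>The edge lies in some bag \<open>s\<close>, which is below \<open>c\<close> because
  \<open>top u\<close> is. The ancestors of \<open>s\<close> form a chain, so either
  \<open>top v\<close> is below \<open>c\<close>, or \<open>c\<close> lies between \<open>s\<close>
  and \<open>top v\<close> and convexity puts \<open>v\<close> into its bag; unless \<open>c\<close>
  is \<open>top v\<close>, the vertex is then in the bag of the parent as well.\<close>

lemma below_neighbour:
  assumes c: "0 < c" "c < m" and u: "u \<in> below c" and "adj u v" and "v \<in> V"
  shows "v \<in> below c \<or> v \<in> B c \<inter> B (parent c)"
proof -
  from adj_B[OF \<open>adj u v\<close>] obtain s where s: "s < m" "u \<in> B s" "v \<in> B s" by blast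
  from top_ancestor[OF s(1,2)] u have sc: "(s, c) \<in> par\<^sup>*" by (auto simp: below_def)
  from single_valued_confluent[OF single_valued_par sc top_ancestor[OF s(1,3)]]
  show ?thesis
  proof
    assume cv: "(c, top v) \<in> par\<^sup>*"
    from bag_convex[OF sc cv s(3,1)] have "v \<in> B c" .
    then show ?thesis using top_parent[OF c(2)] \<open>v \<in> V\<close> by (cases "top v = c") (auto simp: below_def)
  qed (use \<open>v \<in> V\<close> in \<open>auto simp: below_def\<close>)
qed

lemma parent_bag_not_below:
  assumes "0 < c" "c < m" and "v \<in> B (parent c)" and "v \<in> below c"
  shows False
proof -
  have "parent c < c" using assms parent_less by auto
  then have "(parent c, top v) \<in> par\<^sup>*" using top_ancestor assms by auto
  with assms(4) have "(parent c, c) \<in> par\<^sup>*" by (auto simp: below_def)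
  from par_le[OF this] \<open>parent c < c\<close> show False by simp
qed

lemma below_child:
  assumes "v \<in> below i" and "v \<notin> B i"
  shows "\<exists>c. 0 < c \<and> c < m \<and> parent c = i \<and> v \<in> below c"
proof -
  have "(top v, i) \<in> par\<^sup>*" "v \<in> V" using assms by (auto simp: below_def)
  moreover have "top v \<noteq> i" using top[OF \<open>v \<in> V\<close>] assms(2) by auto
  ultimately obtain c where "(top v, c) \<in> par\<^sup>*" "(c, i) \<in> par" by (metis rtranclE)
  with \<open>v \<in> V\<close> show ?thesis by (auto simp: below_def par_def)
qed

lemma below_root: "below 0 = V"
  using root_ancestor top by (auto simp: below_def)

end

context assignment_problem
begin

section \<open>Components behind a bag\<close>

definition outside :: "'v set \<Rightarrow> ('v \<times> 'v) set" where
  "outside X = {(u, v). adj u v \<and> u \<notin> X \<and> v \<notin> X}"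

definition comp :: "'v set \<Rightarrow> 'v \<Rightarrow> 'v set" where
  "comp X d = {v \<in> V. v \<notin> X \<and> (d, v) \<in> sclosure (outside X)}"

text \<open>With \<open>S\<close> a suffix of the vertex list this is a merge in progress: the part
  of \<open>D\<close> that lies in components of \<open>G - X\<close> already reached.\<close>

definition comps_of :: "'v set \<Rightarrow> 'v set \<Rightarrow> 'v set \<Rightarrow> 'v set" where
  "comps_of X D S = {v \<in> V. v \<in> D \<and> v \<notin> X \<and> (\<exists>u\<in>S. u \<in> D \<and> u \<notin> X \<and> (u, v) \<in> sclosure (outside X))}"

lemma comp_closed: "u \<in> comp X d \<Longrightarrow> adj u v \<Longrightarrow> v \<in> comp X d \<union> X"
proof (rule ccontr)
  assume u: "u \<in> comp X d" and uv: "adj u v" and v: "v \<notin> comp X d \<union> X"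
  then have "(u, v) \<in> outside X" by (auto simp: outside_def comp_def)
  with u have "(d, v) \<in> sclosure (outside X)"
    by (auto simp: comp_def intro: sclosure_trans sclosure_base)
  with v uv adj_V show False by (auto simp: comp_def)
qed

lemma sclosure_outside_invariant:
  assumes "(d, v) \<in> sclosure (outside X)" and "d \<in> D"
    and "\<And>u v. u \<in> D \<Longrightarrow> adj u v \<Longrightarrow> v \<in> D \<union> X"
  shows "v \<in> D"
  using assms(1) unfolding sclosure_def
proof (induction rule: rtrancl_induct)
  case (step y z)
  then have "adj y z" "z \<notin> X" using adj_sym by (auto simp: outside_def)
  with assms(3)[OF step.IH] show ?case by auto
qed (rule assms(2))

text \<open>Until a walk out of \<open>Z\<close> first meets a vertex outside \<open>Z\<close>,
  which must be in \<open>X\<close>, each of its edges has an end in \<open>Z\<close> and belongs to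
  \<open>around\<close>.\<close>

lemma around_exit:
  assumes "(v, x) \<in> (realized A)\<^sup>*" and "v \<in> Z" and "x \<notin> Z"
    and closed: "\<And>u v. u \<in> Z \<Longrightarrow> adj u v \<Longrightarrow> v \<in> Z \<union> X"
  shows "\<exists>y\<in>X - Z. (v, y) \<in> (around A Z X)\<^sup>*"
proof -
  from assms(1) have "(x \<in> Z \<and> (v, x) \<in> (around A Z X)\<^sup>*) \<or> (\<exists>y\<in>X - Z. (v, y) \<in> (around A Z X)\<^sup>*)"
  proof (induction rule: rtrancl_induct)
    case base
    show ?case using \<open>v \<in> Z\<close> by auto
  next
    case (step y z)
    show ?case
    proof (cases "\<exists>y\<in>X - Z. (v, y) \<in> (around A Z X)\<^sup>*")
      case False
      with step have y: "y \<in> Z" "(v, y) \<in> (around A Z X)\<^sup>*" by auto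
      have "z \<in> Z \<union> X" using closed[OF y(1)] step.hyps(2) by (auto simp: realized_def)
      then have "(y, z) \<in> around A Z X" using y(1) step.hyps(2) by (auto simp: around_def)
      with y(2) have "(v, z) \<in> (around A Z X)\<^sup>*" by (rule rtrancl_into_rtrancl)
      with \<open>z \<in> Z \<union> X\<close> show ?thesis by auto
    qed simp
  qed
  with assms(3) show ?thesis by blast
qed

text \<open>Such an \<open>R\<close> generates exactly the connectivity that \<open>H\<close>
  induces on \<open>X\<close>, and can therefore replace everything behind \<open>X\<close>.\<close>

definition canonical :: "('v \<times> 'v) set \<Rightarrow> 'v set \<Rightarrow> ('v \<times> 'v) set \<Rightarrow> bool" where
  "canonical R X H \<longleftrightarrow> R \<subseteq> X \<times> X \<and> R \<subseteq> H\<^sup>* \<and> H\<^sup>* \<inter> X \<times> X \<subseteq> sclosure R"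

text \<open>Small sets will be written as tuples of length exactly \<open>Suc w\<close> with
  repetitions; these cannot represent the empty set.\<close>

definition small :: "nat \<Rightarrow> 'a set \<Rightarrow> bool" where
  "small w S \<longleftrightarrow> finite S \<and> S \<noteq> {} \<and> card S \<le> Suc w"

lemma around_contract:
  assumes R: "canonical R X (around A Z X)" and XZ: "X \<inter> Z = {}"
    and E: "\<And>u v. (u, v) \<in> E \<Longrightarrow> u \<notin> Z \<and> v \<notin> Z"
    and xy: "(x, y) \<in> (around A Z X \<union> E)\<^sup>*" "x \<in> X" "y \<notin> Z"
  shows "(x, y) \<in> ((R \<union> R\<inverse>) \<union> E)\<^sup>*" and "(x, y) \<in> sclosure (R \<union> E)"
proof -
  show *: "(x, y) \<in> ((R \<union> R\<inverse>) \<union> E)\<^sup>*"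
  proof (rule rtrancl_contract[OF xy(1,2) _ E _ XZ xy(3)])
    show "(u \<in> Z \<or> v \<in> Z) \<and> u \<in> Z \<union> X \<and> v \<in> Z \<union> X" if "(u, v) \<in> around A Z X" for u v
      using that by (auto simp: around_def)
    show "(u, v) \<in> (R \<union> R\<inverse>)\<^sup>*" if "u \<in> X" "v \<in> X" "(u, v) \<in> (around A Z X)\<^sup>*" for u v
      using R that by (auto simp: canonical_def sclosure_def)
  qed
  have "(R \<union> R\<inverse>) \<union> E \<subseteq> (R \<union> E) \<union> (R \<union> E)\<inverse>" by auto
  with * show "(x, y) \<in> sclosure (R \<union> E)" unfolding sclosure_def using rtrancl_mono by blast
qed

text \<open>Pairing every vertex with a representative of its class yields no more pairs than there
  are vertices, so the interface is as small as the bag.\<close>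

lemma canonical_exists:
  assumes "sym H" and "small w X"
  shows "\<exists>R. canonical R X H \<and> small w R"
proof -
  define rep where "rep x = (SOME y. y \<in> X \<and> (x, y) \<in> H\<^sup>*)" for x
  have rep: "rep x \<in> X \<and> (x, rep x) \<in> H\<^sup>*" if "x \<in> X" for x
    unfolding rep_def by (rule someI[of _ x]) (use that in auto)
  have symH: "sym (H\<^sup>*)" using assms(1) by (rule sym_rtrancl)
  \<comment> \<open>Equivalent vertices have the same candidates, so \<open>SOME\<close> picks the
    same representative for them.\<close>
  have rep_eq: "rep x = rep y" if "(x, y) \<in> H\<^sup>*" for x y
  proof -
    have "(x, z) \<in> H\<^sup>* \<longleftrightarrow> (y, z) \<in> H\<^sup>*" for z
      using that symH by (meson rtrancl_trans symD)
    then show ?thesis by (simp add: rep_def)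
  qed
  define R where "R = (\<lambda>x. (x, rep x)) ` X"
  have "(x, y) \<in> sclosure R" if "x \<in> X" "y \<in> X" "(x, y) \<in> H\<^sup>*" for x y
  proof -
    have "(x, rep x) \<in> R" "(y, rep y) \<in> R" using that by (auto simp: R_def)
    then have "(x, rep x) \<in> sclosure R" "(y, rep x) \<in> sclosure R"
      using rep_eq[OF that(3)] by (simp_all add: sclosure_base)
    then show ?thesis by (blast intro: sclosure_trans sclosure_sym)
  qed
  then have "canonical R X H" using rep by (auto simp: canonical_def R_def)
  moreover have "small w R" using assms(2) card_image_le[of X "\<lambda>x. (x, rep x)"]
    by (auto simp: small_def R_def)
  ultimately show ?thesis by blast
qed

text \<open>These are the sets on which the induction along the tree works: all vertices at the
  root, and at a child a component behind the bag of its parent.\<close>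

definition region :: "nat \<Rightarrow> 'v set \<Rightarrow> bool" where
  "region w D \<longleftrightarrow> D = V \<or> (\<exists>X d. small w X \<and> X \<subseteq> V \<and> d \<in> V \<and> D = comp X d)"

definition part :: "nat \<Rightarrow> 'v list \<Rightarrow> 'v set \<Rightarrow> bool" where
  "part w vs Z \<longleftrightarrow> region w Z \<or>
     (\<exists>X D i. small w X \<and> X \<subseteq> V \<and> region w D \<and> Z = comps_of X D (set (drop i vs)))"

definition derivable where
  "derivable Der \<beta> Z R \<longleftrightarrow> Z = {} \<and> R \<subseteq> Id \<or>
     (\<exists>Z1 Z2 R1 R2. Der \<beta> Z1 R1 \<and> Der \<beta> Z2 R2 \<and> Z = Z1 \<union> Z2 \<and> Z1 \<inter> Z2 = {} \<and> R \<subseteq> sclosure (R1 \<union> R2)) \<or>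
     (\<exists>\<beta>' Z' R'. Der \<beta>' Z' R' \<and> step_ok \<beta> Z R \<beta>' Z' R')"

text \<open>Closure under the rules is only required for the polynomially many triples that the
  algorithm considers.\<close>

definition derivation_closed ::
    "nat \<Rightarrow> 'v list \<Rightarrow> (('v \<times> 's) set \<Rightarrow> 'v set \<Rightarrow> ('v \<times> 'v) set \<Rightarrow> bool) \<Rightarrow> bool" where
  "derivation_closed w vs Der \<longleftrightarrow>
     (\<forall>\<beta> Z R. bag \<beta> \<longrightarrow> small w \<beta> \<longrightarrow> part w vs Z \<longrightarrow> R \<subseteq> V \<times> V \<longrightarrow> small w R \<longrightarrow>
        derivable Der \<beta> Z R \<longrightarrow> Der \<beta> Z R)"

end

text \<open>\<open>Der\<close> is left abstract so that the computed fixed point can take its place;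
  \<open>A\<close> is the solution that the derivation follows.\<close>

locale decomposed_problem = assignment_problem V adj allowed meets +
    rooted_decomposition V adj m parent B top
  for V :: "'v set" and adj and allowed :: "'v \<Rightarrow> 's set" and meets and m parent B top +
  fixes w :: nat and A :: "'v \<Rightarrow> 's" and vs :: "'v list"
    and Der :: "('v \<times> 's) set \<Rightarrow> 'v set \<Rightarrow> ('v \<times> 'v) set \<Rightarrow> bool"
  assumes width: "i < m \<Longrightarrow> card (B i) \<le> Suc w"
    and root_bag: "0 < m" "B 0 \<noteq> {}"
    and A_allowed: "v \<in> V \<Longrightarrow> A v \<in> allowed v"
    and A_connected: "V \<times> V \<subseteq> (realized A)\<^sup>*"
    and vs: "set vs = V"
    and Der_closed: "derivation_closed w vs Der"
begin

section \<open>Following a solution through the decomposition\<close>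

definition \<beta> :: "nat \<Rightarrow> ('v \<times> 's) set" where
  "\<beta> i = (\<lambda>v. (v, A v)) ` B i"

lemma Domain_\<beta> [simp]: "Domain (\<beta> i) = B i"
  by (auto simp: \<beta>_def)

lemma bag_\<beta>: "i < m \<Longrightarrow> bag (\<beta> i)"
  using B_V A_allowed by (auto simp: \<beta>_def bag_def single_valued_def)

lemma small_B: "i < m \<Longrightarrow> B i \<noteq> {} \<Longrightarrow> small w (B i)"
  using width[of i] finite_subset[OF B_V finite_V, of i] by (simp add: small_def)

lemma small_\<beta>: "i < m \<Longrightarrow> B i \<noteq> {} \<Longrightarrow> small w (\<beta> i)"
  using small_B[of i] card_image_le[of "B i" "\<lambda>v. (v, A v)"] by (auto simp: small_def \<beta>_def)

lemma bag_edges_\<beta>: "bag_edges (\<beta> i) Z = {(u, v) \<in> realized A. u \<in> B i \<and> v \<in> B i \<and> (u \<in> Z \<or> v \<in> Z)}"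
  by (auto simp: bag_edges_def \<beta>_def realized_def)

lemma
  assumes "i < m" "B i \<noteq> {}" "part w vs Z" "small w R" "R \<subseteq> B i \<times> B i"
  shows Der_empty: "Z = {} \<Longrightarrow> R \<subseteq> Id \<Longrightarrow> Der (\<beta> i) Z R"
    and Der_union: "Der (\<beta> i) Z1 R1 \<Longrightarrow> Der (\<beta> i) Z2 R2 \<Longrightarrow> Z = Z1 \<union> Z2 \<Longrightarrow> Z1 \<inter> Z2 = {} \<Longrightarrow>
      R \<subseteq> sclosure (R1 \<union> R2) \<Longrightarrow> Der (\<beta> i) Z R"
    and Der_step: "Der \<beta>' Z' R' \<Longrightarrow> step_ok (\<beta> i) Z R \<beta>' Z' R' \<Longrightarrow> Der (\<beta> i) Z R"
proof -
  have "R \<subseteq> V \<times> V" using assms(5) B_V[OF assms(1)] by blast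
  note D = Der_closed[unfolded derivation_closed_def derivable_def, rule_format,
      OF bag_\<beta>[OF assms(1)] small_\<beta>[OF assms(1,2)] assms(3) this assms(4)]
  show "Z = {} \<Longrightarrow> R \<subseteq> Id \<Longrightarrow> Der (\<beta> i) Z R"
    by (rule D) simp
  show "Der (\<beta> i) Z1 R1 \<Longrightarrow> Der (\<beta> i) Z2 R2 \<Longrightarrow> Z = Z1 \<union> Z2 \<Longrightarrow> Z1 \<inter> Z2 = {} \<Longrightarrow>
      R \<subseteq> sclosure (R1 \<union> R2) \<Longrightarrow> Der (\<beta> i) Z R"
    by (rule D, rule disjI2, rule disjI1) blast
  show "Der \<beta>' Z' R' \<Longrightarrow> step_ok (\<beta> i) Z R \<beta>' Z' R' \<Longrightarrow> Der (\<beta> i) Z R"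
    by (rule D, rule disjI2, rule disjI2) blast
qed

text \<open>Ranging over all small interfaces that \<open>A\<close> realizes, instead of one choice,
  allows each later rule to ask for the interface it needs.\<close>

definition derives_all :: "nat \<Rightarrow> 'v set \<Rightarrow> bool" where
  "derives_all i Z \<longleftrightarrow>
     (\<forall>R. small w R \<longrightarrow> R \<subseteq> B i \<times> B i \<longrightarrow> R \<subseteq> (around A Z (B i))\<^sup>* \<longrightarrow> Der (\<beta> i) Z R)"

text \<open>Both parts are closed up to the bag, so no edge joins them and a walk through their
  union alternates between the two. Its pieces in \<open>Z1\<close> are contracted first; the
  recorded pairs then act as additional edges while the pieces in \<open>Z2\<close> are
  contracted.\<close>

lemma derives_all_union:
  assumes i: "i < m" "B i \<noteq> {}" and p: "part w vs (Z1 \<union> Z2)"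
    and Z1: "derives_all i Z1" and Z2: "derives_all i Z2"
    and disj: "Z1 \<inter> Z2 = {}" "Z1 \<inter> B i = {}" "Z2 \<inter> B i = {}"
    and cl1: "\<And>u v. u \<in> Z1 \<Longrightarrow> adj u v \<Longrightarrow> v \<in> Z1 \<union> B i"
    and cl2: "\<And>u v. u \<in> Z2 \<Longrightarrow> adj u v \<Longrightarrow> v \<in> Z2 \<union> B i"
  shows "derives_all i (Z1 \<union> Z2)"
  unfolding derives_all_def
proof (intro allI impI)
  fix R assume R: "small w R" "R \<subseteq> B i \<times> B i" "R \<subseteq> (around A (Z1 \<union> Z2) (B i))\<^sup>*"
  let ?H1 = "around A Z1 (B i)" and ?H2 = "around A Z2 (B i)"
  obtain R1 where R1: "canonical R1 (B i) ?H1" "small w R1"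
    using canonical_exists[OF sym_around small_B[OF i]] by blast
  obtain R2 where R2: "canonical R2 (B i) ?H2" "small w R2"
    using canonical_exists[OF sym_around small_B[OF i]] by blast
  have D: "Der (\<beta> i) Z1 R1" "Der (\<beta> i) Z2 R2"
    using Z1 Z2 R1 R2 by (auto simp: derives_all_def canonical_def)
  have H: "around A (Z1 \<union> Z2) (B i) \<subseteq> ?H1 \<union> ?H2"
    using cl1 cl2 adj_sym by (fastforce simp: around_def realized_def)
  have "R \<subseteq> sclosure (R1 \<union> R2)"
  proof
    fix e assume "e \<in> R"
    then obtain x y where e: "e = (x, y)" "x \<in> B i" "y \<in> B i" "(x, y) \<in> (around A (Z1 \<union> Z2) (B i))\<^sup>*"
      using R by (cases e) auto
    have "(x, y) \<in> (?H1 \<union> ?H2)\<^sup>*" using e(4) H rtrancl_mono by blast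
    then have "(x, y) \<in> ((R1 \<union> R1\<inverse>) \<union> ?H2)\<^sup>*"
      using disj e(2,3) by (intro around_contract(1)[OF R1(1)]) (auto simp: around_def)
    then have "(x, y) \<in> (?H2 \<union> (R1 \<union> R1\<inverse>))\<^sup>*" by (simp add: sup_commute)
    then have "(x, y) \<in> ((R2 \<union> R2\<inverse>) \<union> (R1 \<union> R1\<inverse>))\<^sup>*"
      using disj e(2,3) R1(1) by (intro around_contract(1)[OF R2(1)]) (auto simp: canonical_def)
    moreover have "(R2 \<union> R2\<inverse>) \<union> (R1 \<union> R1\<inverse>) = (R1 \<union> R2) \<union> (R1 \<union> R2)\<inverse>" by auto
    ultimately show "e \<in> sclosure (R1 \<union> R2)" using e by (simp add: sclosure_def)
  qed
  with D disj(1) show "Der (\<beta> i) (Z1 \<union> Z2) R"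
    by (intro Der_union[OF i p R(1,2)]) simp_all
qed

text \<open>Here \<open>c\<close> is the child. An edge around \<open>C\<close> is either around
  what remains of \<open>C\<close> outside the bag of \<open>c\<close>, or it lies inside that bag
  and is counted by \<open>bag_edges\<close>.\<close>

lemma derives_all_step:
  assumes i: "i < m" "B i \<noteq> {}" and c: "c < m" "B c \<noteq> {}" and p: "part w vs C"
    and C: "C \<subseteq> V" "C \<inter> B i = {}"
    and IH: "derives_all c (C - B c)"
    and cli: "\<And>u v. u \<in> C \<Longrightarrow> adj u v \<Longrightarrow> v \<in> C \<union> B i"
    and clc: "\<And>u v. u \<in> C \<Longrightarrow> adj u v \<Longrightarrow> v \<in> C \<union> B c"
  shows "derives_all i C"
  unfolding derives_all_def
proof (intro allI impI)
  fix R assume R: "small w R" "R \<subseteq> B i \<times> B i" "R \<subseteq> (around A C (B i))\<^sup>*"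
  let ?Z = "C - B c" and ?E = "bag_edges (\<beta> c) C"
  let ?H = "around A ?Z (B c)"
  obtain R' where R': "canonical R' (B c) ?H" "small w R'"
    using canonical_exists[OF sym_around small_B[OF c]] by blast
  then have D: "Der (\<beta> c) ?Z R'"
    using IH by (auto simp: derives_all_def canonical_def)
  have H: "around A C (B i) \<subseteq> ?H \<union> ?E"
    using clc adj_sym by (fastforce simp: around_def realized_def bag_edges_\<beta>)
  have cl: "(x, y) \<in> sclosure (R' \<union> ?E)"
    if xy: "(x, y) \<in> (around A C (B i))\<^sup>*" and x: "x \<notin> ?Z" and y: "y \<notin> ?Z" for x y
  proof (cases "x = y")
    case False
    with xy obtain z where z: "(x, z) \<in> around A C (B i)" by (metis converse_rtranclE)
    \<comment> \<open>As \<open>x\<close> is not in \<open>?Z\<close>, the first edge of the walk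
      shows that it is in the bag of \<open>c\<close>.\<close>
    with H x have xc: "x \<in> B c" by (auto simp: around_def bag_edges_\<beta>)
    have "(x, y) \<in> (?H \<union> ?E)\<^sup>*" using xy H rtrancl_mono by blast
    then show ?thesis
      using y by (intro around_contract(2)[OF R'(1) _ _ _ xc]) (auto simp: bag_edges_\<beta>)
  qed simp
  have "step_ok (\<beta> i) C R (\<beta> c) ?Z R'"
    unfolding step_ok_def Domain_\<beta>
  proof (intro conjI)
    show "R \<subseteq> sclosure (R' \<union> ?E)"
    proof
      fix e assume "e \<in> R"
      then obtain x y where "e = (x, y)" "x \<in> B i" "y \<in> B i" "(x, y) \<in> (around A C (B i))\<^sup>*"
        using R by (cases e) auto
      then show "e \<in> sclosure (R' \<union> ?E)" using cl[of x y] C(2) by auto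
    qed
    show "\<forall>v\<in>C \<inter> B c. \<exists>x\<in>B i. (v, x) \<in> sclosure (R' \<union> ?E)"
    proof
      fix v assume v: "v \<in> C \<inter> B c"
      \<comment> \<open>\<open>A\<close> connects \<open>v\<close> to any vertex of the bag, and a
        walk can leave \<open>C\<close> only through the bag; so \<open>v\<close> is not cut off by
        being left behind.\<close>
      from i obtain x where x: "x \<in> B i" by blast
      with v C A_connected B_V[OF i(1)] have "(v, x) \<in> (realized A)\<^sup>*" by blast
      from around_exit[OF this, of C "B i"] v x C(2) cli
      obtain y where "y \<in> B i - C" "(v, y) \<in> (around A C (B i))\<^sup>*" by blast
      with cl[of v y] v show "\<exists>x\<in>B i. (v, x) \<in> sclosure (R' \<union> ?E)" by auto
    qed
  qed (use C cli in \<open>auto simp: \<beta>_def\<close>)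
  with D show "Der (\<beta> i) C R"
    by (rule Der_step[OF i p R(1,2)])
qed

text \<open>Children have larger numbers, so induction on \<open>m - i\<close> goes from the leaves
  to the root. A component of \<open>D\<close> outside the bag lies below a single child, from whose
  bag it is derived; the components are then merged along the vertex list.\<close>

lemma derives_all_region:
  assumes "i < m" and "B i \<noteq> {}" and "region w D" and "D \<subseteq> below i"
    and "\<And>u v. u \<in> D \<Longrightarrow> adj u v \<Longrightarrow> v \<in> D \<union> B i"
  shows "derives_all i (D - B i)"
  using assms
proof (induction "m - i" arbitrary: i D rule: less_induct)
  case less
  note i = less.prems(1,2) and D = less.prems(3,4) and D_closed = less.prems(5)
  let ?X = "B i"
  have X: "small w ?X" "?X \<subseteq> V" using small_B i B_V by auto
  have DV: "D \<subseteq> V" using D(2) by (auto simp: below_def)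
  have comp: "derives_all i (comp ?X d)" if d: "d \<in> D - ?X" for d
  proof -
    let ?C = "comp ?X d"
    have dV: "d \<in> V" and dC: "d \<in> ?C" using d DV by (auto simp: comp_def)
    from below_child[of d i] D(2) d obtain c where c: "0 < c" "c < m" "parent c = i" "d \<in> below c" by auto
    have ic: "i < c" using c parent_less by auto
    have CV: "?C \<subseteq> V" by (auto simp: comp_def)
    have Cc: "?C \<subseteq> below c"
    proof
      fix v assume "v \<in> ?C"
      then have "(d, v) \<in> sclosure (outside ?X)" by (auto simp: comp_def)
      then show "v \<in> below c"
      proof (rule sclosure_outside_invariant)
        show "v \<in> below c \<union> ?X" if "u \<in> below c" "adj u v" for u v
          using below_neighbour[OF c(1,2) that] adj_V[OF that(2)] c(3) by auto
      qed (rule c(4))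
    qed
    have CX: "?C \<inter> ?X = {}" by (auto simp: comp_def)
    \<comment> \<open>By the separator property, a neighbour of \<open>?C\<close> in the bag of
      \<open>i\<close> is also in the bag of \<open>c\<close>.\<close>
    have clc: "v \<in> ?C \<union> B c" if "u \<in> ?C" "adj u v" for u v
    proof (cases "v \<in> ?C")
      case False
      with comp_closed[OF that] have "v \<in> B (parent c)" using c(3) by auto
      with parent_bag_not_below[OF c(1,2)] have "v \<notin> below c" by auto
      with below_neighbour[OF c(1,2) _ that(2)] adj_V[OF that(2)] Cc that(1) show ?thesis by auto
    qed simp
    \<comment> \<open>An empty bag at \<open>c\<close> would leave \<open>?C\<close> without edges
      to the outside, although \<open>A\<close> connects it to the bag of \<open>i\<close>.\<close>
    have "B c \<noteq> {}"
    proof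
      assume Bc: "B c = {}"
      from i obtain x where x: "x \<in> ?X" by blast
      then have "(d, x) \<in> (realized A)\<^sup>*" using A_connected dV X(2) by blast
      from around_exit[OF this dC, of "{}"] x CX clc Bc show False by blast
    qed
    have reg: "region w ?C" using X dV by (auto simp: region_def)
    have "derives_all c (?C - B c)"
      using less.hyps[of c ?C] ic c(2) \<open>B c \<noteq> {}\<close> reg Cc clc by auto
    from derives_all_step[OF i c(2) \<open>B c \<noteq> {}\<close> _ CV CX this comp_closed clc] reg
    show ?thesis by (auto simp: part_def)
  qed
  let ?P = "\<lambda>j. comps_of ?X D (set (drop j vs))"
  have part: "part w vs (?P j)" for j
    using X D(1) unfolding part_def by blast
  have P_closed: "v \<in> ?P j \<union> ?X" if u: "u \<in> ?P j" and uv: "adj u v" for u v j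
  proof (rule ccontr)
    assume v: "v \<notin> ?P j \<union> ?X"
    have "u \<in> D" "u \<notin> ?X" using u by (auto simp: comps_of_def)
    with D_closed[OF _ uv] v have "v \<in> D" by auto
    have "(u, v) \<in> outside ?X" using uv v \<open>u \<notin> ?X\<close> by (auto simp: outside_def)
    from sclosure_base[OF this] u v \<open>v \<in> D\<close> DV show False
      by (auto simp: comps_of_def intro: sclosure_trans)
  qed
  \<comment> \<open>Going down with \<open>j\<close>, the vertex \<open>vs ! j\<close> adds its
    whole component, or nothing if that is already present or the vertex is not in \<open>D\<close>
    outside the bag.\<close>
  have "derives_all i (?P j)" if "j \<le> length vs" for j
    using that
  proof (induction "length vs - j" arbitrary: j)
    case 0
    then have P: "?P j = {}" by (auto simp: comps_of_def)
    have H: "around A {} ?X = {}" by (auto simp: around_def)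
    show ?case
      unfolding derives_all_def P H
    proof (intro allI impI)
      fix R assume R: "small w R" "R \<subseteq> ?X \<times> ?X" "R \<subseteq> {}\<^sup>*"
      then show "Der (\<beta> i) {} R"
        using part[of j] by (intro Der_empty[OF i _ R(1,2)]) (auto simp: P)
    qed
  next
    case (Suc k)
    then have j: "j < length vs" by simp
    have IH: "derives_all i (?P (Suc j))" using Suc.hyps(1)[of "Suc j"] Suc.hyps(2) j by simp
    let ?u = "vs ! j"
    have drop: "set (drop j vs) = insert ?u (set (drop (Suc j) vs))"
      using Cons_nth_drop_Suc[OF j] by (metis list.simps(15))
    show ?case
    proof (cases "?u \<in> D - ?X \<and> ?u \<notin> ?P (Suc j)")
      case True
      have CD: "comp ?X ?u \<subseteq> D"
        using True D_closed sclosure_outside_invariant[of ?u _ ?X D] by (auto simp: comp_def)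
      have eq: "?P j = ?P (Suc j) \<union> comp ?X ?u"
        using True CD by (auto simp: comps_of_def comp_def drop)
      have disj: "?P (Suc j) \<inter> comp ?X ?u = {}"
      proof -
        have "False" if "v \<in> ?P (Suc j)" "v \<in> comp ?X ?u" for v
        proof -
          from that obtain u where "u \<in> set (drop (Suc j) vs)" "u \<in> D" "u \<notin> ?X"
            "(u, v) \<in> sclosure (outside ?X)" "(?u, v) \<in> sclosure (outside ?X)"
            by (auto simp: comps_of_def comp_def)
          then have "(u, ?u) \<in> sclosure (outside ?X)" by (blast intro: sclosure_trans sclosure_sym)
          with True DV \<open>u \<in> set _\<close> \<open>u \<in> D\<close> \<open>u \<notin> ?X\<close> show False by (auto simp: comps_of_def)
        qed
        then show ?thesis by blast
      qed
      show ?thesis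
        unfolding eq
      proof (rule derives_all_union[OF i _ IH comp disj])
        show "part w vs (?P (Suc j) \<union> comp ?X ?u)" using part[of j] eq by simp
        show "?P (Suc j) \<inter> ?X = {}" by (auto simp: comps_of_def)
        show "comp ?X ?u \<inter> ?X = {}" by (auto simp: comp_def)
      qed (use True P_closed comp_closed in auto)
    next
      case False
      have "?P j = ?P (Suc j)"
      proof (cases "?u \<in> D - ?X")
        case True
        with False have "?u \<in> ?P (Suc j)" by simp
        then obtain u where u: "u \<in> set (drop (Suc j) vs)" "u \<in> D" "u \<notin> ?X"
          "(u, ?u) \<in> sclosure (outside ?X)" by (auto simp: comps_of_def)
        then have "(u, v) \<in> sclosure (outside ?X)" if "(?u, v) \<in> sclosure (outside ?X)" for v
          using that by (blast intro: sclosure_trans)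
        with u show ?thesis by (auto simp: comps_of_def drop)
      qed (auto simp: comps_of_def drop)
      with IH show ?thesis by simp
    qed
  qed
  from this[of 0] have "derives_all i (?P 0)" by simp
  moreover have "?P 0 = D - ?X" using DV vs by (auto simp: comps_of_def)
  ultimately show ?case by simp
qed

lemma derivation_complete: "\<exists>\<beta> Z R. Der \<beta> Z R \<and> final_ok \<beta> Z R"
proof -
  note i = root_bag
  let ?X = "B 0" and ?Z = "V - B 0"
  have XV: "?X \<subseteq> V" using B_V i by auto
  have all: "derives_all 0 ?Z"
    by (rule derives_all_region[OF i]) (use adj_V in \<open>auto simp: region_def below_root\<close>)
  let ?H = "around A ?Z ?X" and ?E = "bag_edges (\<beta> 0) ?X"
  obtain R where R: "canonical R ?X ?H" "small w R"
    using canonical_exists[OF sym_around small_B[OF i]] by blast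
  then have "Der (\<beta> 0) ?Z R" using all by (auto simp: derives_all_def canonical_def)
  moreover have "final_ok (\<beta> 0) ?Z R"
    unfolding final_ok_def Domain_\<beta>
  proof (intro conjI subsetI)
    fix e assume e: "e \<in> ?X \<times> ?X"
    then obtain x y where xy: "e = (x, y)" "x \<in> ?X" "y \<in> ?X" by auto
    have "realized A \<subseteq> ?H \<union> ?E"
      using adj_V by (fastforce simp: around_def bag_edges_\<beta> realized_def)
    moreover have "(x, y) \<in> (realized A)\<^sup>*" using A_connected xy XV by blast
    ultimately have "(x, y) \<in> (?H \<union> ?E)\<^sup>*" using rtrancl_mono by blast
    then show "e \<in> sclosure (R \<union> ?E)"
      using xy unfolding xy(1) by (intro around_contract(2)[OF R(1)]) (auto simp: bag_edges_\<beta>)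
  qed (use i in auto)
  ultimately show ?thesis by blast
qed

end

section \<open>Rooting a tree decomposition\<close>

lemma rtrancl_on_iff_rtrancl:
  assumes "r \<subseteq> F \<times> F"
  shows "(u, v) \<in> rtrancl_on F r \<longleftrightarrow> u \<in> F \<and> (u, v) \<in> r\<^sup>*"
proof
  assume "(u, v) \<in> rtrancl_on F r"
  then show "u \<in> F \<and> (u, v) \<in> r\<^sup>*"
    by (auto dest: in_rtrancl_on_in_F rtrancl_on_rtranclI)
next
  assume "u \<in> F \<and> (u, v) \<in> r\<^sup>*"
  then have "(u, v) \<in> r\<^sup>*" "u \<in> F" by auto
  then show "(u, v) \<in> rtrancl_on F r"
    by (induction rule: rtrancl_induct) (use assms in \<open>auto intro: rtrancl_on_into_rtrancl_on\<close>)
qed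

text \<open>\<open>connected\<close> is strong connectivity of the symmetrized graph, and
  symmetrizing leaves a symmetric arc relation as it is.\<close>

lemma connected_iff_rtrancl:
  assumes "arcs_ends H \<subseteq> verts H \<times> verts H" and "sym (arcs_ends H)"
  shows "connected H \<longleftrightarrow> verts H \<noteq> {} \<and> verts H \<times> verts H \<subseteq> (arcs_ends H)\<^sup>*"
proof -
  have "parcs (mk_symmetric H) = arcs_ends H \<union> (arcs_ends H)\<inverse>"
    by (auto simp: mk_symmetric_def arcs_ends_conv)
  also have "\<dots> = arcs_ends H" using assms(2) by (auto dest: symD)
  finally have "arcs_ends (with_proj (mk_symmetric H)) = arcs_ends H" by simp
  then show ?thesis
    using assms(1) by (auto simp: connected_def strongly_connected_def reachable_def rtrancl_on_iff_rtrancl)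
qed

lemma arcs_ends_restrict:
  "arcs_ends (with_proj T \<restriction> S) = parcs T \<inter> S \<times> S"
  by (auto simp: arcs_ends_conv)

lemma pair_graph_facts:
  assumes "pair_graph T"
  shows "parcs T \<subseteq> pverts T \<times> pverts T" and "sym (parcs T)" and "finite (pverts T)"
    and "(u, u) \<notin> parcs T"
proof -
  interpret pair_graph T by fact
  show "parcs T \<subseteq> pverts T \<times> pverts T" using in_arcsD1 in_arcsD2 by auto
  show "sym (parcs T)" using arcs_symmetric by (auto intro: symI)
  show "finite (pverts T)" by (rule pair_finite_verts)
  show "(u, u) \<notin> parcs T" using pair_no_loops by force
qed

lemma rtrancl_apath:
  assumes "pair_wf_digraph T" and "(a, b) \<in> (parcs T)\<^sup>*" and "a \<in> pverts T"
  obtains p where "set p \<subseteq> parcs T" "pcas a p b" "distinct (pawalk_verts a p)"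
    "set (pawalk_verts a p) \<subseteq> pverts T"
proof -
  interpret pair_wf_digraph T by fact
  have "parcs T \<subseteq> pverts T \<times> pverts T" using in_arcsD1 in_arcsD2 by auto
  from rtrancl_on_iff_rtrancl[OF this] have "reachable (with_proj T) a b"
    using assms(2,3) by (simp add: reachable_def)
  then obtain p where p: "apath a p b" unfolding reachable_apath by blast
  have "pcas x p b \<Longrightarrow> set p \<subseteq> parcs T \<Longrightarrow> x \<in> pverts T \<Longrightarrow> set (pawalk_verts x p) \<subseteq> pverts T" for x
    by (induction p arbitrary: x) (auto dest: in_arcsD2)
  with that p show thesis by (auto simp: apath_def awalk_def)
qed

lemma pawalk_verts_snoc: "pcas a p b \<Longrightarrow> pawalk_verts a (p @ [(b, y)]) = pawalk_verts a p @ [y]"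
  by (induction p arbitrary: a) auto

lemma pcas_snoc: "pcas a p b \<Longrightarrow> pcas a (p @ [(b, y)]) y"
  by (induction p arbitrary: a) auto

text \<open>Otherwise a simple path from \<open>a\<close> to \<open>b\<close> inside
  \<open>E\<close> misses \<open>y\<close> and closes to a cycle through \<open>y\<close>. The path
  is non-empty, so the cycle has length at least 3 and is not just an arc with its reverse.\<close>

lemma tree_neighbour_unique:
  assumes T: "undirected_tree T" and E: "E \<subseteq> pverts T" "a \<in> E" "b \<in> E" "y \<notin> E"
    and arcs: "(a, y) \<in> parcs T" "(b, y) \<in> parcs T"
    and conn: "(a, b) \<in> (parcs T \<inter> E \<times> E)\<^sup>*"
  shows "a = b"
proof (rule ccontr)
  assume "a \<noteq> b"
  have G: "pair_graph T" using T by (simp add: undirected_tree_def)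
  define T' where "T' = \<lparr> pverts = E, parcs = parcs T \<inter> E \<times> E \<rparr>"
  have "pair_wf_digraph T'" by unfold_locales (auto simp: T'_def)
  then obtain p where p: "set p \<subseteq> parcs T'" "pcas a p b" "distinct (pawalk_verts a p)"
    "set (pawalk_verts a p) \<subseteq> pverts T'"
    by (rule rtrancl_apath[of T' a b]) (use conn E in \<open>auto simp: T'_def\<close>)
  have ya: "(y, a) \<in> parcs T" using pair_graph_facts(2)[OF G] arcs(1) by (auto dest: symD)
  have "y \<in> pverts T" using pair_graph_facts(1)[OF G] ya by auto
  let ?c = "(y, a) # p @ [(b, y)]"
  have "p \<noteq> []" using p(2) \<open>a \<noteq> b\<close> by auto
  then have "3 \<le> length ?c" by (cases p) auto
  moreover have "pre_digraph.cycle (with_proj T) ?c"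
    unfolding pre_digraph.cycle_def pre_digraph.awalk_def cas_with_proj_eq awalk_verts_with_proj_eq
  proof (intro exI[of _ y] conjI)
    show "y \<in> verts (with_proj T)" using \<open>y \<in> pverts T\<close> by simp
    show "set ?c \<subseteq> arcs (with_proj T)" using p(1) ya arcs by (auto simp: T'_def)
    show "pcas y ?c y" using pcas_snoc[OF p(2)] by simp
    show "distinct (tl (pawalk_verts y ?c))"
      using p(3,4) E(4) pawalk_verts_snoc[OF p(2)] by (auto simp: T'_def)
  qed simp
  ultimately show False using T by (auto simp: undirected_tree_def)
qed

lemma rtrancl_exit:
  assumes "(x, y) \<in> r\<^sup>*" and "P x" and "\<not> P y"
  shows "\<exists>u v. (u, v) \<in> r \<and> P u \<and> \<not> P v"
  using assms by (induction rule: rtrancl_induct) auto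

text \<open>The list grows from \<open>r\<close> by nodes adjacent to it, which exist by
  connectivity while nodes are missing. Listed nodes stay connected among themselves, so by
  acyclicity a later node has only one neighbour among them.\<close>

lemma tree_order:
  assumes T: "undirected_tree T" and r: "r \<in> pverts T"
  shows "\<exists>ns. distinct ns \<and> set ns = pverts T \<and> ns \<noteq> [] \<and> hd ns = r \<and>
    (\<forall>i. 0 < i \<longrightarrow> i < length ns \<longrightarrow> (\<exists>j<i. (ns ! j, ns ! i) \<in> parcs T)) \<and>
    (\<forall>i j j'. i < length ns \<longrightarrow> j < i \<longrightarrow> j' < i \<longrightarrow> (ns ! j, ns ! i) \<in> parcs T \<longrightarrow>
      (ns ! j', ns ! i) \<in> parcs T \<longrightarrow> j = j')"
proof -
  have G: "pair_graph T" and C: "connected (with_proj T)" using T by (auto simp: undirected_tree_def)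
  note Gf = pair_graph_facts[OF G]
  have conn: "(u, v) \<in> (parcs T)\<^sup>*" if "u \<in> pverts T" "v \<in> pverts T" for u v
    using C connected_iff_rtrancl[of "with_proj T"] Gf(1,2) that by auto
  have "\<exists>ns. distinct ns \<and> set ns \<subseteq> pverts T \<and> length ns = k \<and> hd ns = r \<and>
      (\<forall>i. 0 < i \<longrightarrow> i < length ns \<longrightarrow> (\<exists>j<i. (ns ! j, ns ! i) \<in> parcs T))"
    if "0 < k" "k \<le> card (pverts T)" for k
    using that
  proof (induction k)
    case (Suc k)
    show ?case
    proof (cases "k = 0")
      case True
      then show ?thesis using r by (intro exI[of _ "[r]"]) auto
    next
      case False
      with Suc obtain ns where ns: "distinct ns" "set ns \<subseteq> pverts T" "length ns = k" "hd ns = r"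
        "\<And>i. 0 < i \<Longrightarrow> i < length ns \<Longrightarrow> \<exists>j<i. (ns ! j, ns ! i) \<in> parcs T" by auto
      have "set ns \<noteq> pverts T" using distinct_card[OF ns(1)] ns(3) Suc.prems by auto
      then obtain z where z: "z \<in> pverts T" "z \<notin> set ns" using ns(2) by blast
      have "ns \<noteq> []" using False ns(3) by auto
      then have "r \<in> set ns" using ns(4) by (metis hd_in_set)
      from rtrancl_exit[OF conn[OF r z(1)], of "\<lambda>x. x \<in> set ns"] this z(2)
      obtain u v where uv: "(u, v) \<in> parcs T" "u \<in> set ns" "v \<notin> set ns" by blast
      then obtain j where j: "j < length ns" "ns ! j = u" by (auto simp: in_set_conv_nth)
      have "\<exists>j<i. ((ns @ [v]) ! j, (ns @ [v]) ! i) \<in> parcs T" if i: "0 < i" "i < Suc k" for i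
      proof (cases "i < length ns")
        case True
        with ns(5)[OF i(1)] obtain l where "l < i" "(ns ! l, ns ! i) \<in> parcs T" by blast
        with True show ?thesis by (intro exI[of _ l]) (simp add: nth_append)
      next
        case False
        with i ns(3) have "i = length ns" by simp
        with j uv(1) show ?thesis by (intro exI[of _ j]) (simp add: nth_append)
      qed
      moreover have "v \<in> pverts T" using uv(1) Gf(1) by auto
      ultimately show ?thesis
        using ns uv(3) \<open>ns \<noteq> []\<close> by (intro exI[of _ "ns @ [v]"]) auto
    qed
  qed simp
  moreover have "0 < card (pverts T)" using r Gf(3) by (auto simp: card_gt_0_iff)
  ultimately obtain ns where ns: "distinct ns" "set ns \<subseteq> pverts T"
    "length ns = card (pverts T)" "hd ns = r"
    and par: "\<And>i. 0 < i \<Longrightarrow> i < length ns \<Longrightarrow> \<exists>j<i. (ns ! j, ns ! i) \<in> parcs T"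
    by blast
  have set: "set ns = pverts T"
    using card_subset_eq[OF Gf(3) ns(2)] distinct_card[OF ns(1)] ns(3) by simp
  then have ne: "ns \<noteq> []" using r by auto
  have unique: "j = j'" if i: "i < length ns" and j: "j < i" "j' < i"
    "(ns ! j, ns ! i) \<in> parcs T" "(ns ! j', ns ! i) \<in> parcs T" for i j j'
  proof -
    define E where "E = set (take i ns)"
    have E: "ns ! k \<in> E" if "k < i" for k
      using that i by (auto simp: E_def in_set_conv_nth intro!: exI[of _ k])
    let ?r = "(parcs T \<inter> E \<times> E)\<^sup>*"
    have sym: "sym ?r" using Gf(2) by (intro sym_rtrancl) (auto simp: sym_def)
    have root: "(ns ! k, ns ! 0) \<in> ?r" if "k < i" for k
      using that
    proof (induction k rule: less_induct)
      case (less k)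
      show ?case
      proof (cases "k = 0")
        case False
        with par[of k] less.prems i obtain l where l: "l < k" "(ns ! l, ns ! k) \<in> parcs T" by auto
        then have "(ns ! k, ns ! l) \<in> parcs T \<inter> E \<times> E"
          using Gf(2) E less.prems by (auto dest: symD)
        with less l show ?thesis by (meson converse_rtrancl_into_rtrancl less_trans)
      qed simp
    qed
    have "(ns ! j, ns ! j') \<in> ?r"
      using root[OF j(1)] root[OF j(2)] sym by (meson rtrancl_trans symD)
    moreover have "ns ! i \<notin> E"
      using i ns(1) by (auto simp: E_def in_set_conv_nth nth_eq_iff_index_eq)
    moreover have "E \<subseteq> pverts T" using ns(2) by (auto simp: E_def dest: in_set_takeD)
    ultimately have "ns ! j = ns ! j'"
      using tree_neighbour_unique[OF T _ E[OF j(1)] E[OF j(2)] _ j(3,4)] by blast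
    with ns(1) i j show ?thesis by (simp add: nth_eq_iff_index_eq)
  qed
  show ?thesis
    by (intro exI[of _ ns] conjI allI impI ns(1,4) set ne par unique)
qed

text \<open>The root can be prescribed, so that one with a non-empty bag can be chosen.\<close>

lemma tree_decomposition_rooted:
  assumes td: "tree_decomposition G T B" and G: "pair_graph G" and r: "r \<in> pverts T"
  obtains ns parent top where "rooted_decomposition (pverts G) (\<lambda>u v. (u, v) \<in> parcs G)
      (length ns) parent (\<lambda>i. B (ns ! i)) top" "set ns = pverts T" "ns \<noteq> []" "hd ns = r"
proof -
  have T: "undirected_tree T" and cover: "(\<Union>i\<in>pverts T. B i) = pverts G"
    and edge: "\<And>u v. (u, v) \<in> parcs G \<Longrightarrow> \<exists>i\<in>pverts T. u \<in> B i \<and> v \<in> B i"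
    and conn: "\<And>v. v \<in> pverts G \<Longrightarrow> connected (with_proj T \<restriction> {i \<in> pverts T. v \<in> B i})"
    using td by (auto simp: tree_decomposition_def)
  from T have "pair_graph T" by (simp add: undirected_tree_def)
  note Tf = pair_graph_facts[OF this]
  obtain ns where ns: "distinct ns" "set ns = pverts T" "ns \<noteq> []" "hd ns = r"
    and par: "\<And>i. 0 < i \<Longrightarrow> i < length ns \<Longrightarrow> \<exists>j<i. (ns ! j, ns ! i) \<in> parcs T"
    and unique: "\<And>i j j'. i < length ns \<Longrightarrow> j < i \<Longrightarrow> j' < i \<Longrightarrow> (ns ! j, ns ! i) \<in> parcs T \<Longrightarrow>
      (ns ! j', ns ! i) \<in> parcs T \<Longrightarrow> j = j'"
    using tree_order[OF T r] by (elim exE conjE) blast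
  let ?m = "length ns"
  define parent where "parent i = (SOME j. j < i \<and> (ns ! j, ns ! i) \<in> parcs T)" for i
  have parent: "parent i < i \<and> (ns ! parent i, ns ! i) \<in> parcs T" if "0 < i" "i < ?m" for i
    unfolding parent_def by (rule someI_ex) (use par[OF that] in blast)
  define top where "top v = (LEAST i. i < ?m \<and> v \<in> B (ns ! i))" for v
  have ex: "\<exists>i<?m. v \<in> B (ns ! i)" if "v \<in> pverts G" for v
    using that unfolding cover[symmetric] ns(2)[symmetric] by (auto simp: in_set_conv_nth)
  have top: "top v < ?m \<and> v \<in> B (ns ! top v)" if "v \<in> pverts G" for v
    unfolding top_def by (rule LeastI_ex) (use ex[OF that] in blast)
  have top_le: "top v \<le> i" if "i < ?m" "v \<in> B (ns ! i)" for v i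
    unfolding top_def by (rule Least_le) (use that in blast)
  define R where "R = {(i, parent i) | i. 0 < i \<and> i < ?m}"
  have R_le: "j \<le> i" if "(i, j) \<in> R\<^sup>*" for i j
    using that by (induction rule: rtrancl_induct) (auto simp: R_def dest: parent)
  have "rooted_decomposition (pverts G) (\<lambda>u v. (u, v) \<in> parcs G) ?m parent (\<lambda>i. B (ns ! i)) top"
  proof
    show "parent i < i" if "0 < i" "i < ?m" for i using parent[OF that] by simp
    show "B (ns ! i) \<subseteq> pverts G" if "i < ?m" for i
      using that ns(2) cover by (metis UN_upper nth_mem)
    show "\<exists>i<?m. u \<in> B (ns ! i) \<and> v \<in> B (ns ! i)" if "(u, v) \<in> parcs G" for u v
      using edge[OF that] unfolding ns(2)[symmetric] by (auto simp: in_set_conv_nth)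
    show "top v < ?m \<and> v \<in> B (ns ! top v)" if "v \<in> pverts G" for v by (rule top[OF that])
    show "0 < i \<and> v \<in> B (ns ! parent i)" if i: "i < ?m" "v \<in> B (ns ! i)" "i \<noteq> top v" for i v
    proof -
      have v: "v \<in> pverts G" using i cover ns(2) by (metis UN_I nth_mem)
      have less: "top v < i" using top_le[OF i(1,2)] i(3) by simp
      let ?S = "{x \<in> pverts T. v \<in> B x}"
      have "sym (parcs T \<inter> ?S \<times> ?S)" using Tf(2) by (auto simp: sym_def)
      with conn[OF v] have "?S \<times> ?S \<subseteq> (parcs T \<inter> ?S \<times> ?S)\<^sup>*"
        using connected_iff_rtrancl[of "with_proj T \<restriction> ?S"] by (simp add: arcs_ends_restrict)
      moreover have "ns ! i \<in> ?S" "ns ! top v \<in> ?S" using i top[OF v] ns(2) by (auto simp flip: ns(2))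
      ultimately have path: "(ns ! i, ns ! top v) \<in> (parcs T \<inter> ?S \<times> ?S)\<^sup>*" by blast
      \<comment> \<open>\<open>?P\<close> describes the subtree of node \<open>i\<close>. The path
        to \<open>top v\<close> runs through nodes whose bags contain \<open>v\<close> and has to
        leave this subtree; the only arc that does so leads from \<open>i\<close> to
        \<open>parent i\<close>, so \<open>v\<close> is in the bag of the parent.\<close>
      let ?P = "\<lambda>x. \<exists>a<?m. x = ns ! a \<and> (a, i) \<in> R\<^sup>*"
      have "\<not> ?P (ns ! top v)"
      proof
        assume "?P (ns ! top v)"
        then obtain a where "a < ?m" "ns ! top v = ns ! a" "(a, i) \<in> R\<^sup>*" by blast
        then show False using less R_le[of a i] ns(1) top[OF v] by (simp add: nth_eq_iff_index_eq)
      qed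
      moreover have "?P (ns ! i)" using i(1) by blast
      ultimately obtain x y where xy: "(x, y) \<in> parcs T \<inter> ?S \<times> ?S" "?P x" "\<not> ?P y"
        using rtrancl_exit[OF path, of ?P] by blast
      then obtain a where a: "a < ?m" "x = ns ! a" "(a, i) \<in> R\<^sup>*" by blast
      have "y \<in> set ns" using xy(1) ns(2) by auto
      then obtain b where b: "b < ?m" "y = ns ! b" by (auto simp: in_set_conv_nth)
      have nb: "(b, i) \<notin> R\<^sup>*" using xy(3) b by blast
      have arc: "(ns ! a, ns ! b) \<in> parcs T" "(ns ! b, ns ! a) \<in> parcs T"
        using xy(1) a b Tf(2) by (auto dest: symD)
      have "a \<noteq> b" using arc Tf(4) by auto
      \<comment> \<open>If \<open>b\<close> came later, \<open>a\<close> would be its parent and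
        \<open>b\<close> would still be in the subtree.\<close>
      moreover have "\<not> a < b"
      proof
        assume "a < b"
        with parent[of b] unique[of b a "parent b"] arc b have "parent b = a" by auto
        with \<open>a < b\<close> b have "(b, a) \<in> R" by (auto simp: R_def)
        with a(3) nb show False by (meson converse_rtrancl_into_rtrancl)
      qed
      ultimately have "b < a" by simp
      with parent[of a] unique[of a b "parent a"] arc a have pa: "parent a = b" by auto
      have "a = i"
      proof (rule ccontr)
        assume "a \<noteq> i"
        with a(3) obtain z where "(a, z) \<in> R" "(z, i) \<in> R\<^sup>*" by (metis converse_rtranclE)
        with pa nb show False by (auto simp: R_def)
      qed
      with pa b xy(1) less show ?thesis by auto
    qed
  qed
  from that[OF this ns(2,3,4)] show thesis .
qed

text \<open>A single bag with all vertices shows that the \<open>LEAST\<close> in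
  \<open>treewidth\<close> is taken over a non-empty set.\<close>

lemma treewidth_decomposition:
  assumes G: "pair_graph G"
  obtains T :: "nat pair_pre_digraph" and B where "tree_decomposition G T B" "td_width T B = treewidth G"
proof -
  define T where "T = \<lparr> pverts = {0 :: nat}, parcs = {} \<rparr>"
  have "pair_graph T" by unfold_locales (auto simp: T_def symmetric_def sym_def)
  have conn: "connected (with_proj T \<restriction> {i \<in> pverts T. True})" "connected (with_proj T)"
    by (subst connected_iff_rtrancl; auto simp: arcs_ends_restrict T_def sym_def)+
  have "\<not> pre_digraph.cycle (with_proj T) p" for p
    by (cases p) (auto simp: pre_digraph.cycle_def pre_digraph.awalk_def T_def)
  then have "undirected_tree T"
    using \<open>pair_graph T\<close> conn(2) by (auto simp: undirected_tree_def)
  then have "tree_decomposition G T (\<lambda>_. pverts G)"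
    using conn(1) pair_graph_facts(1)[OF G] by (auto simp: tree_decomposition_def T_def)
  then have "\<exists>w (T :: nat pair_pre_digraph) B. tree_decomposition G T B \<and> td_width T B = w" by blast
  from LeastI_ex[OF this] that show thesis unfolding treewidth_def by blast
qed

lemma treewidth_rooted_decomposition:
  assumes G: "pair_graph G" and w: "treewidth G \<le> w" and ne: "pverts G \<noteq> {}"
  obtains m parent B top where
    "rooted_decomposition (pverts G) (\<lambda>u v. (u, v) \<in> parcs G) m parent B top"
    "\<And>i. i < m \<Longrightarrow> card (B i) \<le> Suc w" "0 < m" "B 0 \<noteq> {}"
proof -
  obtain T :: "nat pair_pre_digraph" and B where td: "tree_decomposition G T B" "td_width T B \<le> w"
    using treewidth_decomposition[OF G] w by metis
  have cover: "(\<Union>i\<in>pverts T. B i) = pverts G" and "pair_graph T"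
    using td(1) by (auto simp: tree_decomposition_def undirected_tree_def)
  from cover ne obtain r where r: "r \<in> pverts T" "B r \<noteq> {}" by blast
  obtain ns parent top where R: "rooted_decomposition (pverts G) (\<lambda>u v. (u, v) \<in> parcs G)
      (length ns) parent (\<lambda>i. B (ns ! i)) top" and ns: "set ns = pverts T" "ns \<noteq> []" "hd ns = r"
    by (rule tree_decomposition_rooted[OF td(1) G r(1)])
  have "finite (pverts T)" using pair_graph_facts(3)[OF \<open>pair_graph T\<close>] .
  then have "card (B i) \<le> Max ((\<lambda>i. card (B i)) ` pverts T)" if "i \<in> pverts T" for i
    using that by (intro Max_ge) auto
  with td(2) have "card (B i) \<le> Suc w" if "i \<in> pverts T" for i
    using that unfolding td_width_def by fastforce
  then have "card (B (ns ! i)) \<le> Suc w" if "i < length ns" for i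
    using that ns(1) nth_mem by blast
  moreover have "B (ns ! 0) \<noteq> {}" using ns r by (simp add: hd_conv_nth[symmetric])
  ultimately show thesis using that[OF R] ns(2) by simp
qed

section \<open>Preprocessing in exponential time\<close>

text \<open>These functions are written by hand because the calculus does not apply: the list of
  channel sets is exponentially long, and the size of the budgets is not bounded in terms of
  \<open>n\<close> and \<open>k\<close>. The numbers in \<open>Call\<close> are the positions in
  \<open>program_of\<close>.\<close>

definition pow_body :: exp where
  "pow_body = If (Var 0) (Call 3 [Call 2 [Tl (Var 0)]]) (Cons Nul Nul)"

definition dup_body :: exp where
  "dup_body = If (Var 0)
     (Cons (Cons true_exp (Hd (Var 0))) (Cons (Cons Nul (Hd (Var 0))) (Call 3 [Tl (Var 0)]))) Nul"

definition trunc_body :: exp where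
  "trunc_body = If (Var 0)
     (If (Var 1) (Call 4 [Tl (Var 0), Tl (Var 1), Cons (Hd (Var 1)) (Var 2)]) (Var 2))
     (If (Var 1) (Cons true_exp (Var 2)) (Var 2))"

definition zip_body :: exp where
  "zip_body = If (Var 1)
     (Cons (Cons (Hd (Var 1)) (Cons (Hd (Var 2)) (Call 4 [Var 0, Hd (Var 3), Nul])))
       (Call 5 [Var 0, Tl (Var 1), Tl (Var 2), Tl (Var 3)])) Nul"

text \<open>The first row of the spectrum matrix serves as a counter with \<open>k\<close> elements,
  for listing the channel sets and for truncating the budgets. Without users it is
  \<open>Nl\<close>, the value of \<open>Hd\<close> on \<open>Nl\<close>.\<close>

definition main_body :: exp where
  "main_body = Call 1
     [Call 5 [Hd (Hd (Var 0)), Hd (Var 0), Hd (Tl (Var 0)), Hd (Tl (Tl (Var 0)))], Call 2 [Hd (Hd (Var 0))]]"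

definition program_of :: "exp \<Rightarrow> exp list \<Rightarrow> program" where
  "program_of e fs = [main_body, e, pow_body, dup_body, trunc_body, zip_body] @ fs"

fun ddup :: "data \<Rightarrow> data" where
  "ddup Nl = Nl"
| "ddup (Cns x d) = Cns (Cns (Cns Nl Nl) x) (Cns (Cns Nl x) (ddup d))"

fun dpow :: "data \<Rightarrow> data" where
  "dpow Nl = Cns Nl Nl"
| "dpow (Cns x d) = ddup (dpow d)"

text \<open>Truncation of a binary number to as many bits as the first argument has elements; the result
  is reversed, and a further leading 1 replaces the bits cut off. This keeps comparisons with
  numbers up to that length intact.\<close>

fun dtrunc :: "data \<Rightarrow> data \<Rightarrow> data \<Rightarrow> data" where
  "dtrunc (Cns x l) (Cns b d) a = dtrunc l d (Cns b a)"
| "dtrunc (Cns x l) Nl a = a"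
| "dtrunc Nl (Cns b d) a = Cns (Cns Nl Nl) a"
| "dtrunc Nl Nl a = a"

fun dzip :: "data \<Rightarrow> data \<Rightarrow> data \<Rightarrow> data \<Rightarrow> data" where
  "dzip r Nl a b = Nl"
| "dzip r (Cns x s) a b =
     Cns (Cns x (Cns (hd_data a) (dtrunc r (hd_data b) Nl))) (dzip r s (tl_data a) (tl_data b))"

context
  fixes P :: program and e :: exp and fs :: "exp list"
  assumes P: "P = program_of e fs"
begin

lemma program_nth [simp]: "P ! 0 = main_body" "P ! Suc 0 = e" "P ! 2 = pow_body" "P ! 3 = dup_body"
    "P ! 4 = trunc_body" "P ! 5 = zip_body"
  and program_length [simp]: "0 < length P" "Suc 0 < length P" "2 < length P" "3 < length P"
    "4 < length P" "5 < length P"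
  by (simp_all add: P program_of_def numeral_eq_Suc)

lemma evalb_dup: "evalb P [d] dup_body (ddup d) (40 * length (dl d) + 10)"
proof (induction d)
  case Nl
  show ?case unfolding dup_body_def ddup.simps
    by (rule evalb_mono, rule evalb_If[OF evalb_Var0 _ evalb_Nul]) auto
next
  case (Cns x d)
  have c: "evalb P [Cns x d] (Call 3 [Tl (Var 0)]) (ddup d) (1 + 1 + 0 + (40 * length (dl d) + 10) + 1)"
    by (rule evalb_Call[OF evalsb_Cons[OF evalb_Tl[OF evalb_Var0] evalsb_Nil]]) (use Cns in auto)
  have h: "evalb P [Cns x d] (Hd (Var 0)) x (1 + 1)"
    using evalb_Hd[OF evalb_Var0, of P "Cns x d" "[]"] by simp
  note r = evalb_Cons[OF evalb_Cons[OF evalb_true h] evalb_Cons[OF evalb_Cons[OF evalb_Nul h] c]]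
  show ?case unfolding dup_body_def ddup.simps
    by (rule evalb_mono, rule evalb_If[OF evalb_Var0 r]) auto
qed

lemma length_ddup: "length (dl (ddup d)) = 2 * length (dl d)"
  by (induction d) auto

lemma length_dpow: "length (dl (dpow d)) = 2 ^ length (dl d)"
  by (induction d) (auto simp: length_ddup)

lemma evalb_pow: "evalb P [d] pow_body (dpow d) (100 * 2 ^ length (dl d))"
proof (induction d)
  case Nl
  show ?case unfolding pow_body_def dpow.simps
    by (rule evalb_mono, rule evalb_If[OF evalb_Var0 _ evalb_Cons[OF evalb_Nul evalb_Nul]]) auto
next
  case (Cns x d)
  let ?n = "2 ^ length (dl d) :: nat"
  have c: "evalb P [Cns x d] (Call 2 [Tl (Var 0)]) (dpow d) (1 + 1 + 0 + 100 * ?n + 1)"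
    by (rule evalb_Call[OF evalsb_Cons[OF evalb_Tl[OF evalb_Var0] evalsb_Nil]]) (use Cns in auto)
  have c2: "evalb P [Cns x d] (Call 3 [Call 2 [Tl (Var 0)]]) (ddup (dpow d))
      (1 + 1 + 0 + 100 * ?n + 1 + 0 + (40 * ?n + 10) + 1)"
    by (rule evalb_Call[OF evalsb_Cons[OF c evalsb_Nil]])
      (use evalb_dup[of "dpow d"] in \<open>auto simp: length_dpow\<close>)
  \<comment> \<open>Doubling a list of \<open>?n\<close> elements costs about
    \<open>40 * ?n\<close>; the increase from \<open>100 * ?n\<close> to \<open>200 * ?n\<close>
    covers this and the constants.\<close>
  have "1 \<le> ?n" by (rule one_le_power) simp
  moreover have "100 * 2 ^ length (dl (Cns x d)) = 200 * ?n" by simp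
  ultimately have "1 + (1 + 1 + 0 + 100 * ?n + 1 + 0 + (40 * ?n + 10) + 1) + 1 \<le> 100 * 2 ^ length (dl (Cns x d))"
    by linarith
  then show ?case unfolding pow_body_def dpow.simps
    by (rule evalb_mono[rotated], intro evalb_If[OF evalb_Var0 c2]) auto
qed

text \<open>Digits beyond the counter are never visited, so the time depends on the counter alone;
  this removes the length of the budgets from the time bound.\<close>

lemma evalb_trunc: "evalb P [l, d, a] trunc_body (dtrunc l d a) (20 * length (dl l) + 20)"
proof (induction l d a rule: dtrunc.induct)
  case (1 x l b d a)
  let ?env = "[Cns x l, Cns b d, a]"
  have args: "evalsb P ?env [Tl (Var 0), Tl (Var 1), Cons (Hd (Var 1)) (Var 2)] [l, d, Cns b a]
      ((1 + 1) + ((1 + 1) + (((1 + 1) + 1 + 1) + 0)))"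
    using evalsb_Cons[OF evalb_Tl[OF evalb_Var0] evalsb_Cons[OF evalb_Tl[OF evalb_Var1]
      evalsb_Cons[OF evalb_Cons[OF evalb_Hd[OF evalb_Var1] evalb_Var2] evalsb_Nil]], of P "Cns x l" "Cns b d" a "[]"]
    by simp
  have c: "evalb P ?env (Call 4 [Tl (Var 0), Tl (Var 1), Cons (Hd (Var 1)) (Var 2)]) (dtrunc l d (Cns b a))
      ((1 + 1) + ((1 + 1) + (((1 + 1) + 1 + 1) + 0)) + (20 * length (dl l) + 20) + 1)"
    by (rule evalb_Call[OF args]) (use 1 in auto)
  show ?case unfolding trunc_body_def dtrunc.simps
    by (rule evalb_mono, rule evalb_If[OF evalb_Var0], rule evalb_If[OF evalb_Var1 c]) auto
next
  case (2 x l a)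
  show ?case unfolding trunc_body_def dtrunc.simps
    by (rule evalb_mono, rule evalb_If[OF evalb_Var0], rule evalb_If[OF evalb_Var1 _ evalb_Var2]) auto
next
  case (3 b d a)
  show ?case unfolding trunc_body_def dtrunc.simps
    by (rule evalb_mono, rule evalb_If[OF evalb_Var0 _ evalb_If[OF evalb_Var1 evalb_Cons[OF evalb_true evalb_Var2]]]) auto
next
  case (4 a)
  show ?case unfolding trunc_body_def dtrunc.simps
    by (rule evalb_mono, rule evalb_If[OF evalb_Var0 _ evalb_If[OF evalb_Var1 _ evalb_Var2]]) auto
qed

lemma evalb_zip: "evalb P [r, s, a, b] zip_body (dzip r s a b) ((length (dl s) + 1) * (20 * length (dl r) + 60))"
proof (induction r s a b rule: dzip.induct)
  case (1 r a b)
  show ?case unfolding zip_body_def dzip.simps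
    by (rule evalb_mono, rule evalb_If[OF evalb_Var1 _ evalb_Nul]) auto
next
  case (2 r x s a b)
  let ?env = "[r, Cns x s, a, b]" and ?K = "20 * length (dl r) + 60"
  have h: "evalb P ?env (Hd (Var 1)) x (1 + 1)"
    using evalb_Hd[OF evalb_Var1, of P r "Cns x s" "[a, b]"] by simp
  have t: "evalb P ?env (Tl (Var 1)) s (1 + 1)"
    using evalb_Tl[OF evalb_Var1, of P r "Cns x s" "[a, b]"] by simp
  have c: "evalb P ?env (Call 4 [Var 0, Hd (Var 3), Nul]) (dtrunc r (hd_data b) Nl)
      (1 + ((1 + 1) + (1 + 0)) + (20 * length (dl r) + 20) + 1)"
    by (rule evalb_Call[OF evalsb_Cons[OF evalb_Var0 evalsb_Cons[OF evalb_Hd[OF evalb_Var3]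
        evalsb_Cons[OF evalb_Nul evalsb_Nil]]]]) (use evalb_trunc in auto)
  have c2: "evalb P ?env (Call 5 [Var 0, Tl (Var 1), Tl (Var 2), Tl (Var 3)]) (dzip r s (tl_data a) (tl_data b))
      (1 + ((1 + 1) + ((1 + 1) + ((1 + 1) + 0))) + (length (dl s) + 1) * ?K + 1)"
    by (rule evalb_Call[OF evalsb_Cons[OF evalb_Var0 evalsb_Cons[OF t evalsb_Cons[OF evalb_Tl[OF evalb_Var2]
        evalsb_Cons[OF evalb_Tl[OF evalb_Var3] evalsb_Nil]]]]]) (use 2 in auto)
  note r = evalb_Cons[OF evalb_Cons[OF h evalb_Cons[OF evalb_Hd[OF evalb_Var2] c]] c2]
  show ?case unfolding zip_body_def dzip.simps
    by (rule evalb_mono, rule evalb_If[OF evalb_Var1 r]) (auto simp: algebra_simps)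
qed

lemma evalb_main:
  fixes s a b :: data
  defines "r \<equiv> hd_data s"
  assumes "evalb P [dzip r s a b, dpow r] e v T"
  shows "evalb P [enc_list [s, a, b]] main_body v
    ((length (dl s) + 1) * (20 * length (dl r) + 60) + 100 * 2 ^ length (dl r) + T + 30)"
proof -
  let ?env = "[enc_list [s, a, b]]"
  have v0: "evalb P ?env (Var 0) (Cns s (Cns a (Cns b Nl))) 1"
    using evalb_Var0[of P "enc_list [s, a, b]" "[]"] by simp
  have s: "evalb P ?env (Hd (Var 0)) s (1 + 1)" using evalb_Hd[OF v0] by simp
  have r: "evalb P ?env (Hd (Hd (Var 0))) r (1 + 1 + 1)" using evalb_Hd[OF s] by (simp add: r_def)
  have a: "evalb P ?env (Hd (Tl (Var 0))) a (1 + 1 + 1)" using evalb_Hd[OF evalb_Tl[OF v0]] by simp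
  have b: "evalb P ?env (Hd (Tl (Tl (Var 0)))) b (1 + 1 + 1 + 1)"
    using evalb_Hd[OF evalb_Tl[OF evalb_Tl[OF v0]]] by simp
  have z: "evalb P ?env (Call 5 [Hd (Hd (Var 0)), Hd (Var 0), Hd (Tl (Var 0)), Hd (Tl (Tl (Var 0)))]) (dzip r s a b)
      ((1 + 1 + 1) + ((1 + 1) + ((1 + 1 + 1) + ((1 + 1 + 1 + 1) + 0))) + (length (dl s) + 1) * (20 * length (dl r) + 60) + 1)"
    by (rule evalb_Call[OF evalsb_Cons[OF r evalsb_Cons[OF s evalsb_Cons[OF a evalsb_Cons[OF b evalsb_Nil]]]]])
      (use evalb_zip in auto)
  have p: "evalb P ?env (Call 2 [Hd (Hd (Var 0))]) (dpow r) ((1 + 1 + 1) + 0 + 100 * 2 ^ length (dl r) + 1)"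
    by (rule evalb_Call[OF evalsb_Cons[OF r evalsb_Nil]]) (use evalb_pow in auto)
  show ?thesis unfolding main_body_def
    by (rule evalb_mono, rule evalb_Call[OF evalsb_Cons[OF z evalsb_Cons[OF p evalsb_Nil]], of _ _ T])
      (use assms(2) in auto)
qed

end

section \<open>The derivation system in polynomial time\<close>

text \<open>With named arguments in place of the environment, each composite function yields a
  closure rule of its own through \<open>ptime1D\<close> and its relatives.\<close>

definition ptime1 :: "(data \<Rightarrow> data) \<Rightarrow> bool" where
  "ptime1 F \<longleftrightarrow> ptime (Suc 0) (\<lambda>e. F (hd e))"

definition ptime2 :: "(data \<Rightarrow> data \<Rightarrow> data) \<Rightarrow> bool" where
  "ptime2 F \<longleftrightarrow> ptime (Suc (Suc 0)) (\<lambda>e. F (hd e) (hd (tl e)))"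

definition ptime3 :: "(data \<Rightarrow> data \<Rightarrow> data \<Rightarrow> data) \<Rightarrow> bool" where
  "ptime3 F \<longleftrightarrow> ptime (Suc (Suc (Suc 0))) (\<lambda>e. F (hd e) (hd (tl e)) (hd (tl (tl e))))"

definition ptime4 :: "(data \<Rightarrow> data \<Rightarrow> data \<Rightarrow> data \<Rightarrow> data) \<Rightarrow> bool" where
  "ptime4 F \<longleftrightarrow> ptime (Suc (Suc (Suc (Suc 0))))
     (\<lambda>e. F (hd e) (hd (tl e)) (hd (tl (tl e))) (hd (tl (tl (tl e)))))"

lemmas ptime_defs = ptime1_def ptime2_def ptime3_def ptime4_def

lemma ptime1D: "ptime1 F \<Longrightarrow> ptime n f \<Longrightarrow> ptime n (\<lambda>e. F (f e))"
  unfolding ptime_defs by (drule ptime_comp[of _ _ "[f]" n]) simp_all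

lemma ptime2D: "ptime2 F \<Longrightarrow> ptime n f \<Longrightarrow> ptime n g \<Longrightarrow> ptime n (\<lambda>e. F (f e) (g e))"
  unfolding ptime_defs by (drule ptime_comp[of _ _ "[f, g]" n]) simp_all

lemma ptime3D: "ptime3 F \<Longrightarrow> ptime n f \<Longrightarrow> ptime n g \<Longrightarrow> ptime n h \<Longrightarrow> ptime n (\<lambda>e. F (f e) (g e) (h e))"
  unfolding ptime_defs by (drule ptime_comp[of _ _ "[f, g, h]" n]) simp_all

lemma ptime4D: "ptime4 F \<Longrightarrow> ptime n f \<Longrightarrow> ptime n g \<Longrightarrow> ptime n h \<Longrightarrow> ptime n k
    \<Longrightarrow> ptime n (\<lambda>e. F (f e) (g e) (h e) (k e))"
  unfolding ptime_defs by (drule ptime_comp[of _ _ "[f, g, h, k]" n]) simp_all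

abbreviation mem :: "data \<Rightarrow> data \<Rightarrow> bool" (infix "\<in>\<^sub>d" 50) where
  "x \<in>\<^sub>d d \<equiv> x \<in> set (dl d)"

abbreviation notmem :: "data \<Rightarrow> data \<Rightarrow> bool" (infix "\<notin>\<^sub>d" 50) where
  "x \<notin>\<^sub>d d \<equiv> x \<notin> set (dl d)"

section \<open>The rules and their universe as list computations\<close>

definition dprod :: "data \<Rightarrow> data \<Rightarrow> data" where
  "dprod c d = dconcat (dmap (\<lambda>x. dmap (\<lambda>y. Cns x y) d) c)"

lemma ptime_dprod [THEN ptime2D]: "ptime2 dprod"
  unfolding ptime_defs dprod_def by (intro ptime_intros)

fun dtuples :: "nat \<Rightarrow> data \<Rightarrow> data" where
  "dtuples 0 d = Cns Nl Nl"
| "dtuples (Suc m) d = dprod d (dtuples m d)"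

text \<open>The arity \<open>m\<close> is fixed outside the programs, and every increase raises the
  degree of the polynomial; this is how the final exponents come to depend on
  \<open>w\<close>.\<close>

lemma ptime_dtuples: "ptime n f \<Longrightarrow> ptime n (\<lambda>e. dtuples m (f e))"
  by (induction m) (auto intro: ptime_intros ptime_dprod)

text \<open>Position \<open>i\<close> of a list, counted from the end, is addressed by any list of length \<open>i\<close>.\<close>

definition dbit :: "data \<Rightarrow> data \<Rightarrow> bool" where
  "dbit d m \<longleftrightarrow> (\<exists>s\<in>set (dl (dsuffixes d)). dlength s = dlength m \<and> hd_data s \<noteq> Nl)"

lemma ptime_dbit [THEN ptime2D]: "ptime2 (\<lambda>x y. enc_bool (dbit x y))"
  unfolding ptime_defs dbit_def by (intro ptime_intros)

text \<open>A vertex is a suffix of the list of records, so its length is already the address of its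
  entry in the adjacency row of another vertex.\<close>

definition dadj :: "data \<Rightarrow> data \<Rightarrow> bool" where
  "dadj u v \<longleftrightarrow> dbit (hd_data (tl_data (hd_data u))) v"

lemma ptime_dadj [THEN ptime2D]: "ptime2 (\<lambda>x y. enc_bool (dadj x y))"
  unfolding ptime_defs dadj_def by (intro ptime_intros ptime_dbit)

text \<open>A suffix of \<open>c\<close> shows a bit at its head, and by its length it addresses the
  same position in \<open>d\<close>.\<close>

definition dmeets :: "data \<Rightarrow> data \<Rightarrow> bool" where
  "dmeets c d \<longleftrightarrow> (\<exists>s\<in>set (dl (dsuffixes c)). hd_data s \<noteq> Nl \<and> dbit d s)"

lemma ptime_dmeets [THEN ptime2D]: "ptime2 (\<lambda>x y. enc_bool (dmeets x y))"
  unfolding ptime_defs dmeets_def by (intro ptime_intros ptime_dbit)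

definition dallowed :: "data \<Rightarrow> data \<Rightarrow> bool" where
  "dallowed v d \<longleftrightarrow>
     (\<forall>s\<in>set (dl (dsuffixes d)). hd_data s \<noteq> Nl \<longrightarrow> dbit (hd_data (hd_data v)) s) \<and>
     dle_bits (dfilter (\<lambda>x. x \<noteq> Nl) d) (tl_data (tl_data (hd_data v)))"

lemma ptime_dallowed [THEN ptime2D]: "ptime2 (\<lambda>x y. enc_bool (dallowed x y))"
  unfolding ptime_defs dallowed_def by (intro ptime_intros ptime_dbit)

text \<open>Vertices are the non-empty suffixes of the list of user records. This keeps users with equal
  records apart, and the record of a vertex is its head: spectrum map, adjacency row, budget.\<close>

definition dverts :: "data \<Rightarrow> data" where
  "dverts r = dfilter (\<lambda>s. s \<noteq> Nl) (dsuffixes r)"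

lemma ptime_dverts [THEN ptime1D]: "ptime1 dverts"
  unfolding ptime_defs dverts_def by (intro ptime_intros)

definition dclosure :: "data \<Rightarrow> data \<Rightarrow> data" where
  "dclosure V r = dlfp (\<lambda>k p. hd_data p = tl_data p \<or>
     (\<exists>q\<in>set (dl k). hd_data q = hd_data p \<and>
        (Cns (tl_data q) (tl_data p) \<in>\<^sub>d r \<or> Cns (tl_data p) (tl_data q) \<in>\<^sub>d r))) (dprod V V)"

lemma ptime_dclosure [THEN ptime2D]: "ptime2 dclosure"
  unfolding ptime_defs dclosure_def by (intro ptime_dlfp ptime_intros ptime_dprod)

definition dedges :: "data \<Rightarrow> data \<Rightarrow> data \<Rightarrow> data \<Rightarrow> data" where
  "dedges V r b z = dfilter (\<lambda>p. p \<in>\<^sub>d r \<or>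
     (\<exists>s\<in>set (dl b). \<exists>t\<in>set (dl b). hd_data s = hd_data p \<and> hd_data t = tl_data p \<and>
        dadj (hd_data p) (tl_data p) \<and> dmeets (tl_data s) (tl_data t) \<and>
        (hd_data p \<in>\<^sub>d z \<or> tl_data p \<in>\<^sub>d z))) (dprod V V)"

lemma ptime_dedges [THEN ptime4D]: "ptime4 dedges"
  unfolding ptime_defs dedges_def by (intro ptime_intros ptime_dprod ptime_dadj ptime_dmeets)

definition ddom :: "data \<Rightarrow> data" where
  "ddom b = dmap hd_data b"

lemma ptime_ddom [THEN ptime1D]: "ptime1 ddom"
  unfolding ptime_defs ddom_def by (intro ptime_intros)

definition item_bag :: "data \<Rightarrow> data" where "item_bag x = hd_data x"
definition item_part :: "data \<Rightarrow> data" where "item_part x = hd_data (tl_data x)"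
definition item_rel :: "data \<Rightarrow> data" where "item_rel x = tl_data (tl_data x)"

lemma ptime_items:
  assumes "ptime n f"
  shows "ptime n (\<lambda>e. item_bag (f e))" and "ptime n (\<lambda>e. item_part (f e))" and "ptime n (\<lambda>e. item_rel (f e))"
  unfolding item_bag_def item_part_def item_rel_def by (intro ptime_intros assms)+

definition dempty_rule :: "data \<Rightarrow> bool" where
  "dempty_rule x \<longleftrightarrow> item_part x = Nl \<and> (\<forall>p\<in>set (dl (item_rel x)). hd_data p = tl_data p)"

lemma ptime_dempty_rule [THEN ptime1D]: "ptime1 (\<lambda>x. enc_bool (dempty_rule x))"
  unfolding ptime_defs dempty_rule_def by (intro ptime_intros ptime_items)

text \<open>Sets are stored as lists with arbitrary order and repetitions, so equality of trees
  would be too fine for bags and parts.\<close>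

definition dsame :: "data \<Rightarrow> data \<Rightarrow> bool" where
  "dsame c d \<longleftrightarrow> (\<forall>x\<in>set (dl c). x \<in>\<^sub>d d) \<and> (\<forall>x\<in>set (dl d). x \<in>\<^sub>d c)"

lemma ptime_dsame [THEN ptime2D]: "ptime2 (\<lambda>x y. enc_bool (dsame x y))"
  unfolding ptime_defs dsame_def by (intro ptime_intros)

definition dunion_rule :: "data \<Rightarrow> data \<Rightarrow> data \<Rightarrow> data \<Rightarrow> bool" where
  "dunion_rule V x y1 y2 \<longleftrightarrow>
     dsame (item_bag y1) (item_bag x) \<and> dsame (item_bag y2) (item_bag x) \<and>
     dsame (item_part x) (dappend (item_part y1) (item_part y2)) \<and>
     (\<forall>z\<in>set (dl (item_part y1)). z \<notin>\<^sub>d item_part y2) \<and>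
     (\<forall>p\<in>set (dl (item_rel x)). p \<in>\<^sub>d dclosure V (dappend (item_rel y1) (item_rel y2)))"

lemma ptime_dunion_rule [THEN ptime4D]: "ptime4 (\<lambda>v x y z. enc_bool (dunion_rule v x y z))"
  unfolding ptime_defs dunion_rule_def by (intro ptime_intros ptime_items ptime_dsame ptime_dclosure)

definition dstep_rule :: "data \<Rightarrow> data \<Rightarrow> data \<Rightarrow> bool" where
  "dstep_rule V x y \<longleftrightarrow>
     (\<forall>u\<in>set (dl (item_part x)). u \<notin>\<^sub>d ddom (item_bag x) \<and>
        (\<forall>v\<in>set (dl V). dadj u v \<longrightarrow> v \<in>\<^sub>d item_part x \<or> v \<in>\<^sub>d ddom (item_bag x)) \<and>
        (u \<in>\<^sub>d item_part y \<or> u \<in>\<^sub>d ddom (item_bag y)) \<and>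
        (u \<in>\<^sub>d ddom (item_bag y) \<longrightarrow>
          (\<exists>v\<in>set (dl (ddom (item_bag x))).
             Cns u v \<in>\<^sub>d dclosure V (dedges V (item_rel y) (item_bag y) (item_part x))))) \<and>
     (\<forall>u\<in>set (dl (item_part y)). u \<in>\<^sub>d item_part x) \<and>
     (\<forall>p\<in>set (dl (item_bag x)). \<forall>q\<in>set (dl (item_bag y)). hd_data p = hd_data q \<longrightarrow> p = q) \<and>
     (\<forall>p\<in>set (dl (item_rel x)).
        p \<in>\<^sub>d dclosure V (dedges V (item_rel y) (item_bag y) (item_part x)))"

lemma ptime_dstep_rule [THEN ptime3D]: "ptime3 (\<lambda>v x y. enc_bool (dstep_rule v x y))"
  unfolding ptime_defs dstep_rule_def
  by (intro ptime_intros ptime_items ptime_ddom ptime_dadj ptime_dclosure ptime_dedges)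

definition dfinal :: "data \<Rightarrow> data \<Rightarrow> bool" where
  "dfinal V x \<longleftrightarrow> item_bag x \<noteq> Nl \<and>
     (\<forall>v\<in>set (dl V). v \<in>\<^sub>d item_part x \<or> v \<in>\<^sub>d ddom (item_bag x)) \<and>
     (\<forall>u\<in>set (dl (ddom (item_bag x))). \<forall>v\<in>set (dl (ddom (item_bag x))).
        Cns u v \<in>\<^sub>d dclosure V (dedges V (item_rel x) (item_bag x) (ddom (item_bag x))))"

lemma ptime_dfinal [THEN ptime2D]: "ptime2 (\<lambda>v x. enc_bool (dfinal v x))"
  unfolding ptime_defs dfinal_def
  by (intro ptime_intros ptime_items ptime_ddom ptime_dadj ptime_dclosure ptime_dedges)

definition dbags :: "nat \<Rightarrow> data \<Rightarrow> data \<Rightarrow> data" where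
  "dbags w V S = dfilter (\<lambda>b. \<forall>p\<in>set (dl b). \<forall>q\<in>set (dl b). hd_data p = hd_data q \<longrightarrow> p = q)
     (dtuples (Suc w) (dfilter (\<lambda>p. dallowed (hd_data p) (tl_data p)) (dprod V S)))"

lemma ptime_dbags [THEN ptime2D]: "ptime2 (dbags w)"
  unfolding ptime_defs dbags_def by (intro ptime_intros ptime_dtuples ptime_dprod ptime_dallowed)

definition doutside :: "data \<Rightarrow> data \<Rightarrow> data" where
  "doutside V X = dfilter (\<lambda>p. dadj (hd_data p) (tl_data p) \<and> hd_data p \<notin>\<^sub>d X \<and> tl_data p \<notin>\<^sub>d X) (dprod V V)"

lemma ptime_doutside [THEN ptime2D]: "ptime2 doutside"
  unfolding ptime_defs doutside_def by (intro ptime_intros ptime_dadj ptime_dprod)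

definition dcomps_of :: "data \<Rightarrow> data \<Rightarrow> data \<Rightarrow> data \<Rightarrow> data" where
  "dcomps_of V X D S = dfilter (\<lambda>v. v \<in>\<^sub>d D \<and> v \<notin>\<^sub>d X \<and>
     (\<exists>u\<in>set (dl S). u \<in>\<^sub>d D \<and> u \<notin>\<^sub>d X \<and> Cns u v \<in>\<^sub>d dclosure V (doutside V X))) V"

lemma ptime_dcomps_of [THEN ptime4D]: "ptime4 dcomps_of"
  unfolding ptime_defs dcomps_of_def by (intro ptime_intros ptime_dclosure ptime_doutside)

definition dregions :: "nat \<Rightarrow> data \<Rightarrow> data" where
  "dregions w V = Cns V (dmap (\<lambda>q. dfilter (\<lambda>v. v \<notin>\<^sub>d hd_data q \<and>
     Cns (tl_data q) v \<in>\<^sub>d dclosure V (doutside V (hd_data q))) V) (dprod (dtuples (Suc w) V) V))"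

lemma ptime_dregions [THEN ptime1D]: "ptime1 (dregions w)"
  unfolding ptime_defs dregions_def
  by (intro ptime_intros ptime_dtuples ptime_dprod ptime_dclosure ptime_doutside)

definition dparts :: "nat \<Rightarrow> data \<Rightarrow> data" where
  "dparts w V = dappend (dregions w V)
     (dmap (\<lambda>q. dcomps_of V (hd_data q) (hd_data (tl_data q)) (tl_data (tl_data q)))
        (dprod (dtuples (Suc w) V) (dprod (dregions w V) (dsuffixes V))))"

lemma ptime_dparts [THEN ptime1D]: "ptime1 (dparts w)"
  unfolding ptime_defs dparts_def
  by (intro ptime_intros ptime_dtuples ptime_dprod ptime_dcomps_of ptime_dregions)

definition duniverse :: "nat \<Rightarrow> data \<Rightarrow> data \<Rightarrow> data" where
  "duniverse w V S = dprod (dbags w V S) (dprod (dparts w V) (dtuples (Suc w) (dprod V V)))"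

lemma ptime_duniverse [THEN ptime2D]: "ptime2 (duniverse w)"
  unfolding ptime_defs duniverse_def by (intro ptime_vars ptime_dbags ptime_dparts ptime_dtuples ptime_dprod)

definition drule :: "data \<Rightarrow> data \<Rightarrow> data \<Rightarrow> bool" where
  "drule V k x \<longleftrightarrow> dempty_rule x \<or> (\<exists>y1\<in>set (dl k). \<exists>y2\<in>set (dl k). dunion_rule V x y1 y2) \<or>
     (\<exists>y\<in>set (dl k). dstep_rule V x y)"

lemma ptime_drule [THEN ptime3D]: "ptime3 (\<lambda>v k x. enc_bool (drule v k x))"
  unfolding ptime_defs drule_def by (intro ptime_intros ptime_dempty_rule ptime_dunion_rule ptime_dstep_rule)

definition dderived :: "nat \<Rightarrow> data \<Rightarrow> data \<Rightarrow> data" where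
  "dderived w V S = dlfp (drule V) (duniverse w V S)"

lemma ptime_dderived [THEN ptime2D]: "ptime2 (dderived w)"
  unfolding ptime_defs dderived_def
  by (rule ptime_dlfp[of _ _ "\<lambda>k x e. drule (hd e) k x"]) (intro ptime_vars ptime_duniverse ptime_drule)+

definition ddecide :: "nat \<Rightarrow> data \<Rightarrow> data \<Rightarrow> bool" where
  "ddecide w r S \<longleftrightarrow> (\<exists>x\<in>set (dl (dderived w (dverts r) S)). dfinal (dverts r) x)"

lemma ptime_ddecide: "ptime (Suc (Suc 0)) (\<lambda>e. enc_bool (ddecide w (hd e) (hd (tl e))))"
  unfolding ddecide_def by (intro ptime_intros ptime_dderived ptime_dverts ptime_dfinal)

section \<open>Correctness of the decision procedure\<close>

definition rel :: "data \<Rightarrow> (data \<times> data) set" where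
  "rel d = {(u, v). Cns u v \<in>\<^sub>d d}"

text \<open>\<open>rel\<close> overlooks entries \<open>Nl\<close>; where there are none, it
  determines the set of entries.\<close>

definition pairs :: "data \<Rightarrow> bool" where
  "pairs d \<longleftrightarrow> (\<forall>p\<in>set (dl d). p \<noteq> Nl)"

lemma set_dl_pairs:
  assumes "pairs d"
  shows "set (dl d) = (\<lambda>(u, v). Cns u v) ` rel d"
proof (intro equalityI subsetI)
  fix p assume p: "p \<in>\<^sub>d d"
  with assms obtain u v where "p = Cns u v" by (cases p) (auto simp: pairs_def)
  with p show "p \<in> (\<lambda>(u, v). Cns u v) ` rel d" by (auto simp: rel_def intro!: image_eqI[of _ _ "(u, v)"])
qed (auto simp: rel_def)

lemma pairs_ball: "pairs d \<Longrightarrow> (\<forall>p\<in>set (dl d). Q p) \<longleftrightarrow> (\<forall>(u, v)\<in>rel d. Q (Cns u v))"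
  by (simp add: set_dl_pairs case_prod_unfold)

lemma set_ddom: "pairs d \<Longrightarrow> set (dl (ddom d)) = Domain (rel d)"
  by (simp add: ddom_def set_dl_pairs image_image case_prod_unfold fst_eq_Domain)

lemma set_dprod: "set (dl (dprod c d)) = {Cns x y | x y. x \<in>\<^sub>d c \<and> y \<in>\<^sub>d d}"
  by (auto simp: dprod_def)

lemma set_dtuples: "set (dl (dtuples m d)) = {enc_list xs | xs. length xs = m \<and> set xs \<subseteq> set (dl d)}"
proof (induction m)
  case (Suc m)
  show ?case
  proof (intro equalityI subsetI)
    fix x assume "x \<in>\<^sub>d dtuples (Suc m) d"
    then obtain a xs where "x = enc_list (a # xs)" "a \<in>\<^sub>d d" "length xs = m" "set xs \<subseteq> set (dl d)"
      using Suc by (auto simp: set_dprod)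
    then show "x \<in> {enc_list xs | xs. length xs = Suc m \<and> set xs \<subseteq> set (dl d)}"
      by (intro CollectI exI[of _ "a # xs"]) auto
  next
    fix x assume "x \<in> {enc_list xs | xs. length xs = Suc m \<and> set xs \<subseteq> set (dl d)}"
    then show "x \<in>\<^sub>d dtuples (Suc m) d"
      using Suc by (auto simp: set_dprod length_Suc_conv)
  qed
qed auto

declare dtuples.simps [simp del]

lemma set_dsuffixes: "set (dl (dsuffixes d)) = {enc_list (drop i (dl d)) | i. i \<le> length (dl d)}"
proof (induction d)
  case (Cns x d)
  have "{enc_list (drop i (x # dl d)) | i. i \<le> Suc (length (dl d))}
      = insert (enc_list (x # dl d)) {enc_list (drop i (dl d)) | i. i \<le> length (dl d)}" (is "?L = ?R")
  proof (intro equalityI subsetI)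
    fix y assume "y \<in> ?L"
    then obtain i where "y = enc_list (drop i (x # dl d))" "i \<le> Suc (length (dl d))" by blast
    then show "y \<in> ?R" by (cases i) auto
  next
    fix y assume "y \<in> ?R"
    then consider "y = enc_list (drop 0 (x # dl d))" | i where "y = enc_list (drop (Suc i) (x # dl d))" "i \<le> length (dl d)"
      by auto
    then show "y \<in> ?L" by cases blast+
  qed
  with Cns show ?case by simp
qed auto

text \<open>A listing without repetitions is padded with copies of its first element, hence the
  condition \<open>S \<noteq> {}\<close>.\<close>

lemma set_eq_list_of_length:
  assumes "finite S" "S \<noteq> {}" "card S \<le> m"
  shows "\<exists>xs. length xs = m \<and> set xs = S"
proof -
  obtain ys where ys: "set ys = S" "distinct ys" using finite_distinct_list[OF assms(1)] by blast
  then have "length ys \<le> m" "ys \<noteq> []" using assms distinct_card[of ys] by auto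
  then show ?thesis
    using ys by (intro exI[of _ "ys @ replicate (m - length ys) (hd ys)"]) (auto simp: set_replicate_conv_if)
qed

lemma dmeets_sym: "dmeets c d \<Longrightarrow> dmeets d c"
  unfolding dmeets_def dbit_def by (metis dlength_eq_iff)

lemma dclosure_closed:
  assumes "u \<in>\<^sub>d V" "v \<in>\<^sub>d V"
    and "u = v \<or> (\<exists>q\<in>set (dl (dclosure V r)). hd_data q = u \<and> (Cns (tl_data q) v \<in>\<^sub>d r \<or> Cns v (tl_data q) \<in>\<^sub>d r))"
  shows "Cns u v \<in>\<^sub>d dclosure V r"
proof -
  let ?p = "\<lambda>k p. hd_data p = tl_data p \<or> (\<exists>q\<in>set (dl k). hd_data q = hd_data p \<and>
        (Cns (tl_data q) (tl_data p) \<in>\<^sub>d r \<or> Cns (tl_data p) (tl_data q) \<in>\<^sub>d r))"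
  have "Cns u v \<in>\<^sub>d dlfp ?p (dprod V V)"
  proof (rule dlfp_closed)
    show "?p k' x" if "set (dl k) \<subseteq> set (dl k')" "?p k x" for k k' x
      using that by blast
    show "Cns u v \<in>\<^sub>d dprod V V" using assms(1,2) by (auto simp: set_dprod)
    show "?p (dlfp ?p (dprod V V)) (Cns u v)"
      using assms(3) unfolding dclosure_def by simp
  qed
  then show ?thesis by (simp add: dclosure_def)
qed

lemma dclosure_iff:
  assumes "rel r \<subseteq> set (dl V) \<times> set (dl V)"
  shows "Cns u v \<in>\<^sub>d dclosure V r \<longleftrightarrow> u \<in>\<^sub>d V \<and> v \<in>\<^sub>d V \<and> (u, v) \<in> sclosure (rel r)"
proof
  assume "Cns u v \<in>\<^sub>d dclosure V r"
  then have "\<exists>x y. Cns u v = Cns x y \<and> x \<in>\<^sub>d V \<and> y \<in>\<^sub>d V \<and> (x, y) \<in> sclosure (rel r)"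
    unfolding dclosure_def
  proof (rule dlfp_induct)
    fix k p
    assume k: "\<And>q. q \<in>\<^sub>d k \<Longrightarrow> \<exists>x y. q = Cns x y \<and> x \<in>\<^sub>d V \<and> y \<in>\<^sub>d V \<and> (x, y) \<in> sclosure (rel r)"
      and p: "p \<in>\<^sub>d dprod V V" and *: "hd_data p = tl_data p \<or> (\<exists>q\<in>set (dl k). hd_data q = hd_data p \<and>
        (Cns (tl_data q) (tl_data p) \<in>\<^sub>d r \<or> Cns (tl_data p) (tl_data q) \<in>\<^sub>d r))"
    from p obtain x y where xy: "p = Cns x y" "x \<in>\<^sub>d V" "y \<in>\<^sub>d V" by (auto simp: set_dprod)
    have "(x, y) \<in> sclosure (rel r)"
    proof (cases "x = y")
      case False
      with * xy obtain q where q: "q \<in>\<^sub>d k" "hd_data q = x" "Cns (tl_data q) y \<in>\<^sub>d r \<or> Cns y (tl_data q) \<in>\<^sub>d r"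
        by auto
      with k[OF q(1)] obtain z where "(x, z) \<in> sclosure (rel r)" "(z, y) \<in> rel r \<or> (y, z) \<in> rel r"
        by (auto simp: rel_def)
      then show ?thesis by (blast intro: sclosure_trans sclosure_base sclosure_sym)
    qed simp
    with xy show "\<exists>x y. p = Cns x y \<and> x \<in>\<^sub>d V \<and> y \<in>\<^sub>d V \<and> (x, y) \<in> sclosure (rel r)" by blast
  qed
  then show "u \<in>\<^sub>d V \<and> v \<in>\<^sub>d V \<and> (u, v) \<in> sclosure (rel r)" by auto
next
  assume uv: "u \<in>\<^sub>d V \<and> v \<in>\<^sub>d V \<and> (u, v) \<in> sclosure (rel r)"
  then have "(u, v) \<in> (rel r \<union> (rel r)\<inverse>)\<^sup>*" by (simp add: sclosure_def)
  then show "Cns u v \<in>\<^sub>d dclosure V r"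
  proof (induction rule: rtrancl_induct)
    case base
    show ?case by (rule dclosure_closed) (use uv in auto)
  next
    case (step y z)
    then have "z \<in>\<^sub>d V" using assms by auto
    have "Cns y z \<in>\<^sub>d r \<or> Cns z y \<in>\<^sub>d r" using step.hyps(2) by (auto simp: rel_def)
    with step.IH have "\<exists>q\<in>set (dl (dclosure V r)). hd_data q = u \<and> (Cns (tl_data q) z \<in>\<^sub>d r \<or> Cns z (tl_data q) \<in>\<^sub>d r)"
      by (intro bexI[of _ "Cns u y"]) auto
    then show ?case
      using uv \<open>z \<in>\<^sub>d V\<close> by (intro dclosure_closed) auto
  qed
qed

locale data_problem =
  fixes V S :: data and w :: nat
  assumes dadj_sym: "u \<in>\<^sub>d V \<Longrightarrow> v \<in>\<^sub>d V \<Longrightarrow> dadj u v \<Longrightarrow> dadj v u"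
begin

text \<open>\<open>dadj\<close> reads any tree as an address, so adjacency is confined to
  \<open>V\<close>, as \<open>assignment_problem\<close> demands.\<close>

abbreviation "adj u v \<equiv> u \<in>\<^sub>d V \<and> v \<in>\<^sub>d V \<and> dadj u v"
abbreviation "allowed v \<equiv> {s. s \<in>\<^sub>d S \<and> dallowed v s}"

sublocale assignment_problem "set (dl V)" adj allowed dmeets
  by unfold_locales (auto intro: dadj_sym dmeets_sym)

abbreviation "ibag x \<equiv> rel (item_bag x)"
abbreviation "ipart x \<equiv> set (dl (item_part x))"
abbreviation "irel x \<equiv> rel (item_rel x)"

definition wf_item :: "data \<Rightarrow> bool" where
  "wf_item x \<longleftrightarrow> pairs (item_bag x) \<and> pairs (item_rel x) \<and> bag (ibag x) \<and>
     irel x \<subseteq> set (dl V) \<times> set (dl V) \<and> ipart x \<subseteq> set (dl V)"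

lemma dregions_sub: "d \<in>\<^sub>d dregions w V \<Longrightarrow> set (dl d) \<subseteq> set (dl V)"
  by (auto simp: dregions_def)

lemma dparts_sub: "d \<in>\<^sub>d dparts w V \<Longrightarrow> set (dl d) \<subseteq> set (dl V)"
  using dregions_sub by (auto simp: dparts_def dcomps_of_def)

lemma duniverse_wf:
  assumes "x \<in>\<^sub>d duniverse w V S"
  shows "wf_item x"
proof -
  from assms obtain b z r where x: "x = Cns b (Cns z r)" and b: "b \<in>\<^sub>d dbags w V S"
    and z: "z \<in>\<^sub>d dparts w V" and r: "r \<in>\<^sub>d dtuples (Suc w) (dprod V V)"
    by (auto simp: duniverse_def set_dprod)
  have b1: "\<exists>u v. p = Cns u v \<and> u \<in>\<^sub>d V \<and> v \<in>\<^sub>d S \<and> dallowed u v" if "p \<in>\<^sub>d b" for p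
    using b that by (auto simp: dbags_def set_dtuples set_dprod)
  have b2: "p = q" if "p \<in>\<^sub>d b" "q \<in>\<^sub>d b" "hd_data p = hd_data q" for p q
    using b that by (auto simp: dbags_def)
  have "bag (rel b)"
    using b1 b2 unfolding bag_def single_valued_def rel_def by fastforce
  moreover have "pairs b" using b1 by (auto simp: pairs_def)
  moreover have "\<exists>u v. p = Cns u v \<and> u \<in>\<^sub>d V \<and> v \<in>\<^sub>d V" if "p \<in>\<^sub>d r" for p
    using r that by (auto simp: set_dtuples set_dprod)
  then have "pairs r" "rel r \<subseteq> set (dl V) \<times> set (dl V)"
    by (auto simp: pairs_def rel_def)
  ultimately show ?thesis
    using dparts_sub[OF z] by (auto simp: wf_item_def x item_bag_def item_part_def item_rel_def)
qed

lemma dempty_rule_iff: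
  "wf_item x \<Longrightarrow> dempty_rule x \<longleftrightarrow> ipart x = {} \<and> irel x \<subseteq> Id"
  unfolding dempty_rule_def wf_item_def by (cases "item_part x") (auto simp: pairs_ball)

lemma rel_dappend: "rel (dappend c d) = rel c \<union> rel d"
  by (auto simp: rel_def)

lemma rel_subset_dclosure:
  assumes "pairs r" "rel r \<subseteq> set (dl V) \<times> set (dl V)" "rel e \<subseteq> set (dl V) \<times> set (dl V)"
  shows "(\<forall>p\<in>set (dl r). p \<in>\<^sub>d dclosure V e) \<longleftrightarrow> rel r \<subseteq> sclosure (rel e)"
  unfolding pairs_ball[OF assms(1)] using dclosure_iff[OF assms(3)] assms(2) by auto

lemma dsame_rel:
  assumes "pairs c" "pairs d"
  shows "dsame c d \<longleftrightarrow> rel c = rel d"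
  unfolding dsame_def pairs_ball[OF assms(1)] pairs_ball[OF assms(2)] by (auto simp: rel_def)

lemma dsame_set: "dsame c d \<longleftrightarrow> set (dl c) = set (dl d)"
  by (auto simp: dsame_def)

lemma dunion_rule_iff:
  assumes "wf_item x" "wf_item y1" "wf_item y2"
  shows "dunion_rule V x y1 y2 \<longleftrightarrow> ibag y1 = ibag x \<and> ibag y2 = ibag x \<and>
    ipart x = ipart y1 \<union> ipart y2 \<and> ipart y1 \<inter> ipart y2 = {} \<and> irel x \<subseteq> sclosure (irel y1 \<union> irel y2)"
proof -
  have sub: "rel (dappend (item_rel y1) (item_rel y2)) \<subseteq> set (dl V) \<times> set (dl V)"
    using assms by (auto simp: wf_item_def rel_dappend)
  have r: "(\<forall>p\<in>set (dl (item_rel x)). p \<in>\<^sub>d dclosure V (dappend (item_rel y1) (item_rel y2)))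
      \<longleftrightarrow> irel x \<subseteq> sclosure (irel y1 \<union> irel y2)"
    using rel_subset_dclosure[OF _ _ sub, of "item_rel x"] assms by (simp add: wf_item_def rel_dappend)
  have b: "dsame (item_bag y1) (item_bag x) \<longleftrightarrow> ibag y1 = ibag x"
    "dsame (item_bag y2) (item_bag x) \<longleftrightarrow> ibag y2 = ibag x"
    using assms by (intro dsame_rel; simp add: wf_item_def)+
  have p: "dsame (item_part x) (dappend (item_part y1) (item_part y2)) \<longleftrightarrow> ipart x = ipart y1 \<union> ipart y2"
    by (simp add: dsame_set)
  show ?thesis unfolding dunion_rule_def r b p by blast
qed

lemma rel_dedges:
  assumes "pairs b" "rel r \<subseteq> set (dl V) \<times> set (dl V)"
  shows "rel (dedges V r b z) = rel r \<union> bag_edges (rel b) (set (dl z))"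
    and "Domain (rel b) \<subseteq> set (dl V) \<Longrightarrow> rel (dedges V r b z) \<subseteq> set (dl V) \<times> set (dl V)"
proof -
  have b: "(\<exists>s\<in>set (dl b). \<exists>t\<in>set (dl b). hd_data s = u \<and> hd_data t = v \<and> Q (tl_data s) (tl_data t))
      \<longleftrightarrow> (\<exists>s t. (u, s) \<in> rel b \<and> (v, t) \<in> rel b \<and> Q s t)" for u v Q
    unfolding set_dl_pairs[OF assms(1)] by force
  note b = b[of _ _ "\<lambda>s t. dadj u v \<and> dmeets s t \<and> (u \<in>\<^sub>d z \<or> v \<in>\<^sub>d z)" for u v]
  show "rel (dedges V r b z) = rel r \<union> bag_edges (rel b) (set (dl z))"
  proof (intro equalityI subsetI)
    fix e assume "e \<in> rel (dedges V r b z)"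
    then obtain u v where e: "e = (u, v)" "u \<in>\<^sub>d V" "v \<in>\<^sub>d V" and
      "Cns u v \<in>\<^sub>d r \<or> (\<exists>s\<in>set (dl b). \<exists>t\<in>set (dl b). hd_data s = u \<and> hd_data t = v \<and>
        (dadj u v \<and> dmeets (tl_data s) (tl_data t) \<and> (u \<in>\<^sub>d z \<or> v \<in>\<^sub>d z)))"
      unfolding rel_def dedges_def by (auto simp: set_dprod)
    then show "e \<in> rel r \<union> bag_edges (rel b) (set (dl z))"
      unfolding b by (auto simp: rel_def bag_edges_def)
  next
    fix e assume e: "e \<in> rel r \<union> bag_edges (rel b) (set (dl z))"
    obtain u v where uv: "e = (u, v)" by (cases e)
    with e assms(2) have "u \<in>\<^sub>d V" "v \<in>\<^sub>d V" by (auto simp: bag_edges_def)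
    moreover have "Cns u v \<in>\<^sub>d r \<or> (\<exists>s\<in>set (dl b). \<exists>t\<in>set (dl b). hd_data s = u \<and> hd_data t = v \<and>
        (dadj u v \<and> dmeets (tl_data s) (tl_data t) \<and> (u \<in>\<^sub>d z \<or> v \<in>\<^sub>d z)))"
      unfolding b using e uv by (auto simp: rel_def bag_edges_def)
    ultimately show "e \<in> rel (dedges V r b z)"
      unfolding rel_def dedges_def uv by (simp add: set_dprod)
  qed
  then show "rel (dedges V r b z) \<subseteq> set (dl V) \<times> set (dl V)"
    using assms(2) by (auto simp: bag_edges_def)
qed

lemma wf_Domain: "wf_item x \<Longrightarrow> Domain (ibag x) \<subseteq> set (dl V)"
  by (auto simp: wf_item_def bag_def)

lemma dstep_rule_iff:
  assumes x: "wf_item x" and y: "wf_item y"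
  shows "dstep_rule V x y \<longleftrightarrow> step_ok (ibag x) (ipart x) (irel x) (ibag y) (ipart y) (irel y)"
proof -
  let ?E = "dedges V (item_rel y) (item_bag y) (item_part x)"
  have E: "rel ?E = irel y \<union> bag_edges (ibag y) (ipart x)" "rel ?E \<subseteq> set (dl V) \<times> set (dl V)"
    using rel_dedges[of "item_bag y" "item_rel y" "item_part x"] y wf_Domain[OF y] by (auto simp: wf_item_def)
  have d: "set (dl (ddom (item_bag x))) = Domain (ibag x)" "set (dl (ddom (item_bag y))) = Domain (ibag y)"
    using x y by (auto simp: set_ddom wf_item_def)
  have r: "(\<forall>p\<in>set (dl (item_rel x)). p \<in>\<^sub>d dclosure V ?E) \<longleftrightarrow> irel x \<subseteq> sclosure (irel y \<union> bag_edges (ibag y) (ipart x))"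
    using rel_subset_dclosure[OF _ _ E(2), of "item_rel x"] x E(1) by (simp add: wf_item_def)
  have b: "(\<forall>p\<in>set (dl (item_bag x)). \<forall>q\<in>set (dl (item_bag y)). hd_data p = hd_data q \<longrightarrow> p = q)
      \<longleftrightarrow> (\<forall>v s t. (v, s) \<in> ibag x \<longrightarrow> (v, t) \<in> ibag y \<longrightarrow> s = t)"
    using x y by (auto simp: pairs_ball wf_item_def)
  have c: "Cns u v \<in>\<^sub>d dclosure V ?E \<longleftrightarrow> (u, v) \<in> sclosure (irel y \<union> bag_edges (ibag y) (ipart x))"
    if "u \<in> ipart x" "v \<in> Domain (ibag x)" for u v
    unfolding dclosure_iff[OF E(2)] E(1) using that x wf_Domain[OF x] by (auto simp: wf_item_def)
  let ?C = "\<lambda>u. \<exists>v\<in>Domain (ibag x). (u, v) \<in> sclosure (irel y \<union> bag_edges (ibag y) (ipart x))"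
  let ?N = "\<lambda>u. \<forall>v\<in>set (dl V). adj u v \<longrightarrow> v \<in> ipart x \<union> Domain (ibag x)"
  have "(\<forall>u\<in>ipart x. u \<notin> Domain (ibag x) \<and>
        (\<forall>v\<in>set (dl V). dadj u v \<longrightarrow> v \<in> ipart x \<or> v \<in> Domain (ibag x)) \<and>
        (u \<in> ipart y \<or> u \<in> Domain (ibag y)) \<and>
        (u \<in> Domain (ibag y) \<longrightarrow> (\<exists>v\<in>Domain (ibag x). Cns u v \<in>\<^sub>d dclosure V ?E)))
      \<longleftrightarrow> (\<forall>u\<in>ipart x. u \<notin> Domain (ibag x) \<and> ?N u \<and> (u \<in> ipart y \<or> u \<in> Domain (ibag y)) \<and>
        (u \<in> Domain (ibag y) \<longrightarrow> ?C u))" (is "(\<forall>u\<in>_. ?p u) \<longleftrightarrow> (\<forall>u\<in>_. ?q u)")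
  proof (rule ball_cong[OF refl])
    fix u assume u: "u \<in> ipart x"
    then have "(\<exists>v\<in>Domain (ibag x). Cns u v \<in>\<^sub>d dclosure V ?E) \<longleftrightarrow> ?C u"
      using c by (intro bex_cong refl) blast
    moreover have "u \<in>\<^sub>d V" using x u by (auto simp: wf_item_def)
    ultimately show "?p u = ?q u" by simp
  qed
  also have "\<dots> \<longleftrightarrow> ipart x \<inter> Domain (ibag x) = {} \<and> (\<forall>u\<in>ipart x. ?N u) \<and>
      ipart x \<subseteq> ipart y \<union> Domain (ibag y) \<and> (\<forall>v\<in>ipart x \<inter> Domain (ibag y). ?C v)"
    by blast
  finally have main: "(\<forall>u\<in>ipart x. ?p u) \<longleftrightarrow> ipart x \<inter> Domain (ibag x) = {} \<and>
      (\<forall>u\<in>ipart x. ?N u) \<and> ipart x \<subseteq> ipart y \<union> Domain (ibag y) \<and>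
      (\<forall>v\<in>ipart x \<inter> Domain (ibag y). ?C v)" .
  show ?thesis
    unfolding dstep_rule_def step_ok_def r b d main subset_eq[of "ipart y"]
    by (rule iffI; elim conjE; intro conjI; assumption)
qed

lemma dfinal_iff:
  assumes x: "wf_item x"
  shows "dfinal V x \<longleftrightarrow> final_ok (ibag x) (ipart x) (irel x)"
proof -
  let ?E = "dedges V (item_rel x) (item_bag x) (ddom (item_bag x))"
  have d: "set (dl (ddom (item_bag x))) = Domain (ibag x)" using x by (auto simp: set_ddom wf_item_def)
  have E: "rel ?E = irel x \<union> bag_edges (ibag x) (Domain (ibag x))" "rel ?E \<subseteq> set (dl V) \<times> set (dl V)"
    using rel_dedges[of "item_bag x" "item_rel x" "ddom (item_bag x)"] x wf_Domain[OF x] d by (auto simp: wf_item_def)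
  have c: "Cns u v \<in>\<^sub>d dclosure V ?E \<longleftrightarrow> (u, v) \<in> sclosure (irel x \<union> bag_edges (ibag x) (Domain (ibag x)))"
    if "u \<in> Domain (ibag x)" "v \<in> Domain (ibag x)" for u v
    unfolding dclosure_iff[OF E(2)] E(1) using that wf_Domain[OF x] by auto
  have "item_bag x \<noteq> Nl \<longleftrightarrow> set (dl (item_bag x)) \<noteq> {}" by (cases "item_bag x") auto
  also have "\<dots> \<longleftrightarrow> ibag x \<noteq> {}"
    using x by (subst set_dl_pairs) (auto simp: wf_item_def)
  finally have "item_bag x \<noteq> Nl \<longleftrightarrow> Domain (ibag x) \<noteq> {}" by (simp add: Domain_empty_iff)
  moreover have "(\<forall>u\<in>Domain (ibag x). \<forall>v\<in>Domain (ibag x). Cns u v \<in>\<^sub>d dclosure V ?E)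
      \<longleftrightarrow> Domain (ibag x) \<times> Domain (ibag x) \<subseteq> sclosure (irel x \<union> bag_edges (ibag x) (Domain (ibag x)))"
    unfolding subset_eq split_paired_Ball_Sigma using c by (intro ball_cong refl) blast
  ultimately show ?thesis
    unfolding dfinal_def final_ok_def d subset_eq Un_iff by (simp only:)
qed

abbreviation "K \<equiv> dderived w V S"

lemma dderived_sub: "x \<in>\<^sub>d K \<Longrightarrow> x \<in>\<^sub>d duniverse w V S"
  unfolding dderived_def by (erule dlfp_induct)

text \<open>Well-formedness is carried through the induction, since the rules on data agree with the
  abstract rules for well-formed items.\<close>

lemma dderived_sound: "x \<in>\<^sub>d K \<Longrightarrow> sound (ibag x) (ipart x) (irel x)"
proof -
  assume "x \<in>\<^sub>d K"
  then have "wf_item x \<and> sound (ibag x) (ipart x) (irel x)"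
    unfolding dderived_def
  proof (rule dlfp_induct)
    fix k x
    assume k: "\<And>y. y \<in>\<^sub>d k \<Longrightarrow> wf_item y \<and> sound (ibag y) (ipart y) (irel y)"
      and x: "x \<in>\<^sub>d duniverse w V S" and rule: "drule V k x"
    have wf: "wf_item x" by (rule duniverse_wf[OF x])
    then have sv: "single_valued (ibag x)" by (auto simp: wf_item_def bag_def)
    from rule consider "dempty_rule x"
      | y1 y2 where "y1 \<in>\<^sub>d k" "y2 \<in>\<^sub>d k" "dunion_rule V x y1 y2"
      | y where "y \<in>\<^sub>d k" "dstep_rule V x y"
      by (auto simp: drule_def)
    then have "sound (ibag x) (ipart x) (irel x)"
    proof cases
      case 1
      then show ?thesis using sound_empty[OF sv, of "irel x"] dempty_rule_iff[OF wf] by simp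
    next
      case 2
      from k[OF 2(1)] k[OF 2(2)] have y: "wf_item y1" "wf_item y2" by auto
      from 2(3) show ?thesis
        unfolding dunion_rule_iff[OF wf y]
        using sound_union[of "ibag x" "ipart y1" "irel y1" "ipart y2" "irel y2" "irel x"] k[OF 2(1)] k[OF 2(2)]
        by simp
    next
      case 3
      from k[OF 3(1)] have y: "wf_item y" by auto
      then have "bag (ibag y)" by (simp add: wf_item_def)
      with 3(2) k[OF 3(1)] sv show ?thesis
        unfolding dstep_rule_iff[OF wf y] by (blast intro: sound_step)
    qed
    with wf show "wf_item x \<and> sound (ibag x) (ipart x) (irel x)" by simp
  qed
  then show ?thesis by simp
qed

lemma derived_final_solvable:
  assumes "x \<in>\<^sub>d K" and "dfinal V x"
  shows solvable
proof -
  have wf: "wf_item x" using assms(1) dderived_sub duniverse_wf by blast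
  then have "bag (ibag x)" by (simp add: wf_item_def)
  from sound_final[OF dderived_sound[OF assms(1)] this] assms(2) show ?thesis
    by (simp add: dfinal_iff[OF wf])
qed

lemma small_tuple:
  assumes "small w X" and "X \<subseteq> set (dl d)"
  shows "\<exists>t. t \<in>\<^sub>d dtuples (Suc w) d \<and> set (dl t) = X"
proof -
  obtain xs where "length xs = Suc w" "set xs = X"
    using set_eq_list_of_length[of X "Suc w"] assms(1) by (auto simp: small_def)
  with assms(2) show ?thesis by (intro exI[of _ "enc_list xs"]) (auto simp: set_dtuples)
qed

lemma small_rel_tuple:
  assumes "small w R" and "\<And>u v. (u, v) \<in> R \<Longrightarrow> Cns u v \<in>\<^sub>d d"
  shows "\<exists>t. t \<in>\<^sub>d dtuples (Suc w) d \<and> rel t = R \<and> set (dl t) = (\<lambda>(u, v). Cns u v) ` R"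
proof -
  let ?X = "(\<lambda>(u, v). Cns u v) ` R"
  have "small w ?X" using assms(1) card_image_le[of R "\<lambda>(u, v). Cns u v"] by (auto simp: small_def)
  moreover have "?X \<subseteq> set (dl d)" using assms(2) by auto
  ultimately obtain t where t: "t \<in>\<^sub>d dtuples (Suc w) d" "set (dl t) = ?X" using small_tuple by blast
  then show ?thesis by (intro exI[of _ t]) (auto simp: rel_def)
qed

lemma rel_doutside: "rel (doutside V X) = outside (set (dl X))"
  by (auto simp: rel_def doutside_def outside_def set_dprod)

lemma mem_dclosure_outside:
  "Cns u v \<in>\<^sub>d dclosure V (doutside V X) \<longleftrightarrow> u \<in>\<^sub>d V \<and> v \<in>\<^sub>d V \<and> (u, v) \<in> sclosure (outside (set (dl X)))"
  using dclosure_iff[of "doutside V X" V u v] by (auto simp: rel_doutside) (auto simp: outside_def)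

lemma region_dregions:
  assumes "region w D"
  shows "\<exists>d. d \<in>\<^sub>d dregions w V \<and> set (dl d) = D"
proof (cases "D = set (dl V)")
  case True
  then show ?thesis by (intro exI[of _ V]) (auto simp: dregions_def)
next
  case False
  with assms obtain X c where X: "small w X" "X \<subseteq> set (dl V)" "c \<in>\<^sub>d V" "D = comp X c"
    by (auto simp: region_def)
  from small_tuple[OF X(1,2)] obtain t where t: "t \<in>\<^sub>d dtuples (Suc w) V" "set (dl t) = X" by blast
  let ?d = "dfilter (\<lambda>v. v \<notin>\<^sub>d t \<and> Cns c v \<in>\<^sub>d dclosure V (doutside V t)) V"
  have "?d \<in>\<^sub>d dregions w V"
    using t(1) X(3) by (auto simp: dregions_def set_dprod intro!: image_eqI[of _ _ "Cns c' t'" for c' t'] bexI)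
  moreover have "set (dl ?d) = D"
    using X(3) by (auto simp: X(4) comp_def mem_dclosure_outside t(2))
  ultimately show ?thesis by blast
qed

lemma part_dparts:
  assumes "part w (dl V) Z"
  shows "\<exists>d. d \<in>\<^sub>d dparts w V \<and> set (dl d) = Z"
proof (cases "region w Z")
  case True
  from region_dregions[OF this] show ?thesis by (auto simp: dparts_def)
next
  case False
  with assms obtain X D i where X: "small w X" "X \<subseteq> set (dl V)" "region w D"
    "Z = comps_of X D (set (drop i (dl V)))" by (auto simp: part_def)
  from small_tuple[OF X(1,2)] obtain t where t: "t \<in>\<^sub>d dtuples (Suc w) V" "set (dl t) = X" by blast
  from region_dregions[OF X(3)] obtain e where e: "e \<in>\<^sub>d dregions w V" "set (dl e) = D" by blast
  define s where "s = enc_list (drop (min i (length (dl V))) (dl V))"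
  have s: "s \<in>\<^sub>d dsuffixes V" "set (dl s) = set (drop i (dl V))"
    by (auto simp: s_def set_dsuffixes min_def)
  have sV: "set (dl s) \<subseteq> set (dl V)" using s(2) by (auto dest: in_set_dropD)
  let ?d = "dcomps_of V t e s"
  have "Cns t (Cns e s) \<in>\<^sub>d dprod (dtuples (Suc w) V) (dprod (dregions w V) (dsuffixes V))"
    using t e s by (auto simp: set_dprod)
  then have "?d \<in>\<^sub>d dparts w V"
    by (auto simp: dparts_def intro!: image_eqI[of _ _ "Cns t (Cns e s)"])
  moreover have "set (dl ?d) = Z"
    using sV by (auto simp: X(4) dcomps_of_def comps_of_def mem_dclosure_outside t(2) e(2) s(2)[symmetric])
  ultimately show ?thesis by blast
qed

text \<open>Items are compared only through the sets they represent. Every triple that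
  \<open>derivation_closed\<close> speaks about is represented by an item of the universe, and
  \<open>dlfp_closed\<close> puts this item into the fixed point.\<close>

lemma dderived_closed:
  "derivation_closed w (dl V) (\<lambda>\<beta> Z R. \<exists>x. x \<in>\<^sub>d K \<and> ibag x = \<beta> \<and> ipart x = Z \<and> irel x = R)"
  unfolding derivation_closed_def
proof (intro allI impI)
  fix \<beta> R :: "(data \<times> data) set" and Z :: "data set"
  let ?Der = "\<lambda>\<beta> Z R. \<exists>x. x \<in>\<^sub>d K \<and> ibag x = \<beta> \<and> ipart x = Z \<and> irel x = R"
  assume \<beta>: "bag \<beta>" "small w \<beta>" and Z: "part w (dl V) Z" and R: "R \<subseteq> set (dl V) \<times> set (dl V)" "small w R"
    and rule: "derivable ?Der \<beta> Z R"
  have "Cns v s \<in>\<^sub>d dfilter (\<lambda>p. dallowed (hd_data p) (tl_data p)) (dprod V S)" if "(v, s) \<in> \<beta>" for v s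
    using that \<beta>(1) by (auto simp: bag_def set_dprod)
  from small_rel_tuple[OF \<beta>(2) this] obtain b where
    b: "b \<in>\<^sub>d dtuples (Suc w) (dfilter (\<lambda>p. dallowed (hd_data p) (tl_data p)) (dprod V S))"
      "rel b = \<beta>" "set (dl b) = (\<lambda>(u, v). Cns u v) ` \<beta>" by blast
  have "b \<in>\<^sub>d dbags w V S"
    using b \<beta>(1) by (auto simp: dbags_def bag_def single_valued_def)
  moreover obtain z where z: "z \<in>\<^sub>d dparts w V" "set (dl z) = Z" using part_dparts[OF Z] by blast
  moreover have "Cns u v \<in>\<^sub>d dprod V V" if "(u, v) \<in> R" for u v
    using that R(1) by (auto simp: set_dprod)
  from small_rel_tuple[OF R(2) this] obtain r where
    r: "r \<in>\<^sub>d dtuples (Suc w) (dprod V V)" "rel r = R" by blast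
  define x where "x = Cns b (Cns z r)"
  have x: "x \<in>\<^sub>d duniverse w V S"
    using \<open>b \<in>\<^sub>d dbags w V S\<close> z r by (auto simp: duniverse_def set_dprod x_def)
  have ab: "ibag x = \<beta>" "ipart x = Z" "irel x = R"
    by (simp_all add: x_def item_bag_def item_part_def item_rel_def b z r)
  have wf: "wf_item x" by (rule duniverse_wf[OF x])
  have wfK: "wf_item y" if "y \<in>\<^sub>d K" for y using that dderived_sub duniverse_wf by blast
  have "drule V K x"
    using rule unfolding derivable_def
  proof (elim disjE exE conjE)
    assume "Z = {}" "R \<subseteq> Id"
    then have "dempty_rule x" using dempty_rule_iff[OF wf] ab by simp
    then show ?thesis by (simp add: drule_def)
  next
    fix Z1 Z2 R1 R2 y1 y2
    assume *: "Z = Z1 \<union> Z2" "Z1 \<inter> Z2 = {}" "R \<subseteq> sclosure (R1 \<union> R2)"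
      "y1 \<in>\<^sub>d K" "ibag y1 = \<beta>" "ipart y1 = Z1" "irel y1 = R1"
      "y2 \<in>\<^sub>d K" "ibag y2 = \<beta>" "ipart y2 = Z2" "irel y2 = R2"
    then have "dunion_rule V x y1 y2"
      using dunion_rule_iff[OF wf wfK wfK] ab by simp
    with * show ?thesis unfolding drule_def by blast
  next
    fix \<beta>' Z' R' y
    assume *: "step_ok \<beta> Z R \<beta>' Z' R'" "y \<in>\<^sub>d K" "ibag y = \<beta>'" "ipart y = Z'" "irel y = R'"
    then have "dstep_rule V x y"
      using dstep_rule_iff[OF wf wfK] ab by simp
    with * show ?thesis unfolding drule_def by blast
  qed
  have "x \<in>\<^sub>d dlfp (drule V) (duniverse w V S)"
  proof (rule dlfp_closed[OF _ x])
    show "drule V k' y" if "set (dl k) \<subseteq> set (dl k')" "drule V k y" for k k' y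
      using that unfolding drule_def by blast
    show "drule V (dlfp (drule V) (duniverse w V S)) x"
      using \<open>drule V K x\<close> by (simp add: dderived_def)
  qed
  with ab show "?Der \<beta> Z R" unfolding dderived_def by blast
qed

lemma solvable_derived_final:
  fixes top :: "data \<Rightarrow> nat"
  assumes rd: "rooted_decomposition (set (dl V)) adj m parent B top"
    and width: "\<And>i. i < m \<Longrightarrow> card (B i) \<le> Suc w" and root: "0 < m" "B 0 \<noteq> {}" and solvable
  shows "\<exists>x\<in>set (dl K). dfinal V x"
proof -
  from \<open>solvable\<close> obtain A where A: "\<forall>v\<in>set (dl V). A v \<in> allowed v" "set (dl V) \<times> set (dl V) \<subseteq> (realized A)\<^sup>*"
    by (auto simp: solvable_def)
  interpret rooted_decomposition "set (dl V)" adj m parent B top by (rule rd)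
  \<comment> \<open>\<open>Der\<close> becomes the set of triples represented in the computed fixed
    point.\<close>
  interpret decomposed_problem "set (dl V)" adj allowed dmeets m parent B top w A "dl V"
    "\<lambda>\<beta> Z R. \<exists>x. x \<in>\<^sub>d K \<and> ibag x = \<beta> \<and> ipart x = Z \<and> irel x = R"
    using A width root dderived_closed by unfold_locales auto
  from derivation_complete obtain x where x: "x \<in>\<^sub>d K" "final_ok (ibag x) (ipart x) (irel x)" by blast
  then have "wf_item x" using dderived_sub duniverse_wf by blast
  from dfinal_iff[OF this] x show ?thesis by blast
qed

end

section \<open>Bit vectors and truncated numbers\<close>

lemma sz_enc_list_le: "(\<And>x. x \<in> set xs \<Longrightarrow> sz x \<le> b) \<Longrightarrow> sz (enc_list xs) \<le> 1 + length xs * (b + 1)"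
  by (induction xs) fastforce+

lemma hd_enc_list_drop: "i < length xs \<Longrightarrow> hd_data (enc_list (drop i xs)) = xs ! i"
  by (simp add: Cons_nth_drop_Suc[symmetric])

lemma dbit_iff:
  assumes "length xs = n" and "length (dl m) = n - i" and "i < n"
  shows "dbit (enc_list xs) m \<longleftrightarrow> xs ! i \<noteq> Nl"
proof
  assume "dbit (enc_list xs) m"
  then obtain j where "j \<le> n" "length xs - j = n - i" "hd_data (enc_list (drop j xs)) \<noteq> Nl"
    using assms by (auto simp: dbit_def set_dsuffixes)
  moreover from this have "j = i" using assms by auto
  ultimately show "xs ! i \<noteq> Nl" using assms hd_enc_list_drop[of i xs] by simp
next
  assume "xs ! i \<noteq> Nl"
  then show "dbit (enc_list xs) m"
    using assms hd_enc_list_drop[of i xs] by (auto simp: dbit_def set_dsuffixes intro!: exI[of _ i])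
qed

text \<open>A list of length \<open>n\<close> has \<open>n + 1\<close> suffixes. The empty one, at
  \<open>i = n\<close>, has head \<open>Nl\<close> and stands for no position.\<close>

lemma all_le_iff_all_less:
  fixes n :: nat
  assumes "\<And>i. i \<le> n \<Longrightarrow> p i \<longleftrightarrow> (i < n \<longrightarrow> q i)"
  shows "(\<forall>i\<le>n. p i) \<longleftrightarrow> (\<forall>i<n. q i)"
  using assms less_imp_le by blast

lemma ex_le_iff_ex_less:
  fixes n :: nat
  assumes "\<And>i. i \<le> n \<Longrightarrow> p i \<longleftrightarrow> i < n \<and> q i"
  shows "(\<exists>i\<le>n. p i) \<longleftrightarrow> (\<exists>i<n. q i)"
  using assms less_imp_le by blast

lemma ball_dsuffixes_iff:
  assumes "length xs = n" "length ys = n"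
  shows "(\<forall>s\<in>set (dl (dsuffixes (enc_list xs))). hd_data s \<noteq> Nl \<longrightarrow> dbit (enc_list ys) s)
    \<longleftrightarrow> (\<forall>i<n. xs ! i \<noteq> Nl \<longrightarrow> ys ! i \<noteq> Nl)"
proof -
  have *: "(hd_data (enc_list (drop i xs)) \<noteq> Nl \<longrightarrow> dbit (enc_list ys) (enc_list (drop i xs)))
      \<longleftrightarrow> (i < n \<longrightarrow> xs ! i \<noteq> Nl \<longrightarrow> ys ! i \<noteq> Nl)" if "i \<le> n" for i
  proof (cases "i < n")
    case True
    then show ?thesis using assms hd_enc_list_drop[of i xs] dbit_iff[of ys n "enc_list (drop i xs)" i] by simp
  qed (use that assms in auto)
  have "(\<forall>s\<in>set (dl (dsuffixes (enc_list xs))). Q s) \<longleftrightarrow> (\<forall>i\<le>n. Q (enc_list (drop i xs)))" for Q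
    unfolding set_dsuffixes using assms by auto
  then show ?thesis by (rule trans) (rule all_le_iff_all_less[OF *])
qed

lemma dmeets_iff:
  assumes "length xs = n" "length ys = n"
  shows "dmeets (enc_list xs) (enc_list ys) \<longleftrightarrow> (\<exists>i<n. xs ! i \<noteq> Nl \<and> ys ! i \<noteq> Nl)"
proof -
  have *: "hd_data (enc_list (drop i xs)) \<noteq> Nl \<and> dbit (enc_list ys) (enc_list (drop i xs))
      \<longleftrightarrow> i < n \<and> xs ! i \<noteq> Nl \<and> ys ! i \<noteq> Nl" if "i \<le> n" for i
  proof (cases "i < n")
    case True
    then show ?thesis using assms hd_enc_list_drop[of i xs] dbit_iff[of ys n "enc_list (drop i xs)" i] by simp
  qed (use that assms in auto)
  have "(\<exists>s\<in>set (dl (dsuffixes (enc_list xs))). Q s) \<longleftrightarrow> (\<exists>i\<le>n. Q (enc_list (drop i xs)))" for Q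
    unfolding set_dsuffixes using assms by auto
  then show ?thesis unfolding dmeets_def by (rule trans) (rule ex_le_iff_ex_less[OF *])
qed

lemma bval_bits: "bval (bits m) = m"
proof (induction m rule: less_induct)
  case (less m)
  show ?case
  proof (cases "m = 0")
    case False
    then have "bval (bits m) = (if odd m then 1 else 0) + 2 * (m div 2)"
      using less[of "m div 2"] by (subst bits.simps) auto
    then show ?thesis by presburger
  qed (simp add: bits.simps)
qed

lemma power_le_of_length_bits: "k < length (bits m) \<Longrightarrow> 2 ^ k \<le> m"
proof (induction k arbitrary: m)
  case 0
  then show ?case by (cases "m = 0") (auto simp: bits.simps)
next
  case (Suc k)
  have "bits m = (if m = 0 then [] else odd m # bits (m div 2))" by (rule bits.simps)
  with Suc.prems have "k < length (bits (m div 2))" by (auto split: if_splits)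
  from Suc.IH[OF this] show ?case by simp
qed

lemma bval_append: "bval (xs @ ys) = bval xs + 2 ^ length xs * bval ys"
  by (induction xs) (auto simp: algebra_simps)

text \<open>If digits were cut off, both numbers are at least \<open>2 ^ k\<close>, which exceeds
  \<open>k\<close> and hence \<open>m\<close>, so both comparisons succeed; otherwise the number is
  unchanged.\<close>

lemma bval_truncated:
  assumes "m \<le> k"
  shows "m \<le> bval (take k (bits b) @ (if k < length (bits b) then [True] else [])) \<longleftrightarrow> m \<le> b"
proof (cases "k < length (bits b)")
  case True
  have "m < 2 ^ k" using assms less_le_trans less_exp le_less_trans by blast
  moreover have "2 ^ k \<le> b" using power_le_of_length_bits[OF True] .
  ultimately show ?thesis using True by (auto simp: bval_append)
qed (simp add: bval_bits)

lemma dl_dtrunc: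
  "dl (dtrunc l (enc_list bs) a)
    = (if length (dl l) < length bs then [Cns Nl Nl] else []) @ rev (take (length (dl l)) bs) @ dl a"
proof (induction l arbitrary: bs a)
  case Nl
  then show ?case by (cases bs) auto
next
  case (Cns x l)
  then show ?case by (cases bs) auto
qed

section \<open>Encoded networks\<close>

lemma dzip_enc_list:
  "dzip r (enc_list (map f xs)) (enc_list (map g xs)) (enc_list (map h xs))
    = enc_list (map (\<lambda>x. Cns (f x) (Cns (g x) (dtrunc r (h x) Nl))) xs)"
  by (induction xs) auto

lemma set_ddup: "set (dl (ddup d)) = {Cns b x | b x. b \<in> {Cns Nl Nl, Nl} \<and> x \<in>\<^sub>d d}"
  by (induction d) auto

lemma set_dpow:
  "set (dl (dpow d)) = {enc_list (map enc_bool bs) | bs. length bs = length (dl d)}"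
proof (induction d)
  case (Cns x d)
  have "{Cns b y | b y. b \<in> {Cns Nl Nl, Nl} \<and> y \<in> {enc_list (map enc_bool bs) | bs. length bs = m}}
      = {enc_list (map enc_bool bs) | bs. length bs = Suc m}" (is "?L = ?R") for m
  proof (intro equalityI subsetI)
    fix y assume "y \<in> ?L"
    then obtain bs where bs: "length bs = m"
      "y = Cns (Cns Nl Nl) (enc_list (map enc_bool bs)) \<or> y = Cns Nl (enc_list (map enc_bool bs))" by blast
    then obtain b where "y = Cns (enc_bool b) (enc_list (map enc_bool bs))" by (metis enc_bool_simps)
    with bs(1) show "y \<in> ?R" by (intro CollectI exI[of _ "b # bs"]) auto
  next
    fix y assume "y \<in> ?R"
    then obtain b bs where "y = Cns (enc_bool b) (enc_list (map enc_bool bs))" "length bs = m"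
      by (auto simp: length_Suc_conv)
    then show "y \<in> ?L" by (cases b) auto
  qed
  with Cns show ?case by (simp add: set_ddup)
qed auto

definition enc_set :: "'c list \<Rightarrow> 'c set \<Rightarrow> data" where
  "enc_set cs S = enc_list (map (\<lambda>c. enc_bool (c \<in> S)) cs)"

lemma set_dpow_enc_set:
  assumes "distinct cs" and "length (dl d) = length cs"
  shows "set (dl (dpow d)) = enc_set cs ` Pow (set cs)"
proof (intro equalityI subsetI)
  fix x assume "x \<in>\<^sub>d dpow d"
  then obtain bs where bs: "x = enc_list (map enc_bool bs)" "length bs = length cs"
    unfolding set_dpow using assms(2) by auto
  let ?S = "{cs ! i | i. i < length cs \<and> bs ! i}"
  have "map (\<lambda>c. c \<in> ?S) cs = bs"
    using bs(2) assms(1) by (intro nth_equalityI) (auto simp: nth_eq_iff_index_eq)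
  then have "map (\<lambda>c. enc_bool (c \<in> ?S)) cs = map enc_bool bs" by (metis (no_types, lifting) list.map_comp map_eq_conv o_apply)
  then have "x = enc_set cs ?S" by (simp add: bs enc_set_def)
  then show "x \<in> enc_set cs ` Pow (set cs)" by auto
next
  fix x assume "x \<in> enc_set cs ` Pow (set cs)"
  then obtain S where "x = enc_list (map enc_bool (map (\<lambda>c. c \<in> S) cs))" by (auto simp: enc_set_def comp_def)
  then show "x \<in>\<^sub>d dpow d" unfolding set_dpow using assms(2)
    by (intro CollectI exI[of _ "map (\<lambda>c. c \<in> S) cs"]) simp
qed

lemma dmeets_enc_set:
  assumes "S \<subseteq> set cs" "S' \<subseteq> set cs"
  shows "dmeets (enc_set cs S) (enc_set cs S') \<longleftrightarrow> S \<inter> S' \<noteq> {}"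
proof -
  have "dmeets (enc_set cs S) (enc_set cs S') \<longleftrightarrow> (\<exists>i<length cs. cs ! i \<in> S \<and> cs ! i \<in> S')"
    unfolding enc_set_def by (subst dmeets_iff[of _ "length cs"]) auto
  also have "\<dots> \<longleftrightarrow> (\<exists>c\<in>set cs. c \<in> S \<and> c \<in> S')"
    using all_set_conv_all_nth[of cs "\<lambda>c. \<not> (c \<in> S \<and> c \<in> S')"] by blast
  also have "\<dots> \<longleftrightarrow> S \<inter> S' \<noteq> {}" using assms by blast
  finally show ?thesis .
qed

locale encoded_network = cognitive_radio_network N for N :: "(nat, nat) crn" +
  fixes us cs :: "nat list" and w :: nat
  assumes us: "distinct us" "set us = users N" and cs: "distinct cs" "set cs = channels N"
begin

abbreviation "n \<equiv> length us"
abbreviation "k \<equiv> length cs"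
abbreviation "E \<equiv> parcs (potential_graph N)"

definition "specs = enc_matrix (\<lambda>u c. c \<in> spec_map N u) us cs"
definition "adjs = enc_matrix (\<lambda>u v. (u, v) \<in> E) us us"
definition "budgets = enc_list (map (\<lambda>u. enc_nat (budget N u)) us)"
definition "row = hd_data specs"

definition "record_of u = Cns (enc_set cs (spec_map N u))
    (Cns (enc_set us {v. (u, v) \<in> E}) (dtrunc row (enc_nat (budget N u)) Nl))"

definition "records = enc_list (map record_of us)"

definition vertex :: "nat \<Rightarrow> data" where
  "vertex i = enc_list (drop i (map record_of us))"

lemma dzip_network: "dzip row specs adjs budgets = records"
  unfolding specs_def adjs_def budgets_def enc_matrix_def dzip_enc_list records_def record_of_def enc_set_def
  by simp

lemma set_dverts: "set (dl (dverts records)) = vertex ` {..<n}"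
proof -
  have "vertex i \<noteq> Nl \<longleftrightarrow> i < n" for i by (auto simp: vertex_def)
  moreover have "set (dl (dsuffixes records)) = vertex ` {..n}"
    by (auto simp: records_def set_dsuffixes vertex_def)
  ultimately show ?thesis by (auto simp: dverts_def)
qed

lemma length_vertex: "length (dl (vertex i)) = n - i"
  by (simp add: vertex_def)

lemma hd_vertex: "i < n \<Longrightarrow> hd_data (vertex i) = record_of (us ! i)"
  unfolding vertex_def by (subst hd_enc_list_drop) auto

text \<open>Different suffixes have different lengths, even if the users have equal records.\<close>

lemma inj_vertex: "inj_on vertex {..<n}"
  by (rule inj_onI) (metis diff_diff_cancel length_vertex lessThan_iff less_imp_le)

lemma length_row: "n \<noteq> 0 \<Longrightarrow> length (dl row) = k"
  unfolding row_def specs_def enc_matrix_def by (cases us) auto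

lemma length_row_le: "length (dl row) \<le> k"
  unfolding row_def specs_def enc_matrix_def by (cases us) auto

lemma dadj_vertex: "i < n \<Longrightarrow> j < n \<Longrightarrow> dadj (vertex i) (vertex j) \<longleftrightarrow> (us ! i, us ! j) \<in> E"
  unfolding dadj_def hd_vertex record_of_def enc_set_def
  by (simp add: dbit_iff[of _ n _ j] length_vertex)

lemma dallowed_vertex:
  assumes i: "i < n" and S: "S \<subseteq> set cs"
  shows "dallowed (vertex i) (enc_set cs S) \<longleftrightarrow> S \<subseteq> spec_map N (us ! i) \<and> card S \<le> budget N (us ! i)"
proof -
  let ?u = "us ! i"
  have "n \<noteq> 0" using i by auto
  note k = length_row[OF this]
  have "(\<forall>s\<in>set (dl (dsuffixes (enc_set cs S))). hd_data s \<noteq> Nl \<longrightarrow> dbit (enc_set cs (spec_map N ?u)) s)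
      \<longleftrightarrow> (\<forall>j<k. cs ! j \<in> S \<longrightarrow> cs ! j \<in> spec_map N ?u)"
    unfolding enc_set_def by (subst ball_dsuffixes_iff[of _ k]) auto
  also have "\<dots> \<longleftrightarrow> S \<subseteq> spec_map N ?u"
    using S all_set_conv_all_nth[of cs "\<lambda>c. c \<in> S \<longrightarrow> c \<in> spec_map N ?u"] by blast
  finally have sub: "(\<forall>s\<in>set (dl (dsuffixes (enc_set cs S))). hd_data s \<noteq> Nl \<longrightarrow> dbit (enc_set cs (spec_map N ?u)) s)
      \<longleftrightarrow> S \<subseteq> spec_map N ?u" .
  let ?b = "budget N ?u"
  have "filter (\<lambda>x. x \<noteq> Nl) (map (\<lambda>c. enc_bool (c \<in> S)) cs) = map (\<lambda>c. enc_bool (c \<in> S)) (filter (\<lambda>c. c \<in> S) cs)"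
    by (simp add: filter_map comp_def)
  then have len: "length (dl (dfilter (\<lambda>x. x \<noteq> Nl) (enc_set cs S))) = card S"
    using S cs(1) distinct_card[of "filter (\<lambda>c. c \<in> S) cs"] by (simp add: enc_set_def Int_absorb1 Int_def[symmetric] Collect_conj_eq)
  have "map (\<lambda>x. x \<noteq> Nl) (rev (dl (dtrunc row (enc_nat ?b) Nl)))
      = take k (bits ?b) @ (if k < length (bits ?b) then [True] else [])"
    unfolding enc_nat_def dl_dtrunc by (auto simp: k rev_map take_map comp_def)
  moreover have "card S \<le> k" using S card_mono[of "set cs" S] card_length[of cs] by simp
  ultimately have "dle_bits (dfilter (\<lambda>x. x \<noteq> Nl) (enc_set cs S)) (dtrunc row (enc_nat ?b) Nl) \<longleftrightarrow> card S \<le> ?b"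
    unfolding dle_bits_iff len using bval_truncated[of "card S" k ?b] by simp
  with sub show ?thesis unfolding dallowed_def hd_vertex[OF i] record_of_def by simp
qed

sublocale data_problem "dverts records" "dpow row" w
proof
  fix u v assume "u \<in>\<^sub>d dverts records" "v \<in>\<^sub>d dverts records" "dadj u v"
  then show "dadj v u"
    using pair_graph_facts(2)[OF potential_graph] unfolding set_dverts by (auto simp: dadj_vertex dest: symD)
qed

section \<open>Transfer between users and vertices\<close>

definition user_of :: "data \<Rightarrow> nat" where
  "user_of v = us ! inv_into {..<n} vertex v"

definition vertex_of :: "nat \<Rightarrow> data" where
  "vertex_of u = vertex (inv_into {..<n} ((!) us) u)"

lemma inj_nth: "inj_on ((!) us) {..<n}"
  using us(1) by (auto simp: inj_on_def nth_eq_iff_index_eq)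

lemma user_of_vertex [simp]: "i < n \<Longrightarrow> user_of (vertex i) = us ! i"
  unfolding user_of_def by (subst inv_into_f_f[OF inj_vertex]) auto

lemma vertex_of_nth [simp]: "i < n \<Longrightarrow> vertex_of (us ! i) = vertex i"
  unfolding vertex_of_def by (subst inv_into_f_f[OF inj_nth]) auto

lemma users_nth: "u \<in> users N \<Longrightarrow> \<exists>i<n. u = us ! i"
  unfolding us(2)[symmetric] by (auto simp: in_set_conv_nth)

lemma nth_users: "i < n \<Longrightarrow> us ! i \<in> users N"
  unfolding us(2)[symmetric] by simp

lemma arcs_users: "(u, v) \<in> E \<Longrightarrow> u \<in> users N \<and> v \<in> users N"
  using pair_graph_facts(1)[OF potential_graph] potential_verts by auto

lemma connected_realization_iff:
  "connected (with_proj (realization_graph N SA)) \<longleftrightarrow>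
    users N \<noteq> {} \<and> users N \<times> users N \<subseteq> (parcs (realization_graph N SA))\<^sup>*"
proof -
  have "sym (parcs (realization_graph N SA))"
    using pair_graph_facts(2)[OF potential_graph] by (auto simp: realization_graph_def sym_def)
  moreover have "parcs (realization_graph N SA) \<subseteq> users N \<times> users N"
    using arcs_users by (auto simp: realization_graph_def)
  ultimately show ?thesis
    using connected_iff_rtrancl[of "with_proj (realization_graph N SA)"] by (simp add: realization_graph_def)
qed

text \<open>The bijection between users and vertices maps realized edges to realized edges, so walks
  are transported edge by edge.\<close>

lemma connectable_imp_solvable: "connectable N \<Longrightarrow> solvable"
proof -
  assume "connectable N"
  then obtain SA where SA: "spectrum_assignment N SA" and ne: "users N \<noteq> {}"
    and conn: "users N \<times> users N \<subseteq> (parcs (realization_graph N SA))\<^sup>*"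
    by (auto simp: connectable_def connected_realization_iff)
  have n: "n \<noteq> 0" using ne us(2) by auto
  have SAu: "SA u \<subseteq> spec_map N u" "card (SA u) \<le> budget N u" "SA u \<subseteq> set cs" if "u \<in> users N" for u
    using SA that spec_map_subset[OF that] cs(2) by (auto simp: spectrum_assignment_def)
  define A where "A v = enc_set cs (SA (user_of v))" for v
  have "A v \<in> allowed v" if v: "v \<in>\<^sub>d dverts records" for v
  proof -
    from v obtain i where i: "i < n" "v = vertex i" by (auto simp: set_dverts)
    with SAu[OF nth_users[OF i(1)]] show ?thesis
      unfolding set_dpow_enc_set[OF cs(1) length_row[OF n]] by (simp add: A_def dallowed_vertex)
  qed
  moreover have "set (dl (dverts records)) \<times> set (dl (dverts records)) \<subseteq> (realized A)\<^sup>*"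
  proof
    fix e assume "e \<in> set (dl (dverts records)) \<times> set (dl (dverts records))"
    then obtain i j where e: "e = (vertex i, vertex j)" "i < n" "j < n" by (auto simp: set_dverts)
    have step: "(vertex_of u, vertex_of v) \<in> realized A" if "(u, v) \<in> parcs (realization_graph N SA)" for u v
    proof -
      from that have uv: "(u, v) \<in> E" "SA u \<inter> SA v \<noteq> {}" by (auto simp: realization_graph_def)
      with arcs_users users_nth obtain i j where ij: "i < n" "u = us ! i" "j < n" "v = us ! j" by blast
      have "dmeets (A (vertex i)) (A (vertex j))"
        using uv(2) ij SAu(3)[OF nth_users] by (simp add: A_def dmeets_enc_set)
      moreover have "vertex i \<in>\<^sub>d dverts records" "vertex j \<in>\<^sub>d dverts records"
        using ij by (auto simp: set_dverts)
      ultimately show ?thesis using ij uv(1) by (simp add: realized_def dadj_vertex)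
    qed
    have "(vertex_of x, vertex_of y) \<in> (realized A)\<^sup>*" if "(x, y) \<in> (parcs (realization_graph N SA))\<^sup>*" for x y
      using that by (induction rule: rtrancl_induct) (auto dest: step intro: rtrancl_into_rtrancl)
    moreover have "(us ! i, us ! j) \<in> (parcs (realization_graph N SA))\<^sup>*" using conn nth_users e by blast
    ultimately show "e \<in> (realized A)\<^sup>*" using e by fastforce
  qed
  moreover have "set (dl (dverts records)) \<noteq> {}" using n by (auto simp: set_dverts)
  ultimately show solvable unfolding solvable_def by blast
qed

lemma solvable_imp_connectable: "solvable \<Longrightarrow> connectable N"
proof -
  assume solvable
  then obtain A where ne: "set (dl (dverts records)) \<noteq> {}"
    and A: "\<And>v. v \<in>\<^sub>d dverts records \<Longrightarrow> A v \<in> allowed v"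
    and conn: "set (dl (dverts records)) \<times> set (dl (dverts records)) \<subseteq> (realized A)\<^sup>*"
    unfolding solvable_def by blast
  have n: "n \<noteq> 0" using ne by (auto simp: set_dverts)
  \<comment> \<open>Every listed state encodes a channel set, which can be recovered from
    it.\<close>
  have "\<exists>S. S \<subseteq> set cs \<and> A (vertex i) = enc_set cs S" if "i < n" for i
    using A[of "vertex i"] that unfolding set_dpow_enc_set[OF cs(1) length_row[OF n]] by (auto simp: set_dverts)
  then obtain D where D: "\<And>i. i < n \<Longrightarrow> D i \<subseteq> set cs \<and> A (vertex i) = enc_set cs (D i)" by metis
  define SA where "SA u = D (inv_into {..<n} ((!) us) u)" for u
  have SA: "SA (us ! i) = D i" if "i < n" for i
    unfolding SA_def by (subst inv_into_f_f[OF inj_nth]) (use that in auto)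
  have "spectrum_assignment N SA"
    unfolding spectrum_assignment_def
  proof
    fix u assume "u \<in> users N"
    from users_nth[OF this] obtain i where i: "i < n" "u = us ! i" by blast
    then have "dallowed (vertex i) (A (vertex i))" using A[of "vertex i"] by (auto simp: set_dverts)
    with i D[OF i(1)] show "SA u \<subseteq> spec_map N u \<and> card (SA u) \<le> budget N u"
      by (simp add: SA dallowed_vertex)
  qed
  moreover have "users N \<times> users N \<subseteq> (parcs (realization_graph N SA))\<^sup>*"
  proof
    fix e assume "e \<in> users N \<times> users N"
    then obtain i j where e: "e = (us ! i, us ! j)" "i < n" "j < n" using users_nth by blast
    have step: "(user_of u, user_of v) \<in> parcs (realization_graph N SA)" if "(u, v) \<in> realized A" for u v
    proof -
      from that have uv: "u \<in>\<^sub>d dverts records" "v \<in>\<^sub>d dverts records" "dadj u v" "dmeets (A u) (A v)"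
        by (auto simp: realized_def)
      then obtain i j where ij: "i < n" "u = vertex i" "j < n" "v = vertex j" by (auto simp: set_dverts)
      have "SA (us ! i) \<inter> SA (us ! j) \<noteq> {}"
        using uv(4) D[OF ij(1)] D[OF ij(3)] ij by (simp add: SA dmeets_enc_set)
      then show ?thesis using ij uv(3) by (simp add: realization_graph_def dadj_vertex)
    qed
    have "(user_of x, user_of y) \<in> (parcs (realization_graph N SA))\<^sup>*" if "(x, y) \<in> (realized A)\<^sup>*" for x y
      using that by (induction rule: rtrancl_induct) (auto dest: step intro: rtrancl_into_rtrancl)
    moreover have "(vertex i, vertex j) \<in> (realized A)\<^sup>*" using conn e by (auto simp: set_dverts)
    ultimately show "e \<in> (parcs (realization_graph N SA))\<^sup>*" using e by fastforce
  qed
  moreover have "users N \<noteq> {}" using n us(2) by auto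
  ultimately show "connectable N" by (auto simp: connectable_def connected_realization_iff)
qed

lemma rooted_decomposition_vertices:
  fixes top :: "nat \<Rightarrow> nat"
  assumes "rooted_decomposition (users N) (\<lambda>u v. (u, v) \<in> E) m parent B top"
  shows "rooted_decomposition (set (dl (dverts records))) adj m parent (\<lambda>i. vertex_of ` B i) (top \<circ> user_of)"
proof -
  interpret R: rooted_decomposition "users N" "\<lambda>u v. (u, v) \<in> E" m parent B top by fact
  have img: "vertex i \<in> vertex_of ` B t \<longleftrightarrow> us ! i \<in> B t" if i: "i < n" and t: "t < m" for i t
  proof
    assume "vertex i \<in> vertex_of ` B t"
    then obtain u where u: "u \<in> B t" "vertex i = vertex_of u" by blast
    with users_nth R.B_V[OF t] obtain j where j: "j < n" "u = us ! j" by blast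
    with u i inj_vertex show "us ! i \<in> B t" by (auto simp: inj_on_def)
  qed (use i in \<open>auto intro: image_eqI[of _ _ "us ! i"]\<close>)
  show ?thesis
  proof
    show "parent i < i" if "0 < i" "i < m" for i by (rule R.parent_less[OF that])
    show "vertex_of ` B i \<subseteq> set (dl (dverts records))" if i: "i < m" for i
    proof
      fix v assume "v \<in> vertex_of ` B i"
      then obtain u where "u \<in> users N" "v = vertex_of u" using R.B_V[OF i] by blast
      with users_nth show "v \<in>\<^sub>d dverts records" by (fastforce simp: set_dverts)
    qed
    show "\<exists>i<m. u \<in> vertex_of ` B i \<and> v \<in> vertex_of ` B i" if "adj u v" for u v
    proof -
      from that obtain i j where ij: "i < n" "u = vertex i" "j < n" "v = vertex j" by (auto simp: set_dverts)
      with that have "(us ! i, us ! j) \<in> E" by (simp add: dadj_vertex)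
      from R.adj_B[OF this] ij img show ?thesis by auto
    qed
    show "(top \<circ> user_of) v < m \<and> v \<in> vertex_of ` B ((top \<circ> user_of) v)" if "v \<in>\<^sub>d dverts records" for v
    proof -
      from that obtain i where i: "i < n" "v = vertex i" by (auto simp: set_dverts)
      with R.top[OF nth_users[OF i(1)]] img show ?thesis by simp
    qed
    show "0 < i \<and> v \<in> vertex_of ` B (parent i)"
      if i: "i < m" "v \<in> vertex_of ` B i" "i \<noteq> (top \<circ> user_of) v" for i v
    proof -
      from i(2) R.B_V[OF i(1)] users_nth obtain j where j: "j < n" "v = vertex j" "us ! j \<in> B i"
        by fastforce
      with i have "0 < i \<and> us ! j \<in> B (parent i)" using R.top_parent[OF i(1)] by simp
      with j show ?thesis by (auto intro: image_eqI[of _ _ "us ! j"])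
    qed
  qed
qed

lemma ddecide_iff:
  assumes "treewidth (potential_graph N) \<le> w"
  shows "ddecide w records (dpow row) \<longleftrightarrow> connectable N"
proof
  assume "ddecide w records (dpow row)"
  then show "connectable N"
    unfolding ddecide_def using derived_final_solvable solvable_imp_connectable by blast
next
  assume c: "connectable N"
  \<comment> \<open>A connectable network has users, which is what the choice of a non-empty root
    bag requires.\<close>
  then have "users N \<noteq> {}" by (auto simp: connectable_def connected_realization_iff)
  then have "pverts (potential_graph N) \<noteq> {}" by (simp add: potential_verts)
  from treewidth_rooted_decomposition[OF potential_graph assms this] obtain m parent B and top :: "nat \<Rightarrow> nat"
    where R: "rooted_decomposition (users N) (\<lambda>u v. (u, v) \<in> E) m parent B top"
      and B: "\<And>i. i < m \<Longrightarrow> card (B i) \<le> Suc w" "0 < m" "B 0 \<noteq> {}"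
    unfolding potential_verts by metis
  have "card (vertex_of ` B i) \<le> Suc w" if "i < m" for i
  proof -
    have "finite (B i)" using rooted_decomposition.B_V[OF R that] finite_users by (rule finite_subset)
    from card_image_le[OF this, of vertex_of] B(1)[OF that] show ?thesis by simp
  qed
  from solvable_derived_final[OF rooted_decomposition_vertices[OF R] this] B c connectable_imp_solvable
  show "ddecide w records (dpow row)" by (auto simp: ddecide_def)
qed

end

section \<open>Size and time bounds\<close>

lemma sz_enc_bool_list: "sz (enc_list (map (\<lambda>x. enc_bool (p x)) xs)) \<le> 1 + 4 * length xs"
  using sz_enc_list_le[of "map (\<lambda>x. enc_bool (p x)) xs" 3] sz_enc_bool by (auto simp: mult.commute)

context encoded_network
begin

text \<open>At most \<open>k + 1\<close> digits of a budget survive truncation, so the bound is free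
  of the budgets.\<close>

lemma sz_record: "sz (record_of u) \<le> 11 + 8 * k + 4 * n"
proof -
  have "sz x \<le> 3" if "x \<in>\<^sub>d dtrunc row (enc_nat (budget N u)) Nl" for x
    using that by (auto simp: enc_nat_def dl_dtrunc sz_enc_bool split: if_splits dest!: in_set_takeD)
  from sz_enc_list_le[of "dl (dtrunc row (enc_nat (budget N u)) Nl)", OF this]
  have "sz (dtrunc row (enc_nat (budget N u)) Nl) \<le> 1 + length (dl (dtrunc row (enc_nat (budget N u)) Nl)) * (3 + 1)"
    by simp
  moreover have "length (dl (dtrunc row (enc_nat (budget N u)) Nl)) \<le> k + 1"
    using length_row_le by (auto simp: enc_nat_def dl_dtrunc)
  moreover have "sz (enc_set cs (spec_map N u)) \<le> 1 + 4 * k" "sz (enc_set us {v. (u, v) \<in> E}) \<le> 1 + 4 * n"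
    unfolding enc_set_def by (rule sz_enc_bool_list)+
  ultimately show ?thesis by (simp add: record_of_def)
qed

lemma sz_records: "sz records \<le> 1 + n * (12 + 8 * k + 4 * n)"
proof -
  have "x \<in> set (map record_of us) \<Longrightarrow> sz x \<le> 11 + 8 * k + 4 * n" for x using sz_record by auto
  from sz_enc_list_le[of "map record_of us", OF this] show ?thesis by (simp add: records_def algebra_simps)
qed

lemma sz_dpow_row: "sz (dpow row) \<le> 1 + 2 ^ k * (2 + 4 * k)"
proof -
  let ?k = "length (dl row)"
  have "sz x \<le> 1 + 4 * ?k" if "x \<in>\<^sub>d dpow row" for x
  proof -
    from that obtain bs where "length bs = ?k" "x = enc_list (map enc_bool bs)" by (auto simp: set_dpow)
    then show ?thesis using sz_enc_bool_list[of "\<lambda>b. b" bs] by simp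
  qed
  from sz_enc_list_le[of "dl (dpow row)", OF this] have "sz (dpow row) \<le> 1 + 2 ^ ?k * (2 + 4 * ?k)"
    by (simp add: length_dpow)
  also have "\<dots> \<le> 1 + 2 ^ k * (2 + 4 * k)"
    using length_row_le by (intro add_mono mult_mono power_increasing) auto
  finally show ?thesis .
qed

text \<open>\<open>?M\<close> dominates \<open>n + 1\<close>, \<open>k\<close> and
  \<open>2 ^ k\<close>, so the bounds on both sizes are absorbed by its square; 33 is
  \<open>3 + 24 + 6\<close>, from the constants, the records and the channel sets.\<close>

lemma szs_bound: "szs [records, dpow row] \<le> 33 * (2 ^ k * (n + 1)) ^ 2"
proof -
  let ?M = "2 ^ k * (n + 1)"
  have one: "(1 :: nat) \<le> 2 ^ k" by (rule one_le_power) simp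
  have "n + 1 \<le> ?M" using mult_le_mono1[OF one, of "n + 1"] by (simp only: mult_1)
  moreover have "k \<le> 2 ^ k" using less_exp[of k] by (rule less_imp_le)
  then have k: "k * 1 \<le> ?M" by (intro mult_mono) auto
  moreover have two: "2 ^ k * 1 \<le> ?M" by (intro mult_mono) auto
  ultimately have "n * (12 + 8 * k + 4 * n) \<le> ?M * (12 * ?M + 8 * ?M + 4 * ?M)"
    by (intro mult_mono add_mono) auto
  moreover have "2 ^ k * (2 + 4 * k) \<le> ?M * (2 * ?M + 4 * ?M)"
    using two k \<open>n + 1 \<le> ?M\<close> by (intro mult_mono add_mono) auto
  moreover have "1 \<le> ?M" using mult_le_mono[OF one, of 1 "n + 1"] by simp
  then have "1 * 1 \<le> ?M * ?M" using mult_le_mono by blast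
  ultimately have "szs [records, dpow row] \<le> 3 * (?M * ?M) + 24 * (?M * ?M) + 6 * (?M * ?M)"
    using sz_records sz_dpow_row by (simp add: algebra_simps)
  then show ?thesis by (simp add: power2_eq_square)
qed

lemma enc_network_eq: "enc_network N us cs = enc_list [specs, adjs, budgets]"
  by (simp add: enc_network_def specs_def adjs_def budgets_def)

end

text \<open>\<open>n + 1\<close> instead of \<open>n\<close> keeps the bound positive for the
  network without users, on which the program takes time as well.\<close>

theorem theorem10:
  fixes w :: nat
  shows "\<exists>P a b d. decides_connectability P
           {N. cognitive_radio_network N \<and> treewidth (potential_graph N) \<le> w}
           (\<lambda>n k. a * 2 ^ (b * k) * (n + 1) ^ d)"
proof -
  obtain p where "\<And>l. \<exists>e fs. computes l (Suc (Suc 0)) e fs (\<lambda>e. enc_bool (ddecide w (hd e) (hd (tl e)))) p"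
    using ptime_ddecide[of w] by (rule ptimeE) blast
  \<comment> \<open>Six functions precede the helper code in \<open>program_of\<close>, hence
    position 6.\<close>
  then obtain e fs
    where e: "computes 6 (Suc (Suc 0)) e fs (\<lambda>e. enc_bool (ddecide w (hd e) (hd (tl e)))) p"
    by blast
  define P where "P = program_of e fs"
  have eval_e: "evalb P [x, y] e (enc_bool (ddecide w x y)) (poly p (szs [x, y]))" for x y
    using computesD[OF e, of "[main_body, e, pow_body, dup_body, trunc_body, zip_body]" "[x, y]" "[]"]
    by (simp add: P_def program_of_def)
  obtain c d where cd: "\<And>x. x \<ge> 1 \<Longrightarrow> poly p x \<le> c * x ^ d" using poly_nat_bound[of p] by blast
  \<comment> \<open>\<open>a\<close> has to cover 80 for the records, 100 for the channel sets, 30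
    for the calls, and \<open>c * 33 ^ d\<close> for the decision, where 33 comes from
    \<open>szs_bound\<close>. The exponent \<open>b\<close> covers \<open>?M ^ 2\<close> for the
    records and \<open>?M ^ (2 * d)\<close> for the decision; as everything is bounded by powers of
    \<open>?M\<close>, it serves for \<open>2 ^ k\<close> and \<open>n + 1\<close> alike.\<close>
  define a where "a = 270 + c * 33 ^ d"
  define b where "b = 2 * d + 2"
  have "decides_connectability P {N. cognitive_radio_network N \<and> treewidth (potential_graph N) \<le> w}
           (\<lambda>n k. a * 2 ^ (b * k) * (n + 1) ^ b)"
    unfolding decides_connectability_def
  proof (intro allI impI, elim CollectE conjE)
    fix N :: "(nat, nat) crn" and us cs :: "nat list"
    assume N: "cognitive_radio_network N" and tw: "treewidth (potential_graph N) \<le> w"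
      and us: "listing us (users N)" and cs: "listing cs (channels N)"
    interpret cognitive_radio_network N by (rule N)
    interpret encoded_network N us cs w
      using us cs by unfold_locales (auto simp: listing_def)
    have card: "card (users N) = n" "card (channels N) = k"
      using us cs distinct_card[of us] distinct_card[of cs] by (auto simp: listing_def)
    let ?M = "2 ^ k * (n + 1)"
    let ?T = "(n + 1) * (20 * length (dl row) + 60) + 100 * 2 ^ length (dl row) +
      poly p (szs [records, dpow row]) + 30"
    have "length (dl specs) = n" by (simp add: specs_def enc_matrix_def)
    then have "evalb P [enc_network N us cs] main_body (enc_bool (ddecide w records (dpow row))) ?T"
      using evalb_main[OF P_def, of specs adjs budgets] eval_e
      by (simp add: enc_network_eq dzip_network row_def[symmetric])
    then obtain t where t: "t \<le> ?T" "eval P [enc_network N us cs] main_body (enc_bool (connectable N)) t"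
      by (auto simp: evalb_def ddecide_iff[OF tw])
    have "runs P (enc_network N us cs) (enc_bool (connectable N)) t"
      using t(2) by (simp add: runs_def P_def program_of_def)
    moreover have "t \<le> a * 2 ^ (b * k) * (n + 1) ^ b"
    proof -
      have "(1 :: nat) \<le> 2 ^ k" by (rule one_le_power) simp
      from mult_le_mono1[OF this, of "n + 1"] have N1: "n + 1 \<le> ?M" by (simp only: mult_1)
      then have M1: "1 \<le> ?M" by linarith
      have pow: "?M ^ i \<le> ?M ^ b" if "i \<le> b" for i using that M1 by (rule power_increasing)
      have "k \<le> 2 ^ k" using less_exp[of k] by (rule less_imp_le)
      then have k: "k * 1 \<le> ?M" by (intro mult_mono) auto
      have "(n + 1) * (20 * length (dl row) + 60) \<le> ?M * (20 * ?M + 60 * ?M)"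
        using length_row_le k M1 N1 by (intro mult_mono add_mono) auto
      also have "\<dots> = 80 * ?M ^ 2" by (simp add: power2_eq_square)
      also have "\<dots> \<le> 80 * ?M ^ b" using pow[of 2] by (intro mult_left_mono) (auto simp: b_def)
      finally have 1: "(n + 1) * (20 * length (dl row) + 60) \<le> 80 * ?M ^ b" .
      have "(2 :: nat) ^ length (dl row) \<le> 2 ^ k" using length_row_le by (intro power_increasing) auto
      also have "\<dots> \<le> ?M ^ 1" by simp
      also have "\<dots> \<le> ?M ^ b" by (rule pow) (simp add: b_def)
      finally have 2: "(2 :: nat) ^ length (dl row) \<le> ?M ^ b" .
      have "poly p (szs [records, dpow row]) \<le> c * szs [records, dpow row] ^ d"
        using szs_pos[of "[records, dpow row]"] by (intro cd) linarith
      also have "\<dots> \<le> c * (33 * ?M ^ 2) ^ d"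
        by (intro mult_left_mono power_mono szs_bound) auto
      also have "\<dots> = c * 33 ^ d * ?M ^ (2 * d)" by (simp add: power_mult_distrib power_mult)
      also have "\<dots> \<le> c * 33 ^ d * ?M ^ b" by (intro mult_left_mono pow) (auto simp: b_def)
      finally have 3: "poly p (szs [records, dpow row]) \<le> c * 33 ^ d * ?M ^ b" .
      have 4: "1 \<le> ?M ^ b" using pow[of 0] by simp
      have "t \<le> 80 * ?M ^ b + 100 * ?M ^ b + c * 33 ^ d * ?M ^ b + 30 * ?M ^ b"
        using t(1) 1 2 3 4 by linarith
      also have "\<dots> \<le> a * ?M ^ b" by (simp add: a_def algebra_simps)
      also have "?M ^ b = 2 ^ (b * k) * (n + 1) ^ b"
        by (simp only: power_mult_distrib power_mult[symmetric] mult.commute[of k b])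
      finally show ?thesis by (simp add: mult.assoc)
    qed
    ultimately show "\<exists>t. runs P (enc_network N us cs) (enc_bool (connectable N)) t \<and>
        t \<le> a * 2 ^ (b * card (channels N)) * (card (users N) + 1) ^ b"
      unfolding card by blast
  qed
  then show ?thesis by blast
qed

end
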